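(* Fix a time level $n\ge2$. Let $\{(\mathbf E_h^{n,i},\mathbf H_h^{n,i},\mathbf u_h^{n,i},\xi_h^{n,i},p_h^{n,i})\}_{i\ge1}\subset\mathbb S_h$ be the sequence generated by the iterative decoupling scheme, and let $(\mathbf E_h^n,\mathbf H_h^n,\mathbf u_h^n,\xi_h^n,p_h^n)\in\mathbb S_h$ be the solution of the monolithic BDF2 problem at $t_n$, both as described in the context. Denote the iterative errors by $$(\mathbf e_E^{n,i},\mathbf e_H^{n,i},\mathbf e_u^{n,i},e_\xi^{n,i},e_p^{n,i}):=(\mathbf E_h^{n,i}-\mathbf E_h^n,\ \mathbf H_h^{n,i}-\mathbf H_h^n,\ \mathbf u_h^{n,i}-\mathbf u_h^n,\ \xi_h^{n,i}-\xi_h^n,\ p_h^{n,i}-p_h^n).$$ Then, for all $i\ge1$, $$\|\nabla e_p^{n,i}\|_{L^2}\le\frac{L^2}{\kappa\left(\sigma+\frac{3\epsilon}{2\tau}\right)}\,\|\nabla e_p^{n,i-1}\|_{L^2},$$ where the multiplier is strictly smaller than one. Consequently the iteration is contractive, and $$\big(\|\mathbf e_E^{n,i}\|_{L^2},\ \|\mathbf e_H^{n,i}\|_{L^2},\ \|\mathbf e_u^{n,i}\|_{H^1},\ \|e_\xi^{n,i}\|_{L^2},\ \|e_p^{n,i}\|_{H^1}\big)\to\mathbf 0\quad\text{geometrically as }i\to\infty,$$ i.e. each component is bounded by $C r^i$ for some $C\ge0$ and some $r\in[0,1)$ independent of $i$.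
   Context: Setting. $\Omega\subset\mathbb R^3$ is a bounded Lipschitz polyhedron with outward unit normal $\mathbf n$; $\partial\Omega=\overline{\Gamma_D^u}\cup\overline{\Gamma_N^u}$ with $\Gamma_D^u,\Gamma_N^u$ non-empty, disjoint boundary parts (relatively open in $\partial\Omega$). $(\cdot,\cdot)$ is the $L^2(\Omega)$ inner product, $\|\cdot\|_{L^2}$ its norm, bold symbols denote $\mathbb R^3$-valued functions/spaces. Standing assumptions. $\epsilon,\sigma,\mu,G,\lambda,\alpha,\kappa,c_0>0$ and $0<L<\sqrt{\sigma\kappa}$; $\tau>0$ is the time step; $\mathbf h^n,\mathbf f^n\in\mathbf L^2(\Omega)$, $g^n\in L^2(\Omega)$ are the sources at $t_n=n\tau$. Finite elements. $\mathcal T_h$ is a shape-regular tetrahedral partition of $\Omega$. $P_j(K)$, $\widetilde P_j(K)$ are polynomials on $K$ of total degree $\le j$, resp. homogeneous of degree $j$; $\mathbf S_2(K)=\{\mathbf r\in\widetilde{\mathbf P}_2(K):\mathbf r(\mathbf x)\cdot\mathbf x=0\}$, $\mathbf R_2(K)=\mathbf P_1(K)\oplus\mathbf S_2(K)$. Then (conditions for all $K\in\mathcal T_h$) $\mathbb E_h=\{\mathbf D_h\in\mathbf L^2:\nabla\times\mathbf D_h\in\mathbf L^2,\ \mathbf D_h\times\mathbf n=\mathbf 0\text{ on }\partial\Omega,\ \mathbf D_h|_K\in\mathbf R_2(K)\}$, $\mathbb H_h=\{\mathbf B_h\in\mathbf L^2:\mathbf B_h|_K\in\mathbf P_1(K)\}$,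 $\mathbb U_h=\{\mathbf v_h\in\mathbf H^1\cap\mathbf C^0(\overline\Omega):\mathbf v_h=\mathbf 0\text{ on }\Gamma_D^u,\ \mathbf v_h|_K\in\mathbf P_2(K)\}$, $\mathbb W_h=\{w_h\in C^0(\overline\Omega):w_h|_K\in P_1(K)\}$, $\mathbb P_h=\{q_h\in H^1_0(\Omega)\cap C^0(\overline\Omega):q_h|_K\in P_2(K)\}$, $\mathbb S_h=\mathbb E_h\times\mathbb H_h\times\mathbb U_h\times\mathbb W_h\times\mathbb P_h$. The pair $(\mathbb U_h,\mathbb W_h)$ satisfies: there is $\tilde\beta>0$ independent of $h$ with $\tilde\beta\|w_h\|_{L^2}\le\sup_{\mathbf 0\ne\mathbf v_h\in\mathbb U_h}(\nabla\cdot\mathbf v_h,w_h)/\|\mathbf v_h\|_{H^1}$ for all $w_h\in\mathbb W_h$. Monolithic BDF2 problem at $t_n$. Given discrete solutions in $\mathbb S_h$ at levels $n-1,n-2$, and with $\bar\partial_t\chi_h^n=(3\chi_h^n-4\chi_h^{n-1}+\chi_h^{n-2})/(2\tau)$, find $(\mathbf E_h^n,\mathbf H_h^n,\mathbf u_h^n,\xi_h^n,p_h^n)\in\mathbb S_h$ with, for all $(\mathbf D_h,\mathbf B_h,\mathbf v_h,w_h,q_h)\in\mathbb S_h$, $$\epsilon(\bar\partial_t\mathbf E_h^n,\mathbf D_h)+\sigma(\mathbf E_h^n,\mathbf D_h)-(\mathbf H_h^n,\nabla\times\mathbf D_h)-L(\nabla p_h^n,\mathbf D_h)=(\mathbf h^n,\mathbf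 D_h),$$ $$\mu(\bar\partial_t\mathbf H_h^n,\mathbf B_h)+(\nabla\times\mathbf E_h^n,\mathbf B_h)=0,\qquad G(\nabla\mathbf u_h^n,\nabla\mathbf v_h)-(\xi_h^n,\nabla\cdot\mathbf v_h)=(\mathbf f^n,\mathbf v_h),$$ $$(\nabla\cdot\mathbf u_h^n,w_h)+\lambda^{-1}(\xi_h^n,w_h)-\alpha\lambda^{-1}(p_h^n,w_h)=0,$$ $$(c_0+\alpha^2\lambda^{-1})(\bar\partial_tp_h^n,q_h)-\alpha\lambda^{-1}(\bar\partial_t\xi_h^n,q_h)+\kappa(\nabla p_h^n,\nabla q_h)-L(\mathbf E_h^n,\nabla q_h)=(g^n,q_h).$$ Iterative decoupling scheme at $t_n$. It uses the same previous-level solutions at $n-1,n-2$ as the monolithic problem, $\bar\partial_t\chi_h^{n,i}:=(3\chi_h^{n,i}-4\chi_h^{n-1}+\chi_h^{n-2})/(2\tau)$, and the initialization $\chi_h^{n,0}=\chi_h^{n-1}$ for all five fields. For $i\ge1$: Step 1: given $p_h^{n,i-1}$, find $(\mathbf E_h^{n,i},\mathbf H_h^{n,i})\in\mathbb E_h\times\mathbb H_h$ with, for all $(\mathbf D_h,\mathbf B_h)\in\mathbb E_h\times\mathbb H_h$, $$\epsilon(\bar\partial_t\mathbf E_h^{n,i},\mathbf D_h)+\sigma(\mathbf E_h^{n,i},\mathbf D_h)-(\mathbf H_h^{n,i},\nabla\times\mathbf D_h)=L(\nabla p_h^{n,i-1},\mathbf D_h)+(\mathbf h^n,\mathbf D_h),\qquad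 \mu(\bar\partial_t\mathbf H_h^{n,i},\mathbf B_h)+(\nabla\times\mathbf E_h^{n,i},\mathbf B_h)=0.$$ Step 2: given $\mathbf E_h^{n,i}$, find $(\mathbf u_h^{n,i},\xi_h^{n,i},p_h^{n,i})\in\mathbb U_h\times\mathbb W_h\times\mathbb P_h$ with, for all $(\mathbf v_h,w_h,q_h)\in\mathbb U_h\times\mathbb W_h\times\mathbb P_h$, $$G(\nabla\mathbf u_h^{n,i},\nabla\mathbf v_h)-(\xi_h^{n,i},\nabla\cdot\mathbf v_h)=(\mathbf f^n,\mathbf v_h),\qquad (\nabla\cdot\mathbf u_h^{n,i},w_h)+\lambda^{-1}(\xi_h^{n,i},w_h)-\alpha\lambda^{-1}(p_h^{n,i},w_h)=0,$$ $$(c_0+\alpha^2\lambda^{-1})(\bar\partial_tp_h^{n,i},q_h)-\alpha\lambda^{-1}(\bar\partial_t\xi_h^{n,i},q_h)+\kappa(\nabla p_h^{n,i},\nabla q_h)=L(\mathbf E_h^{n,i},\nabla q_h)+(g^n,q_h).$$ *)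

theory Defs
  imports "HOL-Analysis.Analysis"
begin

type_synonym scal = "real^3 \<Rightarrow> real"
type_synonym vecf = "real^3 \<Rightarrow> real^3"

text \<open>Members of function spaces are represented by functions on the whole space whose values
  outside \<open>\<Omega>\<close> (or its closure, for continuous functions) are irrelevant.\<close>

definition L2 :: "(real^3) set \<Rightarrow> (real^3 \<Rightarrow> 'a::euclidean_space) set" where
  "L2 \<Omega> = {f. f \<in> borel_measurable (lebesgue_on \<Omega>)
              \<and> integrable (lebesgue_on \<Omega>) (\<lambda>x. (norm (f x))\<^sup>2)}"

definition L2_inner ::
    "(real^3) set \<Rightarrow> (real^3 \<Rightarrow> 'a::euclidean_space) \<Rightarrow> (real^3 \<Rightarrow> 'a) \<Rightarrow> real" where
  "L2_inner \<Omega> f g = (LINT x|lebesgue_on \<Omega>. f x \<bullet> g x)"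

definition L2_norm :: "(real^3) set \<Rightarrow> (real^3 \<Rightarrow> 'a::euclidean_space) \<Rightarrow> real" where
  "L2_norm \<Omega> f = sqrt (L2_inner \<Omega> f f)"

definition pderiv3 :: "3 \<Rightarrow> scal \<Rightarrow> scal" where
  "pderiv3 j f = (\<lambda>x. frechet_derivative f (at x) (axis j 1))"

primrec Ck :: "nat \<Rightarrow> scal \<Rightarrow> bool" where
  "Ck 0 f \<longleftrightarrow> continuous_on UNIV f"
| "Ck (Suc k) f \<longleftrightarrow> (\<forall>x. f differentiable (at x)) \<and> (\<forall>j. Ck k (pderiv3 j f))"

definition test_functions :: "(real^3) set \<Rightarrow> scal set" where
  "test_functions \<Omega> =
     {\<phi>. (\<forall>k. Ck k \<phi>) \<and> (\<exists>K. compact K \<and> K \<subseteq> \<Omega> \<and> (\<forall>x. x \<notin> K \<longrightarrow> \<phi> x = 0))}"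

definition test_fields :: "(real^3) set \<Rightarrow> vecf set" where
  "test_fields \<Omega> = {\<Phi>. \<forall>i. (\<lambda>x. \<Phi> x $ i) \<in> test_functions \<Omega>}"

definition classical_curl :: "vecf \<Rightarrow> vecf" where
  "classical_curl \<Phi> = (\<lambda>x. vector
     [pderiv3 2 (\<lambda>y. \<Phi> y $ 3) x - pderiv3 3 (\<lambda>y. \<Phi> y $ 2) x,
      pderiv3 3 (\<lambda>y. \<Phi> y $ 1) x - pderiv3 1 (\<lambda>y. \<Phi> y $ 3) x,
      pderiv3 1 (\<lambda>y. \<Phi> y $ 2) x - pderiv3 2 (\<lambda>y. \<Phi> y $ 1) x])"

definition is_weak_grad :: "(real^3) set \<Rightarrow> scal \<Rightarrow> vecf \<Rightarrow> bool" where
  "is_weak_grad \<Omega> u g \<longleftrightarrow> g \<in> L2 \<Omega> \<and>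
     (\<forall>\<phi>\<in>test_functions \<Omega>. \<forall>j.
        L2_inner \<Omega> u (pderiv3 j \<phi>) = - L2_inner \<Omega> (\<lambda>x. g x $ j) \<phi>)"

definition is_weak_curl :: "(real^3) set \<Rightarrow> vecf \<Rightarrow> vecf \<Rightarrow> bool" where
  "is_weak_curl \<Omega> D C \<longleftrightarrow> C \<in> L2 \<Omega> \<and>
     (\<forall>\<Phi>\<in>test_fields \<Omega>. L2_inner \<Omega> D (classical_curl \<Phi>) = L2_inner \<Omega> C \<Phi>)"

text \<open>Weak derivatives are unique only almost everywhere in \<open>\<Omega>\<close>; the choice below is
  immaterial because the operators are used under integrals over \<open>\<Omega>\<close> only.\<close>

definition wgrad :: "(real^3) set \<Rightarrow> scal \<Rightarrow> vecf" where
  "wgrad \<Omega> u = (SOME g. is_weak_grad \<Omega> u g)"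

definition wcurl :: "(real^3) set \<Rightarrow> vecf \<Rightarrow> vecf" where
  "wcurl \<Omega> D = (SOME C. is_weak_curl \<Omega> D C)"

text \<open>Row \<open>i\<close> of the Jacobian is the gradient of component \<open>i\<close>; the inner product on
  \<open>real^3^3\<close> is the Frobenius product.\<close>

definition wjac :: "(real^3) set \<Rightarrow> vecf \<Rightarrow> real^3 \<Rightarrow> real^3^3" where
  "wjac \<Omega> v = (\<lambda>x. \<chi> i. wgrad \<Omega> (\<lambda>y. v y $ i) x)"

definition wdiv :: "(real^3) set \<Rightarrow> vecf \<Rightarrow> scal" where
  "wdiv \<Omega> v = (\<lambda>x. \<Sum>i\<in>UNIV. wjac \<Omega> v x $ i $ i)"

definition H1 :: "(real^3) set \<Rightarrow> scal set" where
  "H1 \<Omega> = {u \<in> L2 \<Omega>. \<exists>g. is_weak_grad \<Omega> u g}"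

definition H1v :: "(real^3) set \<Rightarrow> vecf set" where
  "H1v \<Omega> = {v. \<forall>i. (\<lambda>x. v x $ i) \<in> H1 \<Omega>}"

definition H1_norm :: "(real^3) set \<Rightarrow> scal \<Rightarrow> real" where
  "H1_norm \<Omega> u = sqrt ((L2_norm \<Omega> u)\<^sup>2 + (L2_norm \<Omega> (wgrad \<Omega> u))\<^sup>2)"

definition H1v_norm :: "(real^3) set \<Rightarrow> vecf \<Rightarrow> real" where
  "H1v_norm \<Omega> v = sqrt ((L2_norm \<Omega> v)\<^sup>2 + (L2_norm \<Omega> (wjac \<Omega> v))\<^sup>2)"

definition H10 :: "(real^3) set \<Rightarrow> scal set" where
  "H10 \<Omega> = {u \<in> H1 \<Omega>. \<exists>\<phi>. (\<forall>k::nat. \<phi> k \<in> test_functions \<Omega>) \<and>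
                        (\<lambda>k. H1_norm \<Omega> (\<lambda>x. \<phi> k x - u x)) \<longlonglongrightarrow> 0}"

definition Hcurl :: "(real^3) set \<Rightarrow> vecf set" where
  "Hcurl \<Omega> = {D \<in> L2 \<Omega>. \<exists>C. is_weak_curl \<Omega> D C}"

text \<open>Near each boundary point, and after a rotation or reflection, the domain is the strict
  epigraph of a Lipschitz function of the first two coordinates.\<close>

definition lipschitz_boundary :: "(real^3) set \<Rightarrow> bool" where
  "lipschitz_boundary \<Omega> \<longleftrightarrow> (\<forall>x\<in>frontier \<Omega>.
     \<exists>(Q :: real^3 \<Rightarrow> real^3) M (\<psi> :: real^2 \<Rightarrow> real) r.
       orthogonal_transformation Q \<and> M-lipschitz_on UNIV \<psi> \<and> 0 < r \<and>
       (\<forall>y\<in>ball x r. y \<in> \<Omega> \<longleftrightarrow> \<psi> (vector [Q y $ 1, Q y $ 2]) < Q y $ 3))"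

text \<open>The library's \<open>polyhedron\<close> and \<open>polytope\<close> are convex; a polyhedral domain need not be.\<close>

definition lipschitz_polyhedron :: "(real^3) set \<Rightarrow> bool" where
  "lipschitz_polyhedron \<Omega> \<longleftrightarrow> open \<Omega> \<and> connected \<Omega> \<and> \<Omega> \<noteq> {} \<and> bounded \<Omega> \<and>
     (\<exists>\<P>. finite \<P> \<and> (\<forall>P\<in>\<P>. polytope P) \<and> closure \<Omega> = \<Union>\<P>) \<and> lipschitz_boundary \<Omega>"

definition boundary_parts :: "(real^3) set \<Rightarrow> (real^3) set \<Rightarrow> (real^3) set \<Rightarrow> bool" where
  "boundary_parts \<Omega> \<Gamma>D \<Gamma>N \<longleftrightarrow>
     openin (top_of_set (frontier \<Omega>)) \<Gamma>D \<and> openin (top_of_set (frontier \<Omega>)) \<Gamma>N \<and>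
     \<Gamma>D \<noteq> {} \<and> \<Gamma>N \<noteq> {} \<and> \<Gamma>D \<inter> \<Gamma>N = {} \<and> frontier \<Omega> = closure \<Gamma>D \<union> closure \<Gamma>N"

text \<open>The normal exists exactly where the boundary is locally flat, that is (for a polyhedron)
  off its edges and vertices.\<close>

definition outward_unit_normal :: "(real^3) set \<Rightarrow> real^3 \<Rightarrow> real^3 \<Rightarrow> bool" where
  "outward_unit_normal \<Omega> x \<nu> \<longleftrightarrow> norm \<nu> = 1 \<and>
     (\<exists>r>0. \<Omega> \<inter> ball x r = {y \<in> ball x r. \<nu> \<bullet> (y - x) < 0})"

text \<open>Elements are closed tetrahedra; \<open>triangulation\<close> makes the mesh finite and conforming.\<close>

definition tetrahedral_partition :: "(real^3) set \<Rightarrow> (real^3) set set \<Rightarrow> bool" where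
  "tetrahedral_partition \<Omega> \<T> \<longleftrightarrow>
     triangulation \<T> \<and> (\<forall>K\<in>\<T>. 3 simplex K) \<and> \<Union>\<T> = closure \<Omega>"

text \<open>Shape regularity is a property of a family of meshes: one constant bounds the ratio of the
  diameter to the inscribed radius of every element of every mesh.\<close>

definition shape_regular :: "(real^3) set set set \<Rightarrow> bool" where
  "shape_regular \<MM> \<longleftrightarrow>
     (\<exists>\<gamma>>0. \<forall>\<T>\<in>\<MM>. \<forall>K\<in>\<T>. \<exists>x. cball x (diameter K / \<gamma>) \<subseteq> K)"

text \<open>Exponents are multi-indices \<open>a :: 3 \<Rightarrow> nat\<close>.\<close>

definition Poly :: "nat \<Rightarrow> scal set" where
  "Poly j = {p. \<exists>c :: (3 \<Rightarrow> nat) \<Rightarrow> real.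
       p = (\<lambda>x. \<Sum>a | (\<Sum>i\<in>UNIV. a i) \<le> j. c a * (\<Prod>i\<in>UNIV. (x $ i) ^ a i))}"

definition Polyhom :: "nat \<Rightarrow> scal set" where
  "Polyhom j = {p. \<exists>c :: (3 \<Rightarrow> nat) \<Rightarrow> real.
       p = (\<lambda>x. \<Sum>a | (\<Sum>i\<in>UNIV. a i) = j. c a * (\<Prod>i\<in>UNIV. (x $ i) ^ a i))}"

definition Polyv :: "nat \<Rightarrow> vecf set" where
  "Polyv j = {r. \<forall>i. (\<lambda>x. r x $ i) \<in> Poly j}"

definition S2 :: "vecf set" where
  "S2 = {r. (\<forall>i. (\<lambda>x. r x $ i) \<in> Polyhom 2) \<and> (\<forall>x. r x \<bullet> x = 0)}"

definition R2 :: "vecf set" where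
  "R2 = {(\<lambda>x. p x + s x) | p s. p \<in> Polyv 1 \<and> s \<in> S2}"

text \<open>\<open>r K\<close> is the polynomial representing \<open>D\<close> on \<open>K\<close>, so its values on a boundary facet of
  \<open>K\<close> are the trace of \<open>D\<close>.  Only two-dimensional facets contained in the boundary count: an
  element meeting the boundary in a vertex or an edge carries no tangential condition there.\<close>

definition E_space :: "(real^3) set \<Rightarrow> (real^3) set set \<Rightarrow> vecf set" where
  "E_space \<Omega> \<T> = {D \<in> Hcurl \<Omega>. \<exists>r. \<forall>K\<in>\<T>.
       r K \<in> R2 \<and> (AE x in lebesgue_on K. D x = r K x) \<and>
       (\<forall>F. F facet_of K \<and> F \<subseteq> frontier \<Omega> \<longrightarrow>
          (\<forall>x\<in>F. \<forall>\<nu>. outward_unit_normal \<Omega> x \<nu> \<longrightarrow> cross3 (r K x) \<nu> = 0))}"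

definition H_space :: "(real^3) set \<Rightarrow> (real^3) set set \<Rightarrow> vecf set" where
  "H_space \<Omega> \<T> = {B \<in> L2 \<Omega>. \<forall>K\<in>\<T>. \<exists>r\<in>Polyv 1. AE x in lebesgue_on K. B x = r x}"

definition U_space :: "(real^3) set \<Rightarrow> (real^3) set \<Rightarrow> (real^3) set set \<Rightarrow> vecf set" where
  "U_space \<Omega> \<Gamma>D \<T> = {v \<in> H1v \<Omega>. continuous_on (closure \<Omega>) v \<and> (\<forall>x\<in>\<Gamma>D. v x = 0) \<and>
       (\<forall>K\<in>\<T>. \<exists>r\<in>Polyv 2. \<forall>x\<in>K. v x = r x)}"

definition W_space :: "(real^3) set \<Rightarrow> (real^3) set set \<Rightarrow> scal set" where
  "W_space \<Omega> \<T> = {w. continuous_on (closure \<Omega>) w \<and> (\<forall>K\<in>\<T>. \<exists>r\<in>Poly 1. \<forall>x\<in>K. w x = r x)}"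

definition P_space :: "(real^3) set \<Rightarrow> (real^3) set set \<Rightarrow> scal set" where
  "P_space \<Omega> \<T> = {q \<in> H10 \<Omega>. continuous_on (closure \<Omega>) q \<and>
       (\<forall>K\<in>\<T>. \<exists>r\<in>Poly 2. \<forall>x\<in>K. q x = r x)}"

text \<open>The supremum is taken in the extended reals, so that it needs no boundedness or
  non-emptiness side condition.\<close>

definition inf_sup ::
    "real \<Rightarrow> (real^3) set \<Rightarrow> (real^3) set \<Rightarrow> (real^3) set set \<Rightarrow> bool" where
  "inf_sup \<beta> \<Omega> \<Gamma>D \<T> \<longleftrightarrow> (\<forall>w\<in>W_space \<Omega> \<T>.
     ereal (\<beta> * L2_norm \<Omega> w) \<le>
       (SUP v\<in>{v \<in> U_space \<Omega> \<Gamma>D \<T>. \<exists>x\<in>closure \<Omega>. v x \<noteq> 0}.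
          ereal (L2_inner \<Omega> (wdiv \<Omega> v) w / H1v_norm \<Omega> v)))"

record fields =
  fE :: vecf
  fH :: vecf
  fu :: vecf
  f\<xi> :: scal
  fp :: scal

definition S_space :: "(real^3) set \<Rightarrow> (real^3) set \<Rightarrow> (real^3) set set \<Rightarrow> fields set" where
  "S_space \<Omega> \<Gamma>D \<T> = {X. fE X \<in> E_space \<Omega> \<T> \<and> fH X \<in> H_space \<Omega> \<T> \<and>
     fu X \<in> U_space \<Omega> \<Gamma>D \<T> \<and> f\<xi> X \<in> W_space \<Omega> \<T> \<and> fp X \<in> P_space \<Omega> \<T>}"

definition fields_diff :: "fields \<Rightarrow> fields \<Rightarrow> fields" where
  "fields_diff X Y = \<lparr> fE = (\<lambda>x. fE X x - fE Y x), fH = (\<lambda>x. fH X x - fH Y x),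
     fu = (\<lambda>x. fu X x - fu Y x), f\<xi> = (\<lambda>x. f\<xi> X x - f\<xi> Y x), fp = (\<lambda>x. fp X x - fp Y x) \<rparr>"

text \<open>Arguments: time step, then the values at levels \<open>n\<close>, \<open>n - 1\<close>, \<open>n - 2\<close>.\<close>

definition bdf2 :: "real \<Rightarrow> (real^3 \<Rightarrow> 'a::euclidean_space) \<Rightarrow> (real^3 \<Rightarrow> 'a) \<Rightarrow> (real^3 \<Rightarrow> 'a)
    \<Rightarrow> real^3 \<Rightarrow> 'a" where
  "bdf2 \<tau> z z1 z2 = (\<lambda>x. (3 *\<^sub>R z x - 4 *\<^sub>R z1 x + z2 x) /\<^sub>R (2 * \<tau>))"

text \<open>Below, \<open>X1\<close> and \<open>X2\<close> are the discrete solutions at levels \<open>n - 1\<close> and \<open>n - 2\<close>, and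
  \<open>lam\<close> stands for the coefficient \<open>\<lambda>\<close>.\<close>

definition monolithic :: "real \<Rightarrow> real \<Rightarrow> real \<Rightarrow> real \<Rightarrow> real \<Rightarrow> real \<Rightarrow> real \<Rightarrow> real \<Rightarrow> real \<Rightarrow> real
    \<Rightarrow> (real^3) set \<Rightarrow> (real^3) set \<Rightarrow> (real^3) set set \<Rightarrow> vecf \<Rightarrow> vecf \<Rightarrow> scal
    \<Rightarrow> fields \<Rightarrow> fields \<Rightarrow> fields \<Rightarrow> bool" where
  "monolithic \<epsilon> \<sigma> \<mu> G lam \<alpha> \<kappa> c0 L \<tau> \<Omega> \<Gamma>D \<T> h f g X2 X1 X \<longleftrightarrow>
     X \<in> S_space \<Omega> \<Gamma>D \<T> \<and>
     (\<forall>D\<in>E_space \<Omega> \<T>.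
        \<epsilon> * L2_inner \<Omega> (bdf2 \<tau> (fE X) (fE X1) (fE X2)) D + \<sigma> * L2_inner \<Omega> (fE X) D
        - L2_inner \<Omega> (fH X) (wcurl \<Omega> D) - L * L2_inner \<Omega> (wgrad \<Omega> (fp X)) D
        = L2_inner \<Omega> h D) \<and>
     (\<forall>B\<in>H_space \<Omega> \<T>.
        \<mu> * L2_inner \<Omega> (bdf2 \<tau> (fH X) (fH X1) (fH X2)) B + L2_inner \<Omega> (wcurl \<Omega> (fE X)) B
        = 0) \<and>
     (\<forall>v\<in>U_space \<Omega> \<Gamma>D \<T>.
        G * L2_inner \<Omega> (wjac \<Omega> (fu X)) (wjac \<Omega> v) - L2_inner \<Omega> (f\<xi> X) (wdiv \<Omega> v)
        = L2_inner \<Omega> f v) \<and>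
     (\<forall>w\<in>W_space \<Omega> \<T>.
        L2_inner \<Omega> (wdiv \<Omega> (fu X)) w + inverse lam * L2_inner \<Omega> (f\<xi> X) w
        - \<alpha> * inverse lam * L2_inner \<Omega> (fp X) w = 0) \<and>
     (\<forall>q\<in>P_space \<Omega> \<T>.
        (c0 + \<alpha>\<^sup>2 * inverse lam) * L2_inner \<Omega> (bdf2 \<tau> (fp X) (fp X1) (fp X2)) q
        - \<alpha> * inverse lam * L2_inner \<Omega> (bdf2 \<tau> (f\<xi> X) (f\<xi> X1) (f\<xi> X2)) q
        + \<kappa> * L2_inner \<Omega> (wgrad \<Omega> (fp X)) (wgrad \<Omega> q) - L * L2_inner \<Omega> (fE X) (wgrad \<Omega> q)
        = L2_inner \<Omega> g q)"

text \<open>\<open>Y\<close> is the previous and \<open>X\<close> the current iterate.\<close>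

definition decoupling_step1 :: "real \<Rightarrow> real \<Rightarrow> real \<Rightarrow> real \<Rightarrow> real
    \<Rightarrow> (real^3) set \<Rightarrow> (real^3) set set \<Rightarrow> vecf
    \<Rightarrow> fields \<Rightarrow> fields \<Rightarrow> fields \<Rightarrow> fields \<Rightarrow> bool" where
  "decoupling_step1 \<epsilon> \<sigma> \<mu> L \<tau> \<Omega> \<T> h X2 X1 Y X \<longleftrightarrow>
     fE X \<in> E_space \<Omega> \<T> \<and> fH X \<in> H_space \<Omega> \<T> \<and>
     (\<forall>D\<in>E_space \<Omega> \<T>.
        \<epsilon> * L2_inner \<Omega> (bdf2 \<tau> (fE X) (fE X1) (fE X2)) D + \<sigma> * L2_inner \<Omega> (fE X) D
        - L2_inner \<Omega> (fH X) (wcurl \<Omega> D)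
        = L * L2_inner \<Omega> (wgrad \<Omega> (fp Y)) D + L2_inner \<Omega> h D) \<and>
     (\<forall>B\<in>H_space \<Omega> \<T>.
        \<mu> * L2_inner \<Omega> (bdf2 \<tau> (fH X) (fH X1) (fH X2)) B + L2_inner \<Omega> (wcurl \<Omega> (fE X)) B
        = 0)"

definition decoupling_step2 :: "real \<Rightarrow> real \<Rightarrow> real \<Rightarrow> real \<Rightarrow> real \<Rightarrow> real \<Rightarrow> real
    \<Rightarrow> (real^3) set \<Rightarrow> (real^3) set \<Rightarrow> (real^3) set set \<Rightarrow> vecf \<Rightarrow> scal
    \<Rightarrow> fields \<Rightarrow> fields \<Rightarrow> fields \<Rightarrow> bool" where
  "decoupling_step2 G lam \<alpha> \<kappa> c0 L \<tau> \<Omega> \<Gamma>D \<T> f g X2 X1 X \<longleftrightarrow>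
     fu X \<in> U_space \<Omega> \<Gamma>D \<T> \<and> f\<xi> X \<in> W_space \<Omega> \<T> \<and> fp X \<in> P_space \<Omega> \<T> \<and>
     (\<forall>v\<in>U_space \<Omega> \<Gamma>D \<T>.
        G * L2_inner \<Omega> (wjac \<Omega> (fu X)) (wjac \<Omega> v) - L2_inner \<Omega> (f\<xi> X) (wdiv \<Omega> v)
        = L2_inner \<Omega> f v) \<and>
     (\<forall>w\<in>W_space \<Omega> \<T>.
        L2_inner \<Omega> (wdiv \<Omega> (fu X)) w + inverse lam * L2_inner \<Omega> (f\<xi> X) w
        - \<alpha> * inverse lam * L2_inner \<Omega> (fp X) w = 0) \<and>
     (\<forall>q\<in>P_space \<Omega> \<T>.
        (c0 + \<alpha>\<^sup>2 * inverse lam) * L2_inner \<Omega> (bdf2 \<tau> (fp X) (fp X1) (fp X2)) q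
        - \<alpha> * inverse lam * L2_inner \<Omega> (bdf2 \<tau> (f\<xi> X) (f\<xi> X1) (f\<xi> X2)) q
        + \<kappa> * L2_inner \<Omega> (wgrad \<Omega> (fp X)) (wgrad \<Omega> q)
        = L * L2_inner \<Omega> (fE X) (wgrad \<Omega> q) + L2_inner \<Omega> g q)"

definition decoupling_sequence :: "real \<Rightarrow> real \<Rightarrow> real \<Rightarrow> real \<Rightarrow> real \<Rightarrow> real \<Rightarrow> real \<Rightarrow> real \<Rightarrow> real
    \<Rightarrow> real \<Rightarrow> (real^3) set \<Rightarrow> (real^3) set \<Rightarrow> (real^3) set set \<Rightarrow> vecf \<Rightarrow> vecf \<Rightarrow> scal
    \<Rightarrow> fields \<Rightarrow> fields \<Rightarrow> (nat \<Rightarrow> fields) \<Rightarrow> bool" where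
  "decoupling_sequence \<epsilon> \<sigma> \<mu> G lam \<alpha> \<kappa> c0 L \<tau> \<Omega> \<Gamma>D \<T> h f g X2 X1 Z \<longleftrightarrow>
     Z 0 = X1 \<and>
     (\<forall>i\<ge>1. decoupling_step1 \<epsilon> \<sigma> \<mu> L \<tau> \<Omega> \<T> h X2 X1 (Z (i - 1)) (Z i) \<and>
            decoupling_step2 G lam \<alpha> \<kappa> c0 L \<tau> \<Omega> \<Gamma>D \<T> f g X2 X1 (Z i))"

end

(*
  Subtracting the monolithic scheme from one sweep of the iteration gives error equations in which
  all data cancel and the BDF2 quotient becomes 3/(2 tau) times the error.  Testing the Maxwell part
  with (e_E, e_H) gives |e_E| <= L/s |grad e_p^(i-1)| with s = sigma + 3 epsilon/(2 tau).  Testing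
  the poroelastic part with (e_u, e_xi, e_p), the mixed pressure terms complete a square, so the
  flux term alone gives kappa |grad e_p^i| <= L |e_E|.  The energy terms left over bound the other
  components, without the inf-sup condition; only |e_u| needs a Poincare inequality on U_h, whose
  constant may depend on the mesh.

  As wgrad and wcurl are arbitrary choices of weak derivatives, even their additivity rests on the
  almost everywhere uniqueness of weak derivatives, hence on the existence of smooth bumps.
*)
theory Submission
  imports Defs
begin

subsection \<open>The space of square integrable functions\<close>

text \<open>The contraction factor is a product of two Lipschitz constants: L/s for the map from the
  lagged pressure gradient to the electric field, L/\<kappa> for the map back. It is below one
  because s exceeds \<sigma> and L^2 < \<sigma>\<kappa>. The square closes only after a rescaling.
  In the error equations the pressure balance carries the factor 3/(2 tau), while the equations for
  the displacement and for \<xi> do not; multiplying the energy of the latter by this factor makes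
  the two cross terms equal, and what remains is c0 |e_p|^2 and |\<alpha> e_p - e_\<xi>|^2 / lam.
  Function spaces are sets of functions, not quotients, and the weak derivative chosen for a
  difference is unrelated to those chosen for its two terms, so linearity is used under integrals
  only. Since all errors are differences, the discrete spaces are shown closed under subtraction and
  nothing else. As the mesh is fixed, Poincare's inequality is finite dimensional: the gradient of a
  quadratic is affine, all norms on affine functions are equivalent, and connectedness carries the
  resulting bound from element to element.\<close>

lemma L2_inner_integrable:
  fixes f g :: "real^3 \<Rightarrow> 'a::euclidean_space"
  assumes "f \<in> L2 \<Omega>" "g \<in> L2 \<Omega>"
  shows "integrable (lebesgue_on \<Omega>) (\<lambda>x. f x \<bullet> g x)"
proof (rule Bochner_Integration.integrable_bound)
  show "integrable (lebesgue_on \<Omega>) (\<lambda>x. (norm (f x))\<^sup>2 + (norm (g x))\<^sup>2)"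
    using assms by (auto simp: L2_def)
  show "(\<lambda>x. f x \<bullet> g x) \<in> borel_measurable (lebesgue_on \<Omega>)"
    using assms by (auto simp: L2_def)
  have "norm (a \<bullet> b) \<le> norm ((norm a)\<^sup>2 + (norm b)\<^sup>2)" for a b :: 'a
  proof -
    have "\<bar>a \<bullet> b\<bar> \<le> norm a * norm b" by (rule Cauchy_Schwarz_ineq2)
    moreover have "2 * (norm a * norm b) \<le> (norm a)\<^sup>2 + (norm b)\<^sup>2"
      using sum_squares_bound[of "norm a" "norm b"] by simp
    moreover have "0 \<le> norm a * norm b" by simp
    ultimately have "\<bar>a \<bullet> b\<bar> \<le> (norm a)\<^sup>2 + (norm b)\<^sup>2" by linarith
    then show ?thesis by simp
  qed
  then show "AE x in lebesgue_on \<Omega>. norm (f x \<bullet> g x) \<le> norm ((norm (f x))\<^sup>2 + (norm (g x))\<^sup>2)"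
    by simp
qed

lemma L2_add:
  fixes f g :: "real^3 \<Rightarrow> 'a::euclidean_space"
  assumes "f \<in> L2 \<Omega>" "g \<in> L2 \<Omega>"
  shows "(\<lambda>x. f x + g x) \<in> L2 \<Omega>"
proof -
  have "integrable (lebesgue_on \<Omega>) (\<lambda>x. (norm (f x))\<^sup>2 + 2 * (f x \<bullet> g x) + (norm (g x))\<^sup>2)"
    using assms L2_inner_integrable[OF assms] by (auto simp: L2_def)
  then have "integrable (lebesgue_on \<Omega>) (\<lambda>x. (norm (f x + g x))\<^sup>2)"
    by (simp add: power2_norm_eq_inner algebra_simps inner_commute)
  then show ?thesis
    using assms by (auto simp: L2_def)
qed

lemma L2_scaleR:
  fixes f :: "real^3 \<Rightarrow> 'a::euclidean_space"
  assumes "f \<in> L2 \<Omega>"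
  shows "(\<lambda>x. c *\<^sub>R f x) \<in> L2 \<Omega>"
  using assms by (auto simp: L2_def power_mult_distrib)

lemma L2_diff:
  fixes f g :: "real^3 \<Rightarrow> 'a::euclidean_space"
  assumes "f \<in> L2 \<Omega>" "g \<in> L2 \<Omega>"
  shows "(\<lambda>x. f x - g x) \<in> L2 \<Omega>"
  using L2_add[OF assms(1) L2_scaleR[OF assms(2), of "-1"]] by simp

lemma L2_component:
  fixes g :: "real^3 \<Rightarrow> 'a::euclidean_space^'n"
  assumes "g \<in> L2 \<Omega>"
  shows "(\<lambda>x. g x $ i) \<in> L2 \<Omega>"
proof -
  have m: "(\<lambda>x. g x $ i) \<in> borel_measurable (lebesgue_on \<Omega>)"
    by (rule measurable_compose[of g _ borel])
      (use assms in \<open>auto simp: L2_def intro!: borel_measurable_continuous_onI continuous_intros\<close>)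
  have "integrable (lebesgue_on \<Omega>) (\<lambda>x. (norm (g x $ i))\<^sup>2)"
  proof (rule Bochner_Integration.integrable_bound)
    show "integrable (lebesgue_on \<Omega>) (\<lambda>x. (norm (g x))\<^sup>2)"
      using assms by (auto simp: L2_def)
    show "(\<lambda>x. (norm (g x $ i))\<^sup>2) \<in> borel_measurable (lebesgue_on \<Omega>)"
      using m by measurable
    show "AE x in lebesgue_on \<Omega>. norm ((norm (g x $ i))\<^sup>2) \<le> norm ((norm (g x))\<^sup>2)"
      by (auto intro!: power_mono Finite_Cartesian_Product.norm_nth_le)
  qed
  then show ?thesis using m by (simp add: L2_def)
qed

lemma L2_subset:
  fixes f :: "real^3 \<Rightarrow> 'a::euclidean_space"
  assumes "f \<in> L2 \<Omega>" "S \<subseteq> \<Omega>" "S \<in> sets lebesgue" "\<Omega> \<in> sets lebesgue"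
  shows "f \<in> L2 S"
proof -
  have "integrable lebesgue (\<lambda>x. indicator \<Omega> x *\<^sub>R (norm (f x))\<^sup>2)"
    using assms by (auto simp: L2_def integrable_restrict_space)
  from integrable_mult_indicator[OF assms(3) this]
  have "integrable lebesgue (\<lambda>x. indicator S x *\<^sub>R (norm (f x))\<^sup>2)"
    by (rule Bochner_Integration.integrable_cong[THEN iffD1, rotated -1])
      (use assms(2) in \<open>auto simp: indicator_def\<close>)
  moreover have "f \<in> borel_measurable (lebesgue_on S)"
    by (rule measurable_restrict_mono[of _ _ \<Omega>]) (use assms(1,2) in \<open>simp_all add: L2_def\<close>)
  ultimately show ?thesis
    using assms(3) by (simp add: L2_def integrable_restrict_space)
qed

text \<open>The components are embedded along the axes by linear, hence continuous, maps and sum to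
  \<open>g\<close>. A component may itself be a vector, so matrix fields such as the Jacobian are
  covered row by row.\<close>

lemma L2_vecI:
  fixes g :: "real^3 \<Rightarrow> 'a::euclidean_space^'n"
  assumes "\<And>i. (\<lambda>x. g x $ i) \<in> L2 \<Omega>"
  shows "g \<in> L2 \<Omega>"
proof -
  have "(\<lambda>x. \<Sum>i\<in>UNIV. axis i (g x $ i)) \<in> borel_measurable (lebesgue_on \<Omega>)"
  proof (rule borel_measurable_sum)
    fix i :: 'n
    have "linear (axis i :: 'a \<Rightarrow> 'a^'n)"
      by (auto simp: linear_iff axis_def vec_eq_iff)
    then have "(axis i :: 'a \<Rightarrow> 'a^'n) \<in> borel_measurable borel"
      by (intro borel_measurable_continuous_onI linear_continuous_on linear_conv_bounded_linear[THEN iffD1])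
    then show "(\<lambda>x. axis i (g x $ i)) \<in> borel_measurable (lebesgue_on \<Omega>)"
      using assms[of i] by (auto simp: L2_def intro: measurable_compose)
  qed
  moreover have "(\<lambda>x. \<Sum>i\<in>UNIV. axis i (g x $ i)) = g"
    by (auto simp: vec_eq_iff fun_eq_iff axis_def if_distrib cong: if_cong)
  ultimately have "g \<in> borel_measurable (lebesgue_on \<Omega>)" by simp
  moreover have "integrable (lebesgue_on \<Omega>) (\<lambda>x. \<Sum>i\<in>UNIV. (norm (g x $ i))\<^sup>2)"
    using assms by (auto simp: L2_def)
  moreover have "(norm (g x))\<^sup>2 = (\<Sum>i\<in>UNIV. (norm (g x $ i))\<^sup>2)" for x
    by (simp add: power2_norm_eq_inner inner_vec_def)
  ultimately show ?thesis by (simp add: L2_def)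
qed

lemma L2_bounded:
  fixes f :: "real^3 \<Rightarrow> 'a::euclidean_space"
  assumes "\<Omega> \<in> lmeasurable" "f \<in> borel_measurable (lebesgue_on \<Omega>)"
    and "\<And>x. x \<in> \<Omega> \<Longrightarrow> norm (f x) \<le> B"
  shows "f \<in> L2 \<Omega>"
proof -
  have "integrable (lebesgue_on \<Omega>) (\<lambda>x. (norm (f x))\<^sup>2)"
  proof (rule Bochner_Integration.integrable_bound)
    show "integrable (lebesgue_on \<Omega>) (\<lambda>x. B\<^sup>2)"
      by (intro finite_measure.integrable_const finite_measure_lebesgue_on assms)
    show "(\<lambda>x. (norm (f x))\<^sup>2) \<in> borel_measurable (lebesgue_on \<Omega>)"
      using assms(2) by measurable
    show "AE x in lebesgue_on \<Omega>. norm ((norm (f x))\<^sup>2) \<le> norm (B\<^sup>2)"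
      using assms(3) by (auto intro!: AE_I2 power_mono simp: space_restrict_space)
  qed
  then show ?thesis using assms by (simp add: L2_def)
qed

section \<open>Inner product and norm estimates\<close>

lemma L2_inner_commute: "L2_inner \<Omega> f g = L2_inner \<Omega> g f"
  by (simp add: L2_inner_def inner_commute)

lemma L2_inner_diff_left:
  assumes "f \<in> L2 \<Omega>" "g \<in> L2 \<Omega>" "k \<in> L2 \<Omega>"
  shows "L2_inner \<Omega> (\<lambda>x. f x - g x) k = L2_inner \<Omega> f k - L2_inner \<Omega> g k"
  using assms by (simp add: L2_inner_def inner_diff_left L2_inner_integrable)

lemma L2_inner_diff_right:
  assumes "f \<in> L2 \<Omega>" "g \<in> L2 \<Omega>" "k \<in> L2 \<Omega>"
  shows "L2_inner \<Omega> k (\<lambda>x. f x - g x) = L2_inner \<Omega> k f - L2_inner \<Omega> k g"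
  using L2_inner_diff_left[OF assms] by (simp add: L2_inner_commute)

lemma L2_inner_scaleR_left:
  "L2_inner \<Omega> (\<lambda>x. c *\<^sub>R f x) k = c * L2_inner \<Omega> f k"
  by (simp add: L2_inner_def)

lemma L2_inner_nonneg: "0 \<le> L2_inner \<Omega> f f"
  by (simp add: L2_inner_def)

lemma L2_norm_nonneg [simp]: "0 \<le> L2_norm \<Omega> f"
  by (simp add: L2_norm_def L2_inner_nonneg)

lemma L2_norm_power2: "(L2_norm \<Omega> f)\<^sup>2 = L2_inner \<Omega> f f"
  by (simp add: L2_norm_def L2_inner_nonneg)

text \<open>Turns almost everywhere identities between chosen weak derivatives into equalities
  inside the variational equations.\<close>

lemma L2_inner_cong:
  assumes "AE x in lebesgue_on \<Omega>. f x = f' x" "g \<in> L2 \<Omega>" "f \<in> L2 \<Omega>" "f' \<in> L2 \<Omega>"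
  shows "L2_inner \<Omega> f g = L2_inner \<Omega> f' g"
  unfolding L2_inner_def
  by (rule integral_cong_AE) (use assms in \<open>auto simp: L2_def\<close>)

lemma L2_norm_cong:
  assumes "AE x in lebesgue_on \<Omega>. f x = f' x" "f \<in> L2 \<Omega>" "f' \<in> L2 \<Omega>"
  shows "L2_norm \<Omega> f = L2_norm \<Omega> f'"
  using L2_inner_cong[OF assms(1), of f] L2_inner_cong[OF assms(1), of f'] assms
  by (simp add: L2_norm_def L2_inner_commute)

lemma L2_inner_diff_self:
  assumes "f \<in> L2 \<Omega>" "g \<in> L2 \<Omega>"
  shows "L2_inner \<Omega> (\<lambda>x. f x - g x) (\<lambda>x. f x - g x)
    = L2_inner \<Omega> f f - 2 * L2_inner \<Omega> f g + L2_inner \<Omega> g g"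
  using assms
  by (simp add: L2_inner_diff_left L2_inner_diff_right L2_diff L2_inner_commute[of _ g f])

text \<open>The form is only semidefinite on these functions, so the discriminant argument is run by
  hand on the nonnegative quadratic t -> |f - t g|^2, with its degenerate case apart.\<close>

lemma L2_Cauchy_Schwarz:
  assumes "f \<in> L2 \<Omega>" "g \<in> L2 \<Omega>"
  shows "L2_inner \<Omega> f g \<le> L2_norm \<Omega> f * L2_norm \<Omega> g"
proof -
  define a b c where "a = L2_inner \<Omega> f f" "b = L2_inner \<Omega> f g" "c = L2_inner \<Omega> g g"
  have q: "0 \<le> a - 2 * t * b + t\<^sup>2 * c" for t
  proof -
    have "0 \<le> L2_inner \<Omega> (\<lambda>x. f x - t *\<^sub>R g x) (\<lambda>x. f x - t *\<^sub>R g x)"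
      by (rule L2_inner_nonneg)
    also have "\<dots> = L2_inner \<Omega> f f - 2 * L2_inner \<Omega> f (\<lambda>x. t *\<^sub>R g x)
        + L2_inner \<Omega> (\<lambda>x. t *\<^sub>R g x) (\<lambda>x. t *\<^sub>R g x)"
      by (rule L2_inner_diff_self) (use assms in \<open>auto intro: L2_scaleR\<close>)
    also have "\<dots> = a - 2 * t * b + t\<^sup>2 * c"
      by (simp add: a_b_c_def L2_inner_def power2_eq_square algebra_simps)
    finally show ?thesis .
  qed
  have "c \<ge> 0" "a \<ge> 0" by (auto simp: a_b_c_def L2_inner_nonneg)
  have "b\<^sup>2 \<le> a * c"
  proof (cases "c = 0")
    case True
    have "b = 0"
    proof (rule ccontr)
      assume "b \<noteq> 0"
      \<comment> \<open>For c = 0 the quadratic is a - 2 t b, which equals - a - 2 at this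
        t.\<close>
      then show False
        using q[of "(a + 1) / b"] True \<open>a \<ge> 0\<close> by simp
    qed
    then show ?thesis using True by simp
  next
    case False
    then have "c > 0" using \<open>c \<ge> 0\<close> by simp
    \<comment> \<open>b / c is the minimiser of the quadratic.\<close>
    then show ?thesis
      using q[of "b / c"] by (simp add: field_simps power2_eq_square)
  qed
  then have "\<bar>b\<bar> \<le> sqrt (a * c)"
    using real_le_rsqrt by fastforce
  then show ?thesis
    by (simp add: a_b_c_def L2_norm_def real_sqrt_mult)
qed

lemma L2_norm_triangle:
  assumes "f \<in> L2 \<Omega>" "g \<in> L2 \<Omega>"
  shows "L2_norm \<Omega> (\<lambda>x. f x - g x) \<le> L2_norm \<Omega> f + L2_norm \<Omega> g"
proof (rule power2_le_imp_le)
  have m: "(\<lambda>x. - g x) \<in> L2 \<Omega>" using L2_scaleR[OF assms(2), of "-1"] by simp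
  have "- L2_inner \<Omega> f g \<le> L2_norm \<Omega> f * L2_norm \<Omega> g"
    using L2_Cauchy_Schwarz[OF assms(1) m] by (simp add: L2_norm_def L2_inner_def)
  then show "(L2_norm \<Omega> (\<lambda>x. f x - g x))\<^sup>2 \<le> (L2_norm \<Omega> f + L2_norm \<Omega> g)\<^sup>2"
    using assms by (simp add: L2_norm_power2 L2_inner_diff_self power2_sum)
qed simp

lemma L2_norm_component:
  fixes g :: "real^3 \<Rightarrow> 'a::euclidean_space^'n"
  assumes "g \<in> L2 \<Omega>"
  shows "L2_norm \<Omega> (\<lambda>x. g x $ i) \<le> L2_norm \<Omega> g"
  unfolding L2_norm_def
proof (rule real_sqrt_le_mono)
  show "L2_inner \<Omega> (\<lambda>x. g x $ i) (\<lambda>x. g x $ i) \<le> L2_inner \<Omega> g g"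
    unfolding L2_inner_def
  proof (rule integral_mono)
    show "integrable (lebesgue_on \<Omega>) (\<lambda>x. g x $ i \<bullet> g x $ i)"
      using assms by (intro L2_inner_integrable L2_component)
    show "integrable (lebesgue_on \<Omega>) (\<lambda>x. g x \<bullet> g x)"
      using assms by (intro L2_inner_integrable)
    fix x
    have "norm (g x $ i) \<le> norm (g x)" by (rule Finite_Cartesian_Product.norm_nth_le)
    then show "g x $ i \<bullet> g x $ i \<le> g x \<bullet> g x"
      by (simp add: norm_le)
  qed
qed

lemma L2_norm_subset:
  fixes f :: "real^3 \<Rightarrow> 'a::euclidean_space"
  assumes "f \<in> L2 \<Omega>" "S \<subseteq> \<Omega>" "S \<in> sets lebesgue" "\<Omega> \<in> sets lebesgue"
  shows "L2_norm S f \<le> L2_norm \<Omega> f"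
  unfolding L2_norm_def
proof (rule real_sqrt_le_mono)
  have i: "integrable (lebesgue_on T) (\<lambda>x. f x \<bullet> f x)" if "T = S \<or> T = \<Omega>" for T
    using that L2_subset[OF assms] assms(1) L2_inner_integrable by blast
  have "L2_inner T f f = (LINT x|lebesgue. indicator T x *\<^sub>R (f x \<bullet> f x))" if "T = S \<or> T = \<Omega>" for T
    unfolding L2_inner_def by (rule integral_restrict_space) (use that assms in auto)
  moreover have "(LINT x|lebesgue. indicator S x *\<^sub>R (f x \<bullet> f x))
      \<le> (LINT x|lebesgue. indicator \<Omega> x *\<^sub>R (f x \<bullet> f x))"
    using i[of S] i[of \<Omega>] assms
    by (intro integral_mono) (auto simp: integrable_restrict_space indicator_def)
  ultimately show "L2_inner S f f \<le> L2_inner \<Omega> f f" by simp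
qed

lemma L2_norm_le_bound:
  fixes f :: "real^3 \<Rightarrow> 'a::euclidean_space"
  assumes "\<Omega> \<in> lmeasurable" "f \<in> L2 \<Omega>" "0 \<le> B" and "\<And>x. x \<in> \<Omega> \<Longrightarrow> norm (f x) \<le> B"
  shows "L2_norm \<Omega> f \<le> sqrt (measure lebesgue \<Omega>) * B"
proof -
  have "L2_inner \<Omega> f f \<le> (LINT x|lebesgue_on \<Omega>. B\<^sup>2)"
    unfolding L2_inner_def
  proof (rule integral_mono_AE)
    show "integrable (lebesgue_on \<Omega>) (\<lambda>x. f x \<bullet> f x)" by (rule L2_inner_integrable) fact+
    show "integrable (lebesgue_on \<Omega>) (\<lambda>x. B\<^sup>2)"
      by (intro finite_measure.integrable_const finite_measure_lebesgue_on assms)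
    show "AE x in lebesgue_on \<Omega>. f x \<bullet> f x \<le> B\<^sup>2"
      using assms(4) by (auto intro!: AE_I2 power_mono simp: space_restrict_space simp flip: power2_norm_eq_inner)
  qed
  also have "\<dots> = measure lebesgue \<Omega> * B\<^sup>2"
    using assms(1) by (simp add: measure_restrict_space fmeasurableD)
  finally have "sqrt (L2_inner \<Omega> f f) \<le> sqrt (measure lebesgue \<Omega> * B\<^sup>2)" by simp
  then show ?thesis using assms(3) by (simp add: L2_norm_def real_sqrt_mult)
qed

subsection \<open>Smooth bumps\<close>

text \<open>The derivative is existential, so inductions supply explicit derivatives instead of
  computing with a derivative operator. Level 0 asks nothing, not even continuity; this is why
  \<open>Ck_prod\<close> spends one extra order.\<close>

primrec Ck1 :: "nat \<Rightarrow> (real \<Rightarrow> real) \<Rightarrow> bool" where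
  "Ck1 0 f \<longleftrightarrow> True"
| "Ck1 (Suc k) f \<longleftrightarrow> (\<exists>f'. (\<forall>x. (f has_real_derivative f' x) (at x)) \<and> Ck1 k f')"

lemma Ck1_SucD: "Ck1 (Suc k) f \<Longrightarrow> Ck1 k f"
proof (induction k arbitrary: f)
  case (Suc k)
  then obtain f' where "\<forall>x. (f has_real_derivative f' x) (at x)" "Ck1 (Suc k) f'"
    by auto
  with Suc.IH show ?case by auto
qed simp

lemma Ck1_const: "Ck1 k (\<lambda>x. c)"
proof (induction k arbitrary: c)
  case (Suc k)
  have "\<forall>x. ((\<lambda>x. c) has_real_derivative 0) (at x)" by auto
  with Suc show ?case by (auto intro!: exI[of _ "\<lambda>x. 0"])
qed simp

lemma Ck1_add: "Ck1 k f \<Longrightarrow> Ck1 k g \<Longrightarrow> Ck1 k (\<lambda>x. f x + g x)"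
proof (induction k arbitrary: f g)
  case (Suc k)
  then obtain f' g' where
    "\<forall>x. (f has_real_derivative f' x) (at x)" "Ck1 k f'"
    "\<forall>x. (g has_real_derivative g' x) (at x)" "Ck1 k g'"
    by auto
  with Suc.IH[of f' g'] show ?case
    by (auto intro!: exI[of _ "\<lambda>x. f' x + g' x"] DERIV_add)
qed simp

lemma Ck1_mult: "Ck1 k f \<Longrightarrow> Ck1 k g \<Longrightarrow> Ck1 k (\<lambda>x. f x * g x)"
proof (induction k arbitrary: f g)
  case (Suc k)
  then obtain f' g' where
    *: "\<forall>x. (f has_real_derivative f' x) (at x)" "Ck1 k f'"
    "\<forall>x. (g has_real_derivative g' x) (at x)" "Ck1 k g'"
    by auto
  have "Ck1 k (\<lambda>x. f' x * g x + f x * g' x)"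
    using * Suc.prems[THEN Ck1_SucD] by (auto intro!: Ck1_add Suc.IH)
  with * show ?case
    by (auto intro!: exI[of _ "\<lambda>x. f' x * g x + f x * g' x"] derivative_eq_intros)
qed simp

lemma Ck1_affine: "Ck1 k f \<Longrightarrow> Ck1 k (\<lambda>x. f (a * x + b))"
proof (induction k arbitrary: f)
  case (Suc k)
  then obtain f' where f': "\<And>x. (f has_real_derivative f' x) (at x)" "Ck1 k f'"
    by auto
  have "Ck1 k (\<lambda>x. a * f' (a * x + b))"
    by (intro Ck1_mult Ck1_const Suc.IH f')
  moreover have "((\<lambda>x. f (a * x + b)) has_real_derivative a * f' (a * x + b)) (at x)" for x
    by (rule DERIV_cong[OF DERIV_chain2[OF f'(1)]]) (auto intro!: derivative_eq_intros)
  ultimately show ?case by (auto intro!: exI[of _ "\<lambda>x. a * f' (a * x + b)"])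
qed simp

text \<open>For p = 1 this is the classical smooth function exp(-1/t), extended by zero to the left
  half line. Admitting every polynomial in 1/t makes the family closed under
  differentiation.\<close>

definition flat :: "real poly \<Rightarrow> real \<Rightarrow> real" where
  "flat p t = (if t > 0 then poly p (1 / t) * exp (- (1 / t)) else 0)"

lemma poly_times_exp_tendsto_0:
  fixes p :: "real poly"
  shows "((\<lambda>s. poly p s * exp (- s)) \<longlongrightarrow> 0) at_top"
proof -
  have "((\<lambda>s. \<Sum>i\<le>degree p. coeff p i * (s ^ i / exp s)) \<longlongrightarrow> (\<Sum>i\<le>degree p. coeff p i * 0)) at_top"
    by (intro tendsto_sum tendsto_mult tendsto_const tendsto_power_div_exp_0)
  then show ?thesis
    by (simp add: poly_altdef exp_minus divide_inverse sum_distrib_right mult.assoc)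
qed

lemma flat_tendsto_0: "(flat p \<longlongrightarrow> 0) (at_right 0)"
proof -
  have "((\<lambda>t. poly p (inverse t) * exp (- inverse t)) \<longlongrightarrow> 0) (at_right 0)"
    by (rule filterlim_compose[OF poly_times_exp_tendsto_0 filterlim_inverse_at_top_right])
  moreover have "\<forall>\<^sub>F t in at_right 0. poly p (inverse t) * exp (- inverse t) = flat p t"
    by (auto simp: eventually_at_right_field flat_def field_simps intro!: exI[of _ 1])
  ultimately show ?thesis by (rule Lim_transform_eventually)
qed

text \<open>With s = 1/t, the derivative of p(s) exp(-s) in t is s^2 (p(s) - p'(s)) exp(-s); the
  factor \<open>[:0, 0, 1:]\<close> is s^2.\<close>

lemma flat_derivative:
  "(flat p has_real_derivative flat ([:0, 0, 1:] * (p - pderiv p)) t) (at t)"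
proof -
  consider "t > 0" | "t < 0" | "t = 0" by linarith
  then show ?thesis
  proof cases
    case 1
    have "((\<lambda>t. poly p (1 / t) * exp (- (1 / t))) has_real_derivative
        flat ([:0, 0, 1:] * (p - pderiv p)) t) (at t)"
      using 1 by (auto intro!: derivative_eq_intros DERIV_chain2[OF poly_DERIV]
          simp: flat_def field_simps power2_eq_square)
    then show ?thesis
      by (rule has_field_derivative_transform_within_open[of _ _ _ "{0<..}"])
        (use 1 in \<open>auto simp: flat_def\<close>)
  next
    case 2
    have "((\<lambda>t. 0) has_real_derivative flat ([:0, 0, 1:] * (p - pderiv p)) t) (at t)"
      using 2 by (auto simp: flat_def)
    then show ?thesis
      by (rule has_field_derivative_transform_within_open[of _ _ _ "{..<0}"])
        (use 2 in \<open>auto simp: flat_def\<close>)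
  next
    case 3
    \<comment> \<open>To the right of 0, dividing by h multiplies the polynomial by 1/h, so the
      difference quotient is again a member of the family and tends to 0.\<close>
    have "((\<lambda>h. flat p h / h) \<longlongrightarrow> 0) (at_right 0)"
      by (rule Lim_transform_eventually[OF flat_tendsto_0[of "[:0, 1:] * p"]])
        (auto simp: eventually_at_right_field flat_def field_simps intro!: exI[of _ 1])
    moreover have "((\<lambda>h. flat p h / h) \<longlongrightarrow> 0) (at_left 0)"
      by (rule Lim_transform_eventually[OF tendsto_const])
        (auto simp: eventually_at_left_field flat_def intro!: exI[of _ "-1"])
    ultimately have "((\<lambda>h. flat p h / h) \<longlongrightarrow> 0) (at 0)"
      by (simp add: filterlim_split_at)
    then show ?thesis
      using 3 by (simp add: DERIV_def flat_def)
  qed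
qed

lemma Ck1_flat: "Ck1 k (flat p)"
proof (induction k arbitrary: p)
  case (Suc k)
  show ?case
    unfolding Ck1.simps using flat_derivative Suc.IH by blast
qed simp

lemma has_derivative_prod_components:
  fixes f f' :: "3 \<Rightarrow> real \<Rightarrow> real"
  assumes "\<And>i t. (f i has_real_derivative f' i t) (at t)"
  shows "((\<lambda>x::real^3. \<Prod>i\<in>UNIV. f i (x $ i)) has_derivative
    (\<lambda>y. \<Sum>i\<in>UNIV. (f' i (x $ i) * y $ i) * (\<Prod>j\<in>UNIV - {i}. f j (x $ j)))) (at x)"
proof (rule has_derivative_prod)
  fix i :: 3
  have "((\<lambda>x::real^3. x $ i) has_derivative (\<lambda>y. y $ i)) (at x)"
    by (intro bounded_linear.has_derivative[OF bounded_linear_vec_nth] has_derivative_ident)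
  then show "((\<lambda>x::real^3. f i (x $ i)) has_derivative (\<lambda>y. f' i (x $ i) * y $ i)) (at x)"
    using has_derivative_compose[of "\<lambda>x::real^3. x $ i" "\<lambda>y. y $ i" x UNIV "f i"
        "\<lambda>h. f' i (x $ i) * h"] assms[of i "x $ i"]
    by (simp add: has_field_derivative_def)
qed

text \<open>Differentiating a product of one-variable functions in direction j only replaces its
  j-th factor by the derivative, so the induction never leaves this class of products.\<close>

lemma Ck_prod:
  fixes f :: "3 \<Rightarrow> real \<Rightarrow> real"
  assumes "\<And>i. Ck1 (Suc k) (f i)"
  shows "Ck k (\<lambda>x. \<Prod>i\<in>UNIV. f i (x $ i))"
  using assms
proof (induction k arbitrary: f)
  case 0
  then have "continuous_on UNIV (f i)" for i
    by (metis Ck1.simps(2) DERIV_isCont continuous_at_imp_continuous_on)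
  then have "continuous_on UNIV (\<lambda>x::real^3. f i (x $ i))" for i
    by (rule continuous_on_compose2) (intro continuous_intros, simp)
  then show ?case
    by (simp add: continuous_on_prod)
next
  case (Suc k)
  have "\<forall>i. \<exists>g. (\<forall>x. (f i has_real_derivative g x) (at x)) \<and> Ck1 (Suc k) g"
    using Suc.prems by simp
  then obtain f' where f': "\<And>i x. (f i has_real_derivative f' i x) (at x)" "\<And>i. Ck1 (Suc k) (f' i)"
    by metis
  note d = has_derivative_prod_components[of f f', OF f'(1)]
  have "pderiv3 j (\<lambda>x. \<Prod>i\<in>UNIV. f i (x $ i)) = (\<lambda>x. \<Prod>i\<in>UNIV. (f(j := f' j)) i (x $ i))" for j
  proof
    fix x :: "real^3"
    have "pderiv3 j (\<lambda>x. \<Prod>i\<in>UNIV. f i (x $ i)) x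
      = (\<Sum>i\<in>UNIV. (f' i (x $ i) * (axis j 1 :: real^3) $ i) * (\<Prod>l\<in>UNIV - {i}. f l (x $ l)))"
      by (simp add: pderiv3_def flip: frechet_derivative_at[OF d[of x]])
    also have "\<dots> = (\<Sum>i\<in>UNIV. if i = j then f' j (x $ j) * (\<Prod>l\<in>UNIV - {j}. f l (x $ l)) else 0)"
      by (rule sum.cong) (auto simp: axis_def)
    also have "\<dots> = (\<Prod>i\<in>UNIV. (f(j := f' j)) i (x $ i))"
      by (subst prod.remove[of UNIV j]) (auto intro!: prod.cong)
    finally show "pderiv3 j (\<lambda>x. \<Prod>i\<in>UNIV. f i (x $ i)) x = (\<Prod>i\<in>UNIV. (f(j := f' j)) i (x $ i))" .
  qed
  moreover have "Ck k (\<lambda>x. \<Prod>i\<in>UNIV. (f(j := f' j)) i (x $ i))" for j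
    by (rule Suc.IH) (use f'(2) Suc.prems Ck1_SucD in \<open>auto simp del: Ck1.simps\<close>)
  ultimately show ?case
    using d by (auto simp: differentiable_def)
qed

text \<open>\<open>m\<close> is a steepness. Inside the box each factor exp(-1/(m t)) tends to 1 as
  m grows, and outside some factor vanishes identically, so the bumps tend to the indicator of the
  open box while staying between 0 and 1.\<close>

definition bump :: "real^3 \<Rightarrow> real^3 \<Rightarrow> real \<Rightarrow> scal" where
  "bump a b m x = (\<Prod>i\<in>UNIV. flat 1 (m * (x $ i - a $ i)) * flat 1 (m * (b $ i - x $ i)))"

lemma flat_1_bounds: "0 \<le> flat 1 t" "flat 1 t \<le> 1"
  by (auto simp: flat_def)

lemma bump_bounds: "0 \<le> bump a b m x" "bump a b m x \<le> 1"
  unfolding bump_def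
  by (auto intro!: prod_nonneg prod_le_1 mult_nonneg_nonneg mult_le_one flat_1_bounds)

lemma bump_outside:
  assumes "m > 0" "x \<notin> box a b"
  shows "bump a b m x = 0"
proof -
  obtain i where "x $ i \<le> a $ i \<or> b $ i \<le> x $ i"
    using assms(2) by (auto simp: mem_box_cart not_less)
  then have "m * (x $ i - a $ i) \<le> 0 \<or> m * (b $ i - x $ i) \<le> 0"
    using assms(1) by (auto simp: mult_le_0_iff)
  then show ?thesis
    unfolding bump_def by (intro prod_zero bexI[of _ i]) (auto simp: flat_def)
qed

lemma flat_scaled_tendsto_1:
  assumes "s > 0"
  shows "(\<lambda>k. flat 1 (real (Suc k) * s)) \<longlonglongrightarrow> 1"
proof -
  have "(\<lambda>k. exp (- (inverse s * inverse (real (Suc k))))) \<longlonglongrightarrow> exp (- (inverse s * 0))"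
    by (intro tendsto_intros LIMSEQ_inverse_real_of_nat)
  moreover have "flat 1 (real (Suc k) * s) = exp (- (inverse s * inverse (real (Suc k))))" for k
  proof -
    have "real (Suc k) * s > 0" using assms by simp
    then show ?thesis by (simp only: flat_def if_True poly_1 mult_1) (simp add: field_simps)
  qed
  ultimately show ?thesis by simp
qed

lemma bump_tendsto_indicator:
  "(\<lambda>k. bump a b (real (Suc k)) x) \<longlonglongrightarrow> indicator (box a b) x"
proof (cases "x \<in> box a b")
  case True
  have "(\<lambda>k. bump a b (real (Suc k)) x) \<longlonglongrightarrow> (\<Prod>i\<in>(UNIV::3 set). 1 * 1)"
    unfolding bump_def
    by (intro tendsto_prod tendsto_mult flat_scaled_tendsto_1) (use True in \<open>auto simp: mem_box_cart\<close>)
  then show ?thesis using True by simp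
next
  case False
  then have "(\<lambda>k. bump a b (real (Suc k)) x) = (\<lambda>k. 0)"
    by (auto simp: bump_outside)
  then show ?thesis using False by simp
qed

lemma bump_Ck: "Ck k (bump a b m)"
proof -
  have "Ck1 n (\<lambda>t. flat 1 (m * (t - a $ i)) * flat 1 (m * (b $ i - t)))" for n i
    using Ck1_mult[OF Ck1_affine[OF Ck1_flat[of n 1], of m "- m * a $ i"]
        Ck1_affine[OF Ck1_flat[of n 1], of "- m" "m * b $ i"]]
    by (simp add: algebra_simps)
  from Ck_prod[of k "\<lambda>i t. flat 1 (m * (t - a $ i)) * flat 1 (m * (b $ i - t))", OF this]
  show ?thesis by (simp add: bump_def[abs_def])
qed

lemma bump_test_function:
  assumes "m > 0" "cbox a b \<subseteq> \<Omega>"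
  shows "bump a b m \<in> test_functions \<Omega>"
proof -
  have "bump a b m x = 0" if "x \<notin> cbox a b" for x
  proof (rule bump_outside[OF assms(1)])
    show "x \<notin> box a b" using subsetD[OF box_subset_cbox] that by metis
  qed
  with assms(2) show ?thesis
    unfolding test_functions_def
    by (intro CollectI conjI allI bump_Ck exI[of _ "cbox a b"] impI) (rule compact_cbox, assumption, metis)
qed

subsection \<open>Test functions\<close>

lemma Ck_continuous: "Ck k f \<Longrightarrow> continuous_on UNIV f"
  by (cases k) (simp_all add: continuous_at_imp_continuous_on differentiable_imp_continuous_within)

lemma pderiv3_diff:
  assumes "\<And>x. f differentiable (at x)" "\<And>x. g differentiable (at x)"
  shows "pderiv3 j (\<lambda>x. f x - g x) = (\<lambda>x. pderiv3 j f x - pderiv3 j g x)"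
proof
  fix x
  have "((\<lambda>x. f x - g x) has_derivative
      (\<lambda>h. frechet_derivative f (at x) h - frechet_derivative g (at x) h)) (at x)"
    using assms by (intro has_derivative_diff) (auto simp: frechet_derivative_works[symmetric])
  from frechet_derivative_at[OF this]
  show "pderiv3 j (\<lambda>x. f x - g x) x = pderiv3 j f x - pderiv3 j g x"
    by (simp add: pderiv3_def fun_eq_iff)
qed

lemma pderiv3_mult:
  assumes "\<And>x. f differentiable (at x)" "\<And>x. g differentiable (at x)"
  shows "pderiv3 j (\<lambda>x. f x * g x) = (\<lambda>x. f x * pderiv3 j g x + pderiv3 j f x * g x)"
proof
  fix x
  have "((\<lambda>x. f x * g x) has_derivative
      (\<lambda>h. f x * frechet_derivative g (at x) h + frechet_derivative f (at x) h * g x)) (at x)"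
    using assms by (intro has_derivative_mult) (auto simp: frechet_derivative_works[symmetric])
  from frechet_derivative_at[OF this]
  show "pderiv3 j (\<lambda>x. f x * g x) x = f x * pderiv3 j g x + pderiv3 j f x * g x"
    by (simp add: pderiv3_def fun_eq_iff)
qed

lemma Ck_diff: "Ck k f \<Longrightarrow> Ck k g \<Longrightarrow> Ck k (\<lambda>x. f x - g x)"
  by (induction k arbitrary: f g) (simp_all add: continuous_on_diff pderiv3_diff)

text \<open>The complement of \<open>K\<close> is open, so \<open>f\<close> vanishes near
  \<open>x\<close>; hence differentiation does not enlarge the support of a test function.\<close>

lemma pderiv3_outside:
  assumes "closed K" "\<And>x. x \<notin> K \<Longrightarrow> f x = 0" "x \<notin> K"
  shows "pderiv3 j f x = 0"
proof -
  have "(f has_derivative (\<lambda>h. 0)) (at x)"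
    by (rule has_derivative_transform_within_open[of "\<lambda>x. 0" _ _ _ "- K"])
      (use assms in \<open>auto simp: open_Compl\<close>)
  from frechet_derivative_at[OF this] show ?thesis
    by (simp add: pderiv3_def fun_eq_iff)
qed

lemma zero_test_function: "(\<lambda>x. 0) \<in> test_functions \<Omega>"
proof -
  have "pderiv3 j (\<lambda>x. 0) = (\<lambda>x. 0)" for j
    by (auto simp: fun_eq_iff intro: pderiv3_outside[of "{}"])
  then have "Ck k (\<lambda>x. 0)" for k
    by (induction k) auto
  then show ?thesis by (auto simp: test_functions_def intro!: exI[of _ "{}"])
qed

lemma test_function_diff:
  assumes "f \<in> test_functions \<Omega>" "g \<in> test_functions \<Omega>"
  shows "(\<lambda>x. f x - g x) \<in> test_functions \<Omega>"
proof -
  obtain K K' where "compact K" "K \<subseteq> \<Omega>" "\<forall>x. x \<notin> K \<longrightarrow> f x = 0"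
    "compact K'" "K' \<subseteq> \<Omega>" "\<forall>x. x \<notin> K' \<longrightarrow> g x = 0"
    using assms by (auto simp: test_functions_def)
  then show ?thesis
    using assms by (auto simp: test_functions_def intro!: Ck_diff exI[of _ "K \<union> K'"])
qed

lemma test_function_pderiv3:
  assumes "f \<in> test_functions \<Omega>"
  shows "pderiv3 j f \<in> test_functions \<Omega>"
proof -
  obtain K where K: "compact K" "K \<subseteq> \<Omega>" "\<And>x. x \<notin> K \<Longrightarrow> f x = 0"
    using assms by (auto simp: test_functions_def)
  have "Ck (Suc k) f" for k using assms by (simp add: test_functions_def)
  then have "Ck k (pderiv3 j f)" for k by simp
  moreover have "\<forall>x. x \<notin> K \<longrightarrow> pderiv3 j f x = 0"
    using pderiv3_outside[OF compact_imp_closed[OF K(1)] K(3)] by auto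
  ultimately show ?thesis using K by (auto simp: test_functions_def)
qed

lemma continuous_compact_support_bounded:
  fixes f :: "'a::topological_space \<Rightarrow> real"
  assumes "continuous_on UNIV f" "compact K" "\<And>x. x \<notin> K \<Longrightarrow> f x = 0"
  obtains B where "\<And>x. \<bar>f x\<bar> \<le> B" "B \<ge> 0"
proof -
  have "bounded (f ` K)"
    using assms by (intro compact_imp_bounded compact_continuous_image) (auto intro: continuous_on_subset)
  then obtain B where "\<And>x. x \<in> K \<Longrightarrow> \<bar>f x\<bar> \<le> B" by (auto simp: bounded_iff)
  then have "\<bar>f x\<bar> \<le> max B 0" for x
    using assms(3) by (cases "x \<in> K") (auto simp: max.coboundedI1)
  then show ?thesis using that[of "max B 0"] by simp
qed

lemma continuous_imp_measurable_lebesgue_on: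
  fixes f :: "real^3 \<Rightarrow> 'a::euclidean_space"
  assumes "continuous_on UNIV f"
  shows "f \<in> borel_measurable (lebesgue_on \<Omega>)"
  using borel_measurable_continuous_onI[OF assms]
  by (intro measurable_restrict_space1 measurable_completion) simp

lemma test_function_L2:
  assumes "\<Omega> \<in> lmeasurable" "f \<in> test_functions \<Omega>"
  shows "f \<in> L2 \<Omega>"
proof -
  obtain K where K: "compact K" "\<And>x. x \<notin> K \<Longrightarrow> f x = 0"
    using assms by (auto simp: test_functions_def)
  have c: "continuous_on UNIV f"
    using assms(2) Ck_continuous by (auto simp: test_functions_def)
  obtain B where "\<And>x. \<bar>f x\<bar> \<le> B"
    by (rule continuous_compact_support_bounded[OF c K]) auto
  then show ?thesis
    by (intro L2_bounded assms continuous_imp_measurable_lebesgue_on c) auto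
qed

subsection \<open>The fundamental lemma of the calculus of variations\<close>

lemma L2_integrable:
  fixes g :: "real^3 \<Rightarrow> real"
  assumes "\<Omega> \<in> lmeasurable" "g \<in> L2 \<Omega>"
  shows "integrable (lebesgue_on \<Omega>) g"
proof -
  have "(\<lambda>x. 1::real) \<in> L2 \<Omega>" by (rule L2_bounded[of _ _ 1]) (use assms in auto)
  from L2_inner_integrable[OF assms(2) this] show ?thesis by simp
qed

text \<open>Bumps tend boundedly to indicators of boxes, so \<open>g\<close> integrates to zero over
  every closed box inside the domain. Lebesgue differentiation along shrinking cubes then gives g =
  0 at almost every point.\<close>

lemma AE_zero_if_orthogonal_to_test_functions:
  assumes \<Omega>: "open \<Omega>" "\<Omega> \<in> lmeasurable" and g: "g \<in> L2 \<Omega>"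
    and orth: "\<And>\<phi>. \<phi> \<in> test_functions \<Omega> \<Longrightarrow> L2_inner \<Omega> g \<phi> = 0"
  shows "AE x in lebesgue_on \<Omega>. g x = (0::real)"
proof -
  have \<Omega>s: "\<Omega> \<in> sets lebesgue" by (rule fmeasurableD) fact
  \<comment> \<open>Extension by zero, because the differentiation theorem concerns functions on the
    whole space.\<close>
  define G where "G x = (if x \<in> \<Omega> then g x else 0)" for x
  have Gi: "integrable lebesgue G"
  proof -
    have "G = (\<lambda>x. indicator \<Omega> x *\<^sub>R g x)" by (auto simp: G_def indicator_def)
    then show ?thesis
      using L2_integrable[OF \<Omega>(2) g] \<Omega>s by (simp add: integrable_restrict_space)
  qed
  have boxes: "integral (cbox a b) G = 0" if ab: "cbox a b \<subseteq> \<Omega>" for a b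
  proof -
    have gm: "g \<in> borel_measurable (lebesgue_on \<Omega>)" using g by (simp add: L2_def)
    have "(\<lambda>k. LINT x|lebesgue_on \<Omega>. g x * bump a b (real (Suc k)) x)
        \<longlonglongrightarrow> (LINT x|lebesgue_on \<Omega>. g x * indicator (box a b) x)"
    proof (rule integral_dominated_convergence[where w = "\<lambda>x. \<bar>g x\<bar>"])
      show "(\<lambda>x. g x * indicator (box a b) x) \<in> borel_measurable (lebesgue_on \<Omega>)"
      proof (intro borel_measurable_times gm)
        have "indicator (box a b) \<in> borel_measurable lebesgue"
          by (rule borel_measurable_indicator) simp
        then show "indicator (box a b) \<in> borel_measurable (lebesgue_on \<Omega>)"
          by (rule measurable_restrict_space1)
      qed
      show "(\<lambda>x. g x * bump a b (real (Suc k)) x) \<in> borel_measurable (lebesgue_on \<Omega>)" for k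
        using bump_Ck[of 0 a b]
        by (intro borel_measurable_times gm continuous_imp_measurable_lebesgue_on) simp
      show "integrable (lebesgue_on \<Omega>) (\<lambda>x. \<bar>g x\<bar>)"
        by (intro integrable_abs L2_integrable \<Omega> g)
      show "AE x in lebesgue_on \<Omega>. (\<lambda>k. g x * bump a b (real (Suc k)) x) \<longlonglongrightarrow> g x * indicator (box a b) x"
        by (intro AE_I2 tendsto_mult tendsto_const bump_tendsto_indicator)
      show "AE x in lebesgue_on \<Omega>. norm (g x * bump a b (real (Suc k)) x) \<le> \<bar>g x\<bar>" for k
        by (intro AE_I2) (auto simp: abs_mult bump_bounds intro!: mult_left_le)
    qed
    moreover have "(LINT x|lebesgue_on \<Omega>. g x * bump a b (real (Suc k)) x) = 0" for k
      using orth[OF bump_test_function[of "real (Suc k)", OF _ ab]] by (simp add: L2_inner_def)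
    ultimately have "(LINT x|lebesgue_on \<Omega>. g x * indicator (box a b) x) = 0"
      by (simp add: LIMSEQ_const_iff del: of_nat_Suc)
    also have "(LINT x|lebesgue_on \<Omega>. g x * indicator (box a b) x)
        = (LINT x|lebesgue. indicator \<Omega> x *\<^sub>R (g x * indicator (box a b) x))"
      by (rule integral_restrict_space) (use \<Omega>s in simp)
    also have "\<dots> = (LINT x|lebesgue. indicator (box a b) x *\<^sub>R G x)"
      by (rule Bochner_Integration.integral_cong) (auto simp: G_def indicator_def)
    also have "\<dots> = (LINT x|lebesgue_on (box a b). G x)"
      by (rule integral_restrict_space[symmetric]) simp
    also have "\<dots> = integral (box a b) G"
    proof (rule lebesgue_integral_eq_integral)
      show "integrable (lebesgue_on (box a b)) G"
        using integrable_mult_indicator[OF _ Gi, of "box a b"] by (simp add: integrable_restrict_space)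
    qed simp
    also have "\<dots> = integral (cbox a b) G"
      using integral_open_interval[of a b G] by simp
    finally show ?thesis .
  qed
  have "G integrable_on cbox a b" for a b
    using integrable_on_lebesgue[OF Gi] integrable_on_subcbox by blast
  \<comment> \<open>The Lebesgue differentiation theorem for cubes with lower corner x and side
    h.\<close>
  then obtain N where N: "negligible N" and
    diff: "\<And>x e. \<lbrakk>x \<notin> N; 0 < e\<rbrakk> \<Longrightarrow> \<exists>d>0. \<forall>h. 0 < h \<and> h < d \<longrightarrow>
       norm (integral (cbox x (x + h *\<^sub>R One)) G /\<^sub>R h ^ DIM(real^3) - G x) < e"
    using integrable_ccontinuous_explicit[of G] by blast
  have zero: "g x = 0" if x: "x \<in> \<Omega>" "x \<notin> N" for x
  proof -
    have "\<bar>g x\<bar> < e" if e: "e > 0" for e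
    proof -
      obtain d where d: "d > 0" "\<And>h. 0 < h \<Longrightarrow> h < d \<Longrightarrow>
         norm (integral (cbox x (x + h *\<^sub>R One)) G /\<^sub>R h ^ DIM(real^3) - G x) < e"
        using diff[OF x(2) e] by blast
      obtain \<rho> where \<rho>: "\<rho> > 0" "ball x \<rho> \<subseteq> \<Omega>"
        using \<Omega>(1) x(1) open_contains_ball by blast
      \<comment> \<open>The first entry keeps h below d. The second makes the diagonal of the cube
        at most \<rho>/2, so the cube stays in the ball; adding 1 gives strict room.\<close>
      define h where "h = min (d / 2) (\<rho> / (2 * (norm (One::real^3) + 1)))"
      have np: "norm (One::real^3) + 1 > 0" by (simp add: add_nonneg_pos)
      have "\<rho> / (2 * (norm (One::real^3) + 1)) > 0" using \<rho>(1) np by simp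
      then have h: "h > 0" "h < d" using d(1) unfolding h_def by linarith+
      have sub: "cbox x (x + h *\<^sub>R One) \<subseteq> ball x \<rho>"
      proof
        fix y assume y: "y \<in> cbox x (x + h *\<^sub>R One)"
        have "norm (y - x) \<le> norm (h *\<^sub>R One :: real^3)"
        proof (rule norm_le_componentwise_cart)
          fix i
          have "x $ i \<le> y $ i" "y $ i \<le> x $ i + h * (One::real^3) $ i"
            using y by (auto simp: mem_box_cart)
          then show "norm ((y - x) $ i) \<le> norm ((h *\<^sub>R One :: real^3) $ i)"
            by auto
        qed
        also have "\<dots> < h * (norm (One::real^3) + 1)" using h by (simp add: algebra_simps)
        also have "\<dots> \<le> \<rho> / (2 * (norm (One::real^3) + 1)) * (norm (One::real^3) + 1)"
          using np by (intro mult_right_mono) (auto simp: h_def)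
        also have "\<dots> = \<rho> / 2" using np by (simp only: times_divide_eq_left) (simp add: divide_simps)
        also have "\<dots> < \<rho>" using \<rho>(1) by simp
        finally show "y \<in> ball x \<rho>" by (simp add: dist_norm norm_minus_commute)
      qed
      have "integral (cbox x (x + h *\<^sub>R One)) G = 0" by (rule boxes[OF order_trans[OF sub \<rho>(2)]])
      then show ?thesis using d(2)[OF h] x(1) by (simp add: G_def)
    qed
    \<comment> \<open>If g x were nonzero, its absolute value would be an admissible e and smaller
      than itself.\<close>
    from this[of "\<bar>g x\<bar>"] show ?thesis by auto
  qed
  have "N \<in> null_sets lebesgue" using N by (simp add: negligible_iff_null_sets)
  then have "AE x in lebesgue. x \<notin> N" by (rule AE_not_in)
  then have "AE x in lebesgue. x \<in> \<Omega> \<longrightarrow> g x = 0"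
    by (rule AE_mp) (use zero in auto)
  then show ?thesis
    using \<Omega>s by (simp add: AE_restrict_space_iff)
qed

subsection \<open>Integration by parts\<close>

text \<open>By translation invariance the difference quotients integrate to zero; the derivative is
  their dominated limit.\<close>

lemma integral_pderiv3_compact_support:
  assumes F: "Ck 1 F" and K: "compact K" "\<And>x. x \<notin> K \<Longrightarrow> F x = 0"
  shows "(LINT x|lborel. pderiv3 j F x) = 0"
proof -
  define u where "u = (axis j 1 :: real^3)"
  have nu: "norm u = 1" by (simp add: u_def norm_axis_1)
  have dF: "(F has_derivative frechet_derivative F (at x)) (at x)" for x
    using F by (auto simp: frechet_derivative_works[symmetric])
  have cF: "continuous_on UNIV F" using F by (rule Ck_continuous)
  have cdF: "continuous_on UNIV (pderiv3 j F)" using F by simp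
  have "\<And>x. x \<notin> K \<Longrightarrow> pderiv3 j F x = 0"
    using pderiv3_outside[OF compact_imp_closed[OF K(1)] K(2)] by auto
  then obtain B where B: "\<And>x. \<bar>pderiv3 j F x\<bar> \<le> B" "B \<ge> 0"
    by (rule continuous_compact_support_bounded[OF cdF K(1)]) auto
  obtain R where R: "\<And>x. x \<in> K \<Longrightarrow> norm x \<le> R"
    using compact_imp_bounded[OF K(1)] by (auto simp: bounded_iff)
  have line: "((\<lambda>t. F (x + t *\<^sub>R u)) has_real_derivative pderiv3 j F (x + t *\<^sub>R u)) (at t)" for x t
  proof -
    have "((\<lambda>t. x + t *\<^sub>R u) has_derivative (\<lambda>t. t *\<^sub>R u)) (at t)"
      by (auto intro!: derivative_eq_intros)
    from has_derivative_compose[OF this dF]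
    have "((\<lambda>t. F (x + t *\<^sub>R u)) has_derivative
        (\<lambda>s. frechet_derivative F (at (x + t *\<^sub>R u)) (s *\<^sub>R u))) (at t)" .
    moreover have "frechet_derivative F (at (x + t *\<^sub>R u)) (s *\<^sub>R u) = pderiv3 j F (x + t *\<^sub>R u) * s" for s
      using linear_cmul[OF has_derivative_linear[OF dF]] by (simp add: pderiv3_def u_def)
    ultimately show ?thesis by (simp add: has_field_derivative_def)
  qed
  define h where "h k = inverse (real (Suc k))" for k
  have h: "h k > 0" "h k \<le> 1" for k by (auto simp: h_def field_simps)
  define q where "q k x = (F (x + h k *\<^sub>R u) - F x) / h k" for k x
  have "integrable lborel F"
  proof (rule Bochner_Integration.integrable_cong[THEN iffD1])
    show "integrable lborel (\<lambda>x. indicator K x *\<^sub>R F x)"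
      using borel_integrable_compact[OF K(1), of F] cF continuous_on_subset by blast
  qed (use K(2) in \<open>auto simp: indicator_def\<close>)
  have tr: "integrable lborel (\<lambda>x. F (x + c)) \<and> (LINT x|lborel. F (x + c)) = (LINT x|lborel. F x)" for c
  proof -
    have "integrable (distr lborel borel ((+) c)) F"
      using \<open>integrable lborel F\<close> by (simp add: lborel_distr_plus)
    then have "integrable lborel (\<lambda>x. F (c + x))"
      by (subst (asm) integrable_distr_eq) (use cF in \<open>auto intro: borel_measurable_continuous_onI\<close>)
    moreover have "(LINT x|distr lborel borel ((+) c). F x) = (LINT x|lborel. F (c + x))"
      by (rule integral_distr) (use cF in \<open>auto intro: borel_measurable_continuous_onI\<close>)
    ultimately show ?thesis by (simp add: lborel_distr_plus add.commute)
  qed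
  have q0: "(LINT x|lborel. q k x) = 0" for k
    using tr \<open>integrable lborel F\<close> by (simp add: q_def)
  have "(\<lambda>k. LINT x|lborel. q k x) \<longlonglongrightarrow> (LINT x|lborel. pderiv3 j F x)"
  \<comment> \<open>By the mean value theorem the quotients are bounded by B. Since
    \<open>h k\<close> is at most 1, they vanish at points farther than R + 1 from the origin, where
    neither x nor its translate lies in K.\<close>
  proof (rule integral_dominated_convergence[where w = "\<lambda>x. indicator (cball 0 (R + 1)) x *\<^sub>R B"])
    show "pderiv3 j F \<in> borel_measurable lborel"
      using borel_measurable_continuous_onI[OF cdF] by simp
    show "q k \<in> borel_measurable lborel" for k
    proof -
      have "continuous_on UNIV (q k)"
        unfolding q_def using h[of k]
        by (intro continuous_intros continuous_on_compose2[OF cF]) auto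
      then show ?thesis using borel_measurable_continuous_onI by simp
    qed
    show "integrable lborel (\<lambda>x::real^3. indicator (cball 0 (R + 1)) x *\<^sub>R B)"
      by (rule borel_integrable_compact) auto
    show "AE x in lborel. (\<lambda>k. q k x) \<longlonglongrightarrow> pderiv3 j F x"
    proof (rule AE_I2)
      fix x
      have "((\<lambda>s. (F (x + s *\<^sub>R u) - F x) / s) \<longlongrightarrow> pderiv3 j F x) (at 0)"
        using line[of x 0] by (simp add: DERIV_def)
      moreover have "filterlim h (at 0) sequentially"
        unfolding filterlim_at using h(1) LIMSEQ_inverse_real_of_nat
        by (auto simp: h_def[abs_def] less_imp_neq[symmetric])
      ultimately show "(\<lambda>k. q k x) \<longlonglongrightarrow> pderiv3 j F x"
        unfolding q_def by (rule filterlim_compose)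
    qed
    show "AE x in lborel. norm (q k x) \<le> indicator (cball 0 (R + 1)) x *\<^sub>R B" for k
    proof (rule AE_I2)
      fix x
      have "\<bar>q k x\<bar> \<le> B"
      proof -
        obtain z where "F (x + h k *\<^sub>R u) - F (x + 0 *\<^sub>R u) = (h k - 0) * pderiv3 j F (x + z *\<^sub>R u)"
          using MVT2[of 0 "h k" "\<lambda>t. F (x + t *\<^sub>R u)" "\<lambda>t. pderiv3 j F (x + t *\<^sub>R u)"] line h(1)[of k]
          by blast
        then have "q k x = pderiv3 j F (x + z *\<^sub>R u)"
          using h(1)[of k] by (simp add: q_def)
        then show ?thesis using B by simp
      qed
      moreover have "q k x = 0" if "x \<notin> cball 0 (R + 1)"
      proof -
        have "norm x \<le> norm (x + h k *\<^sub>R u) + norm (h k *\<^sub>R u)"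
          by (metis add_diff_cancel norm_triangle_sub norm_triangle_ineq4)
        then have "norm (x + h k *\<^sub>R u) > R" "norm x > R" using that h[of k] nu by auto
        then have "x + h k *\<^sub>R u \<notin> K" "x \<notin> K" using R by force+
        then show ?thesis using K(2) by (simp add: q_def)
      qed
      ultimately show "norm (q k x) \<le> indicator (cball 0 (R + 1)) x *\<^sub>R B"
        by (cases "x \<in> cball 0 (R + 1)") auto
    qed
  qed
  then show ?thesis by (simp add: q0 LIMSEQ_const_iff)
qed

text \<open>Leads from the restricted Lebesgue integral of the weak formulation to the Borel
  integral, where the vanishing integral of a derivative is available.\<close>

lemma L2_inner_eq_lborel:
  assumes "\<Omega> \<in> sets lebesgue" "continuous_on UNIV f" "continuous_on UNIV g"
    and "\<And>x. x \<notin> \<Omega> \<Longrightarrow> g x = 0"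
  shows "L2_inner \<Omega> f g = (LINT x|lborel. f x * (g x :: real))"
proof -
  have "L2_inner \<Omega> f g = (LINT x|lebesgue. indicator \<Omega> x *\<^sub>R (f x * g x))"
    unfolding L2_inner_def inner_real_def by (rule integral_restrict_space) (use assms in simp)
  also have "\<dots> = (LINT x|lebesgue. f x * g x)"
    by (rule Bochner_Integration.integral_cong) (use assms(4) in \<open>auto simp: indicator_def\<close>)
  also have "\<dots> = (LINT x|lborel. f x * g x)"
    using borel_measurable_continuous_onI[OF assms(2)] borel_measurable_continuous_onI[OF assms(3)]
    by (intro integral_completion) simp
  finally show ?thesis .
qed

text \<open>The derivative of the compactly supported product u \<phi> integrates to zero. The
  support of \<open>u\<close> is arbitrary, so \<open>u\<close> can be a test function as well as a
  polynomial.\<close>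

lemma integration_by_parts:
  assumes \<Omega>: "\<Omega> \<in> sets lebesgue" and u: "Ck 1 u" and \<phi>: "\<phi> \<in> test_functions \<Omega>"
  shows "L2_inner \<Omega> u (pderiv3 j \<phi>) = - L2_inner \<Omega> (pderiv3 j u) \<phi>"
proof -
  obtain K where K: "compact K" "K \<subseteq> \<Omega>" "\<And>x. x \<notin> K \<Longrightarrow> \<phi> x = 0"
    using \<phi> by (auto simp: test_functions_def)
  have dK: "pderiv3 i \<phi> x = 0" if "x \<notin> K" for i x
    using pderiv3_outside[OF compact_imp_closed[OF K(1)] K(3) that] .
  have "Ck 1 \<phi>" using \<phi> by (auto simp: test_functions_def)
  then have du: "\<And>x. u differentiable (at x)" "\<And>x. \<phi> differentiable (at x)"
    and c: "continuous_on UNIV u" "continuous_on UNIV \<phi>"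
      "\<And>i. continuous_on UNIV (pderiv3 i u)" "\<And>i. continuous_on UNIV (pderiv3 i \<phi>)"
    using u Ck_continuous[OF u] Ck_continuous[OF \<open>Ck 1 \<phi>\<close>] by auto
  have "Ck 1 (\<lambda>x. u x * \<phi> x)"
    using du c by (auto simp: pderiv3_mult intro!: continuous_intros)
  then have "(LINT x|lborel. pderiv3 j (\<lambda>x. u x * \<phi> x) x) = 0"
    by (rule integral_pderiv3_compact_support[OF _ K(1)]) (simp add: K(3))
  then have "(LINT x|lborel. u x * pderiv3 j \<phi> x + pderiv3 j u x * \<phi> x) = 0"
    by (simp add: pderiv3_mult du)
  moreover have "integrable lborel (\<lambda>x. v x * w x)"
    if "continuous_on UNIV v" "continuous_on UNIV w" "\<And>x. x \<notin> K \<Longrightarrow> w x = 0" for v w :: scal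
  proof (rule Bochner_Integration.integrable_cong[THEN iffD1])
    show "integrable lborel (\<lambda>x. indicator K x *\<^sub>R (v x * w x))"
      using that by (intro borel_integrable_compact K continuous_intros)
        (auto intro: continuous_on_subset)
  qed (use that(3) in \<open>auto simp: indicator_def\<close>)
  ultimately have "(LINT x|lborel. u x * pderiv3 j \<phi> x) + (LINT x|lborel. pderiv3 j u x * \<phi> x) = 0"
    using c K(3) dK by simp
  moreover have "L2_inner \<Omega> u (pderiv3 j \<phi>) = (LINT x|lborel. u x * pderiv3 j \<phi> x)"
    by (rule L2_inner_eq_lborel) (use \<Omega> c dK K(2) in blast)+
  moreover have "L2_inner \<Omega> (pderiv3 j u) \<phi> = (LINT x|lborel. pderiv3 j u x * \<phi> x)"
    by (rule L2_inner_eq_lborel) (use \<Omega> c K in blast)+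
  ultimately show ?thesis by simp
qed

subsection \<open>Weak derivatives\<close>

text \<open>The geometry is kept this weak so that the same theory can be instantiated a second
  time, on the part of the domain inside a single mesh element.\<close>

locale bounded_open =
  fixes \<Omega> :: "(real^3) set"
  assumes open_domain: "open \<Omega>" and bounded_domain: "bounded \<Omega>"
begin

lemma lmeasurable_domain: "\<Omega> \<in> lmeasurable"
  using bounded_domain open_domain by (simp add: lmeasurable_open)

lemma sets_domain: "\<Omega> \<in> sets lebesgue"
  using lmeasurable_domain by (rule fmeasurableD)

lemmas test_L2 = test_function_L2[OF lmeasurable_domain]

lemma L2_eq_AE:
  fixes f g :: "real^3 \<Rightarrow> real"
  assumes "f \<in> L2 \<Omega>" "g \<in> L2 \<Omega>"
    and "\<And>\<phi>. \<phi> \<in> test_functions \<Omega> \<Longrightarrow> L2_inner \<Omega> f \<phi> = L2_inner \<Omega> g \<phi>"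
  shows "AE x in lebesgue_on \<Omega>. f x = g x"
proof -
  have "AE x in lebesgue_on \<Omega>. f x - g x = 0"
    by (rule AE_zero_if_orthogonal_to_test_functions[OF open_domain lmeasurable_domain])
      (use assms in \<open>auto simp: L2_diff L2_inner_diff_left test_L2\<close>)
  then show ?thesis by simp
qed

lemma L2_vec_eq_AE:
  fixes f g :: vecf
  assumes "f \<in> L2 \<Omega>" "g \<in> L2 \<Omega>"
    and "\<And>\<phi> j. \<phi> \<in> test_functions \<Omega> \<Longrightarrow>
      L2_inner \<Omega> (\<lambda>x. f x $ j) \<phi> = L2_inner \<Omega> (\<lambda>x. g x $ j) \<phi>"
  shows "AE x in lebesgue_on \<Omega>. f x = g x"
proof -
  have "AE x in lebesgue_on \<Omega>. f x $ j = g x $ j" for j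
    using assms by (intro L2_eq_AE L2_component)
  then have "AE x in lebesgue_on \<Omega>. \<forall>j\<in>UNIV. f x $ j = g x $ j"
    by (intro AE_finite_allI) auto
  then show ?thesis by (simp add: vec_eq_iff)
qed

section \<open>Weak gradients and scalar Sobolev functions\<close>

lemma weak_grad_unique:
  assumes "is_weak_grad \<Omega> u g" "is_weak_grad \<Omega> u g'"
  shows "AE x in lebesgue_on \<Omega>. g x = g' x"
  using assms by (intro L2_vec_eq_AE) (auto simp: is_weak_grad_def)

lemma weak_grad_diff:
  assumes "u \<in> L2 \<Omega>" "v \<in> L2 \<Omega>" "is_weak_grad \<Omega> u g" "is_weak_grad \<Omega> v k"
  shows "is_weak_grad \<Omega> (\<lambda>x. u x - v x) (\<lambda>x. g x - k x)"
  using assms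
  by (auto simp: is_weak_grad_def L2_diff L2_inner_diff_left L2_component test_L2 test_function_pderiv3)

lemma weak_grad_wgrad: "u \<in> H1 \<Omega> \<Longrightarrow> is_weak_grad \<Omega> u (wgrad \<Omega> u)"
  unfolding wgrad_def H1_def using someI_ex[of "is_weak_grad \<Omega> u"] by blast

lemma H1_L2: "u \<in> H1 \<Omega> \<Longrightarrow> u \<in> L2 \<Omega>"
  by (simp add: H1_def)

lemma wgrad_L2: "u \<in> H1 \<Omega> \<Longrightarrow> wgrad \<Omega> u \<in> L2 \<Omega>"
  using weak_grad_wgrad by (simp add: is_weak_grad_def)

lemma H1_diff: "u \<in> H1 \<Omega> \<Longrightarrow> v \<in> H1 \<Omega> \<Longrightarrow> (\<lambda>x. u x - v x) \<in> H1 \<Omega>"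
  unfolding H1_def using weak_grad_diff L2_diff by blast

text \<open>Both sides are weak gradients of u - v, so uniqueness identifies them; the three choices
  made by \<open>wgrad\<close> are independent of one another, hence the almost everywhere
  form.\<close>

lemma wgrad_diff:
  assumes "u \<in> H1 \<Omega>" "v \<in> H1 \<Omega>"
  shows "AE x in lebesgue_on \<Omega>. wgrad \<Omega> (\<lambda>x. u x - v x) x = wgrad \<Omega> u x - wgrad \<Omega> v x"
  by (rule weak_grad_unique[OF weak_grad_wgrad weak_grad_diff])
    (use assms in \<open>auto intro: weak_grad_wgrad H1_diff H1_L2\<close>)

lemma L2_inner_wgrad_diff:
  assumes "u \<in> H1 \<Omega>" "v \<in> H1 \<Omega>" "D \<in> L2 \<Omega>"
  shows "L2_inner \<Omega> (wgrad \<Omega> (\<lambda>x. u x - v x)) D = L2_inner \<Omega> (wgrad \<Omega> u) D - L2_inner \<Omega> (wgrad \<Omega> v) D"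
  using L2_inner_cong[OF wgrad_diff, of u v D] assms
  by (simp add: L2_inner_diff_left L2_diff wgrad_L2 H1_diff)

text \<open>The classical gradient is a weak one. This lets the triangle inequality be applied to
  the approximation errors in the definition of \<open>H10\<close>.\<close>

lemma test_function_H1:
  assumes "\<phi> \<in> test_functions \<Omega>"
  shows "\<phi> \<in> H1 \<Omega>"
proof -
  have "Ck 1 \<phi>" using assms by (auto simp: test_functions_def)
  then have "is_weak_grad \<Omega> \<phi> (\<lambda>x. \<chi> j. pderiv3 j \<phi> x)"
    unfolding is_weak_grad_def using assms
    by (auto intro!: L2_vecI simp: test_L2 test_function_pderiv3 integration_by_parts sets_domain)
  then show ?thesis using assms test_L2 by (auto simp: H1_def)
qed

text \<open>The L2 triangle inequality for values and for gradients, followed by the Euclidean one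
  in the plane for the two resulting pairs of norms.\<close>

lemma H1_norm_triangle:
  assumes "u \<in> H1 \<Omega>" "v \<in> H1 \<Omega>"
  shows "H1_norm \<Omega> (\<lambda>x. u x - v x) \<le> H1_norm \<Omega> u + H1_norm \<Omega> v"
proof -
  have a: "L2_norm \<Omega> (\<lambda>x. u x - v x) \<le> L2_norm \<Omega> u + L2_norm \<Omega> v"
    using assms by (intro L2_norm_triangle H1_L2)
  have "L2_norm \<Omega> (wgrad \<Omega> (\<lambda>x. u x - v x)) = L2_norm \<Omega> (\<lambda>x. wgrad \<Omega> u x - wgrad \<Omega> v x)"
    using assms by (intro L2_norm_cong wgrad_diff wgrad_L2 L2_diff H1_diff)
  also have "\<dots> \<le> L2_norm \<Omega> (wgrad \<Omega> u) + L2_norm \<Omega> (wgrad \<Omega> v)"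
    using assms by (intro L2_norm_triangle wgrad_L2)
  finally have b: "L2_norm \<Omega> (wgrad \<Omega> (\<lambda>x. u x - v x))
    \<le> L2_norm \<Omega> (wgrad \<Omega> u) + L2_norm \<Omega> (wgrad \<Omega> v)" .
  have "H1_norm \<Omega> (\<lambda>x. u x - v x) \<le> sqrt ((L2_norm \<Omega> u + L2_norm \<Omega> v)\<^sup>2
      + (L2_norm \<Omega> (wgrad \<Omega> u) + L2_norm \<Omega> (wgrad \<Omega> v))\<^sup>2)"
    unfolding H1_norm_def using a b
    by (intro real_sqrt_le_mono add_mono power_mono L2_norm_nonneg)
  also have "\<dots> \<le> H1_norm \<Omega> u + H1_norm \<Omega> v"
    unfolding H1_norm_def by (rule real_sqrt_sum_squares_triangle_ineq)
  finally show ?thesis .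
qed

lemma H10_diff:
  assumes "u \<in> H10 \<Omega>" "v \<in> H10 \<Omega>"
  shows "(\<lambda>x. u x - v x) \<in> H10 \<Omega>"
proof -
  obtain \<phi> \<psi> where \<phi>: "\<And>k::nat. \<phi> k \<in> test_functions \<Omega>" "(\<lambda>k. H1_norm \<Omega> (\<lambda>x. \<phi> k x - u x)) \<longlonglongrightarrow> 0"
    and \<psi>: "\<And>k::nat. \<psi> k \<in> test_functions \<Omega>" "(\<lambda>k. H1_norm \<Omega> (\<lambda>x. \<psi> k x - v x)) \<longlonglongrightarrow> 0"
    using assms by (auto simp: H10_def)
  have uv: "u \<in> H1 \<Omega>" "v \<in> H1 \<Omega>" using assms by (auto simp: H10_def)
  have "(\<lambda>k. H1_norm \<Omega> (\<lambda>x. (\<phi> k x - \<psi> k x) - (u x - v x))) \<longlonglongrightarrow> 0"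
  proof (rule tendsto_sandwich)
    show "\<forall>\<^sub>F k in sequentially. 0 \<le> H1_norm \<Omega> (\<lambda>x. (\<phi> k x - \<psi> k x) - (u x - v x))"
      by (simp add: H1_norm_def)
    have "H1_norm \<Omega> (\<lambda>x. (\<phi> k x - \<psi> k x) - (u x - v x))
        \<le> H1_norm \<Omega> (\<lambda>x. \<phi> k x - u x) + H1_norm \<Omega> (\<lambda>x. \<psi> k x - v x)" for k
    proof -
      \<comment> \<open>Regrouped as the difference of the two approximation errors, both of which
        tend to zero.\<close>
      have "(\<lambda>x. (\<phi> k x - \<psi> k x) - (u x - v x)) = (\<lambda>x. (\<phi> k x - u x) - (\<psi> k x - v x))" by auto
      moreover have "H1_norm \<Omega> (\<lambda>x. (\<phi> k x - u x) - (\<psi> k x - v x))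
          \<le> H1_norm \<Omega> (\<lambda>x. \<phi> k x - u x) + H1_norm \<Omega> (\<lambda>x. \<psi> k x - v x)"
        by (intro H1_norm_triangle H1_diff uv test_function_H1[OF \<phi>(1)] test_function_H1[OF \<psi>(1)])
      ultimately show ?thesis by simp
    qed
    then show "\<forall>\<^sub>F k in sequentially. H1_norm \<Omega> (\<lambda>x. (\<phi> k x - \<psi> k x) - (u x - v x))
        \<le> H1_norm \<Omega> (\<lambda>x. \<phi> k x - u x) + H1_norm \<Omega> (\<lambda>x. \<psi> k x - v x)" by simp
    show "(\<lambda>k. H1_norm \<Omega> (\<lambda>x. \<phi> k x - u x) + H1_norm \<Omega> (\<lambda>x. \<psi> k x - v x)) \<longlonglongrightarrow> 0"
      using tendsto_add[OF \<phi>(2) \<psi>(2)] by simp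
  qed simp
  then show ?thesis
    unfolding H10_def using \<phi>(1) \<psi>(1) uv
    by (intro CollectI conjI H1_diff exI[of _ "\<lambda>k x. \<phi> k x - \<psi> k x"] allI test_function_diff)
qed

section \<open>Weak curls\<close>

lemma test_field_curl_L2:
  assumes "\<Phi> \<in> test_fields \<Omega>"
  shows "classical_curl \<Phi> \<in> L2 \<Omega>"
proof (rule L2_vecI)
  fix i :: 3
  have "(\<lambda>x. pderiv3 j (\<lambda>y. \<Phi> y $ l) x - pderiv3 l (\<lambda>y. \<Phi> y $ j) x) \<in> L2 \<Omega>" for j l
    using assms by (intro L2_diff test_L2 test_function_pderiv3) (auto simp: test_fields_def)
  moreover have "i = 1 \<or> i = 2 \<or> i = 3" by (rule exhaust_3)
  ultimately show "(\<lambda>x. classical_curl \<Phi> x $ i) \<in> L2 \<Omega>"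
    by (auto simp: classical_curl_def vector_3)
qed

lemma test_field_L2: "\<Phi> \<in> test_fields \<Omega> \<Longrightarrow> \<Phi> \<in> L2 \<Omega>"
  by (auto intro: L2_vecI test_L2 simp: test_fields_def)

text \<open>Test fields with a single nonzero component pick out one component of the curl, which
  reduces the claim to scalar test functions.\<close>

lemma weak_curl_unique:
  assumes "is_weak_curl \<Omega> D C" "is_weak_curl \<Omega> D C'"
  shows "AE x in lebesgue_on \<Omega>. C x = C' x"
proof (rule L2_vec_eq_AE)
  fix \<phi> and j :: 3
  assume \<phi>: "\<phi> \<in> test_functions \<Omega>"
  define \<Phi> :: vecf where "\<Phi> = (\<lambda>x. axis j (\<phi> x))"
  have "(\<lambda>x. \<Phi> x $ i) = (if i = j then \<phi> else (\<lambda>x. 0))" for i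
    by (auto simp: \<Phi>_def axis_def)
  then have "\<Phi> \<in> test_fields \<Omega>"
    using \<phi> zero_test_function by (simp add: test_fields_def)
  moreover have "L2_inner \<Omega> B \<Phi> = L2_inner \<Omega> (\<lambda>x. B x $ j) \<phi>" for B
    by (simp add: L2_inner_def \<Phi>_def inner_axis)
  ultimately show "L2_inner \<Omega> (\<lambda>x. C x $ j) \<phi> = L2_inner \<Omega> (\<lambda>x. C' x $ j) \<phi>"
    using assms unfolding is_weak_curl_def by metis
qed (use assms in \<open>auto simp: is_weak_curl_def\<close>)

lemma weak_curl_diff:
  assumes "D \<in> L2 \<Omega>" "D' \<in> L2 \<Omega>" "is_weak_curl \<Omega> D C" "is_weak_curl \<Omega> D' C'"
  shows "is_weak_curl \<Omega> (\<lambda>x. D x - D' x) (\<lambda>x. C x - C' x)"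
  using assms
  by (auto simp: is_weak_curl_def L2_diff L2_inner_diff_left test_field_curl_L2 test_field_L2)

lemma weak_curl_wcurl: "D \<in> Hcurl \<Omega> \<Longrightarrow> is_weak_curl \<Omega> D (wcurl \<Omega> D)"
  unfolding wcurl_def Hcurl_def using someI_ex[of "is_weak_curl \<Omega> D"] by blast

lemma Hcurl_L2: "D \<in> Hcurl \<Omega> \<Longrightarrow> D \<in> L2 \<Omega>"
  by (simp add: Hcurl_def)

lemma wcurl_L2: "D \<in> Hcurl \<Omega> \<Longrightarrow> wcurl \<Omega> D \<in> L2 \<Omega>"
  using weak_curl_wcurl by (simp add: is_weak_curl_def)

lemma Hcurl_diff: "D \<in> Hcurl \<Omega> \<Longrightarrow> D' \<in> Hcurl \<Omega> \<Longrightarrow> (\<lambda>x. D x - D' x) \<in> Hcurl \<Omega>"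
  unfolding Hcurl_def using weak_curl_diff L2_diff by blast

lemma L2_inner_wcurl_diff:
  assumes "D \<in> Hcurl \<Omega>" "D' \<in> Hcurl \<Omega>" "B \<in> L2 \<Omega>"
  shows "L2_inner \<Omega> (wcurl \<Omega> (\<lambda>x. D x - D' x)) B = L2_inner \<Omega> (wcurl \<Omega> D) B - L2_inner \<Omega> (wcurl \<Omega> D') B"
proof -
  have "AE x in lebesgue_on \<Omega>. wcurl \<Omega> (\<lambda>x. D x - D' x) x = wcurl \<Omega> D x - wcurl \<Omega> D' x"
    by (rule weak_curl_unique[OF weak_curl_wcurl weak_curl_diff])
      (use assms in \<open>auto intro: weak_curl_wcurl Hcurl_diff Hcurl_L2\<close>)
  from L2_inner_cong[OF this assms(3)] show ?thesis
    using assms by (simp add: L2_inner_diff_left L2_diff wcurl_L2 Hcurl_diff)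
qed

section \<open>Jacobian and divergence of vector fields\<close>

lemma H1v_component: "v \<in> H1v \<Omega> \<Longrightarrow> (\<lambda>x. v x $ i) \<in> H1 \<Omega>"
  by (simp add: H1v_def)

lemma H1v_L2: "v \<in> H1v \<Omega> \<Longrightarrow> v \<in> L2 \<Omega>"
  by (auto intro: L2_vecI H1_L2 H1v_component)

lemma H1v_diff: "v \<in> H1v \<Omega> \<Longrightarrow> w \<in> H1v \<Omega> \<Longrightarrow> (\<lambda>x. v x - w x) \<in> H1v \<Omega>"
  by (simp add: H1v_def H1_diff)

lemma wjac_L2: "v \<in> H1v \<Omega> \<Longrightarrow> wjac \<Omega> v \<in> L2 \<Omega>"
  by (rule L2_vecI) (simp add: wjac_def wgrad_L2 H1v_component)

lemma wdiv_L2: "v \<in> H1v \<Omega> \<Longrightarrow> wdiv \<Omega> v \<in> L2 \<Omega>"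
  unfolding wdiv_def wjac_def sum_3 vec_lambda_beta
  by (intro L2_add L2_component wgrad_L2 H1v_component)

lemma wjac_diff:
  assumes "v \<in> H1v \<Omega>" "w \<in> H1v \<Omega>"
  shows "AE x in lebesgue_on \<Omega>. wjac \<Omega> (\<lambda>x. v x - w x) x = wjac \<Omega> v x - wjac \<Omega> w x"
proof -
  have "AE x in lebesgue_on \<Omega>. wgrad \<Omega> (\<lambda>x. v x $ i - w x $ i) x
      = wgrad \<Omega> (\<lambda>x. v x $ i) x - wgrad \<Omega> (\<lambda>x. w x $ i) x" for i
    using assms by (intro wgrad_diff H1v_component)
  then have "AE x in lebesgue_on \<Omega>. \<forall>i\<in>UNIV. wgrad \<Omega> (\<lambda>x. v x $ i - w x $ i) x
      = wgrad \<Omega> (\<lambda>x. v x $ i) x - wgrad \<Omega> (\<lambda>x. w x $ i) x"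
    by (intro AE_finite_allI) auto
  then show ?thesis
    by (rule AE_mp) (simp add: wjac_def vec_eq_iff)
qed

lemma L2_inner_wjac_diff:
  assumes "v \<in> H1v \<Omega>" "w \<in> H1v \<Omega>" "A \<in> L2 \<Omega>"
  shows "L2_inner \<Omega> (wjac \<Omega> (\<lambda>x. v x - w x)) A = L2_inner \<Omega> (wjac \<Omega> v) A - L2_inner \<Omega> (wjac \<Omega> w) A"
  using L2_inner_cong[OF wjac_diff, of v w A] assms
  by (simp add: L2_inner_diff_left L2_diff wjac_L2 H1v_diff)

lemma L2_inner_wdiv_diff:
  assumes "v \<in> H1v \<Omega>" "w \<in> H1v \<Omega>" "p \<in> L2 \<Omega>"
  shows "L2_inner \<Omega> (wdiv \<Omega> (\<lambda>x. v x - w x)) p = L2_inner \<Omega> (wdiv \<Omega> v) p - L2_inner \<Omega> (wdiv \<Omega> w) p"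
proof -
  have "AE x in lebesgue_on \<Omega>. wdiv \<Omega> (\<lambda>x. v x - w x) x = wdiv \<Omega> v x - wdiv \<Omega> w x"
    by (rule AE_mp[OF wjac_diff[OF assms(1,2)]]) (simp add: wdiv_def sum_subtractf)
  from L2_inner_cong[OF this assms(3)] show ?thesis
    using assms by (simp add: L2_inner_diff_left L2_diff wdiv_L2 H1v_diff)
qed

lemma L2_norm_wjac_component:
  assumes "v \<in> H1v \<Omega>"
  shows "L2_norm \<Omega> (wgrad \<Omega> (\<lambda>x. v x $ i)) \<le> L2_norm \<Omega> (wjac \<Omega> v)"
  using L2_norm_component[OF wjac_L2[OF assms], of i] by (simp add: wjac_def)

subsection \<open>Finite element spaces\<close>

text \<open>\<open>W_space\<close> asks for continuity up to the boundary and does not mention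
  \<open>L2\<close>; compactness of the closure supplies square integrability.\<close>

lemma continuous_on_closure_L2:
  fixes w :: "real^3 \<Rightarrow> 'a::euclidean_space"
  assumes "continuous_on (closure \<Omega>) w"
  shows "w \<in> L2 \<Omega>"
proof -
  have "bounded (w ` closure \<Omega>)"
    using assms bounded_domain by (intro compact_imp_bounded compact_continuous_image) auto
  then obtain B where B: "\<And>x. x \<in> closure \<Omega> \<Longrightarrow> norm (w x) \<le> B" by (auto simp: bounded_iff)
  have "continuous_on \<Omega> w" using assms closure_subset continuous_on_subset by blast
  then have "w \<in> borel_measurable (lebesgue_on \<Omega>)"
    using sets_domain continuous_imp_measurable_on_sets_lebesgue by blast
  then show ?thesis
    using B closure_subset by (intro L2_bounded[OF lmeasurable_domain]) blast+
qed

end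

section \<open>Differences in the polynomial classes\<close>

lemma Poly_diff:
  assumes "p \<in> Poly j" "q \<in> Poly j"
  shows "(\<lambda>x. p x - q x) \<in> Poly j"
proof -
  obtain c d where "p = (\<lambda>x. \<Sum>a | (\<Sum>i\<in>UNIV. a i) \<le> j. c a * (\<Prod>i\<in>UNIV. (x $ i) ^ a i))"
    "q = (\<lambda>x. \<Sum>a | (\<Sum>i\<in>UNIV. a i) \<le> j. d a * (\<Prod>i\<in>UNIV. (x $ i) ^ a i))"
    using assms unfolding Poly_def by blast
  then have "(\<lambda>x. p x - q x)
      = (\<lambda>x. \<Sum>a | (\<Sum>i\<in>UNIV. a i) \<le> j. (c a - d a) * (\<Prod>i\<in>UNIV. (x $ i) ^ a i))"
    by (simp add: sum_subtractf left_diff_distrib)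
  then show ?thesis unfolding Poly_def by (intro CollectI exI[of _ "\<lambda>a. c a - d a"])
qed

lemma Polyhom_diff:
  assumes "p \<in> Polyhom j" "q \<in> Polyhom j"
  shows "(\<lambda>x. p x - q x) \<in> Polyhom j"
proof -
  obtain c d where "p = (\<lambda>x. \<Sum>a | (\<Sum>i\<in>UNIV. a i) = j. c a * (\<Prod>i\<in>UNIV. (x $ i) ^ a i))"
    "q = (\<lambda>x. \<Sum>a | (\<Sum>i\<in>UNIV. a i) = j. d a * (\<Prod>i\<in>UNIV. (x $ i) ^ a i))"
    using assms unfolding Polyhom_def by blast
  then have "(\<lambda>x. p x - q x)
      = (\<lambda>x. \<Sum>a | (\<Sum>i\<in>UNIV. a i) = j. (c a - d a) * (\<Prod>i\<in>UNIV. (x $ i) ^ a i))"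
    by (simp add: sum_subtractf left_diff_distrib)
  then show ?thesis unfolding Polyhom_def by (intro CollectI exI[of _ "\<lambda>a. c a - d a"])
qed

lemma Polyv_diff: "p \<in> Polyv j \<Longrightarrow> q \<in> Polyv j \<Longrightarrow> (\<lambda>x. p x - q x) \<in> Polyv j"
  by (simp add: Polyv_def Poly_diff)

lemma R2_diff:
  assumes "r \<in> R2" "r' \<in> R2"
  shows "(\<lambda>x. r x - r' x) \<in> R2"
proof -
  obtain p s p' s' where *: "r = (\<lambda>x. p x + s x)" "p \<in> Polyv 1" "s \<in> S2"
    "r' = (\<lambda>x. p' x + s' x)" "p' \<in> Polyv 1" "s' \<in> S2"
    using assms by (auto simp: R2_def)
  have "(\<lambda>x. s x - s' x) \<in> S2"
    using *(3,6) by (simp add: S2_def Polyhom_diff inner_diff_left)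
  moreover have "(\<lambda>x. p x - p' x) \<in> Polyv 1" using * by (simp add: Polyv_diff)
  moreover have "(\<lambda>x. r x - r' x) = (\<lambda>x. (p x - p' x) + (s x - s' x))" by (simp add: * algebra_simps)
  ultimately show ?thesis unfolding R2_def by (intro CollectI exI conjI)
qed

text \<open>Serves the three continuous spaces, whose elementwise conditions differ only in the
  polynomial class \<open>S\<close>.\<close>

lemma piecewise_diff:
  assumes "\<forall>K\<in>\<T>. \<exists>r\<in>S. \<forall>x\<in>K. v x = r x" "\<forall>K\<in>\<T>. \<exists>r\<in>S. \<forall>x\<in>K. w x = r x"
    and S: "\<And>r r'. r \<in> S \<Longrightarrow> r' \<in> S \<Longrightarrow> (\<lambda>x. r x - r' x) \<in> S"
  shows "\<forall>K\<in>\<T>. \<exists>r\<in>S. \<forall>x\<in>K. v x - w x = r x"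
proof
  fix K assume "K \<in> \<T>"
  then obtain r r' where "r \<in> S" "\<forall>x\<in>K. v x = r x" "r' \<in> S" "\<forall>x\<in>K. w x = r' x"
    using assms(1,2) by metis
  then show "\<exists>r\<in>S. \<forall>x\<in>K. v x - w x = r x"
    by (intro bexI[of _ "\<lambda>x. r x - r' x"] S) auto
qed

context bounded_open
begin

lemma E_space_Hcurl: "D \<in> E_space \<Omega> \<T> \<Longrightarrow> D \<in> Hcurl \<Omega>"
  by (simp add: E_space_def)

text \<open>The tangential boundary condition is attached to the elementwise polynomials and not to
  the field, so representatives of both fields are fixed as functions of the element before
  subtracting; the cross product is linear in them.\<close>

lemma E_space_diff:
  assumes "D \<in> E_space \<Omega> \<T>" "D' \<in> E_space \<Omega> \<T>"
  shows "(\<lambda>x. D x - D' x) \<in> E_space \<Omega> \<T>"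
proof -
  from assms(1) obtain r where r: "\<forall>K\<in>\<T>. r K \<in> R2 \<and> (AE x in lebesgue_on K. D x = r K x) \<and>
       (\<forall>F. F facet_of K \<and> F \<subseteq> frontier \<Omega> \<longrightarrow>
          (\<forall>x\<in>F. \<forall>\<nu>. outward_unit_normal \<Omega> x \<nu> \<longrightarrow> cross3 (r K x) \<nu> = 0))"
    unfolding E_space_def mem_Collect_eq by (elim conjE exE) (rule that)
  from assms(2) obtain r' where r': "\<forall>K\<in>\<T>. r' K \<in> R2 \<and> (AE x in lebesgue_on K. D' x = r' K x) \<and>
       (\<forall>F. F facet_of K \<and> F \<subseteq> frontier \<Omega> \<longrightarrow>
          (\<forall>x\<in>F. \<forall>\<nu>. outward_unit_normal \<Omega> x \<nu> \<longrightarrow> cross3 (r' K x) \<nu> = 0))"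
    unfolding E_space_def mem_Collect_eq by (elim conjE exE) (rule that)
  have "(\<lambda>x. r K x - r' K x) \<in> R2 \<and> (AE x in lebesgue_on K. D x - D' x = r K x - r' K x) \<and>
       (\<forall>F. F facet_of K \<and> F \<subseteq> frontier \<Omega> \<longrightarrow>
          (\<forall>x\<in>F. \<forall>\<nu>. outward_unit_normal \<Omega> x \<nu> \<longrightarrow> cross3 (r K x - r' K x) \<nu> = 0))"
    if K: "K \<in> \<T>" for K
  proof (intro conjI)
    show "(\<lambda>x. r K x - r' K x) \<in> R2" using r r' K by (simp add: R2_diff)
    have "AE x in lebesgue_on K. D x = r K x" "AE x in lebesgue_on K. D' x = r' K x"
      using r r' K by simp_all
    then show "AE x in lebesgue_on K. D x - D' x = r K x - r' K x" by eventually_elim simp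
    show "\<forall>F. F facet_of K \<and> F \<subseteq> frontier \<Omega> \<longrightarrow>
          (\<forall>x\<in>F. \<forall>\<nu>. outward_unit_normal \<Omega> x \<nu> \<longrightarrow> cross3 (r K x - r' K x) \<nu> = 0)"
      using r r' K by (simp add: Cross3.left_diff_distrib)
  qed
  then show ?thesis
    using assms Hcurl_diff unfolding E_space_def
    by (intro CollectI conjI exI[of _ "\<lambda>K x. r K x - r' K x"]) auto
qed

lemma H_space_L2: "B \<in> H_space \<Omega> \<T> \<Longrightarrow> B \<in> L2 \<Omega>"
  by (simp add: H_space_def)

lemma H_space_diff:
  assumes "B \<in> H_space \<Omega> \<T>" "B' \<in> H_space \<Omega> \<T>"
  shows "(\<lambda>x. B x - B' x) \<in> H_space \<Omega> \<T>"
proof -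
  have "\<exists>r\<in>Polyv 1. AE x in lebesgue_on K. B x - B' x = r x" if K: "K \<in> \<T>" for K
  proof -
    obtain r r' where r: "r \<in> Polyv 1" "r' \<in> Polyv 1"
      and ae: "AE x in lebesgue_on K. B x = r x" "AE x in lebesgue_on K. B' x = r' x"
      using assms K unfolding H_space_def by blast
    from ae have "AE x in lebesgue_on K. B x - B' x = r x - r' x" by eventually_elim simp
    then show ?thesis by (intro bexI[of _ "\<lambda>x. r x - r' x"] Polyv_diff r)
  qed
  then show ?thesis using assms by (simp add: H_space_def L2_diff)
qed

lemma U_space_H1v: "v \<in> U_space \<Omega> \<Gamma>D \<T> \<Longrightarrow> v \<in> H1v \<Omega>"
  by (simp add: U_space_def)

lemma U_space_diff:
  assumes "v \<in> U_space \<Omega> \<Gamma>D \<T>" "w \<in> U_space \<Omega> \<Gamma>D \<T>"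
  shows "(\<lambda>x. v x - w x) \<in> U_space \<Omega> \<Gamma>D \<T>"
  using assms piecewise_diff[where S = "Polyv 2", of \<T> v w]
  by (simp add: U_space_def H1v_diff continuous_on_diff Polyv_diff)

lemma W_space_L2: "w \<in> W_space \<Omega> \<T> \<Longrightarrow> w \<in> L2 \<Omega>"
  by (simp add: W_space_def continuous_on_closure_L2)

lemma W_space_diff:
  assumes "v \<in> W_space \<Omega> \<T>" "w \<in> W_space \<Omega> \<T>"
  shows "(\<lambda>x. v x - w x) \<in> W_space \<Omega> \<T>"
  using assms piecewise_diff[where S = "Poly 1", of \<T> v w]
  by (simp add: W_space_def  continuous_on_diff Poly_diff)

lemma P_space_H1: "q \<in> P_space \<Omega> \<T> \<Longrightarrow> q \<in> H1 \<Omega>"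
  by (simp add: P_space_def H10_def)

lemma P_space_diff:
  assumes "v \<in> P_space \<Omega> \<T>" "w \<in> P_space \<Omega> \<T>"
  shows "(\<lambda>x. v x - w x) \<in> P_space \<Omega> \<T>"
  using assms piecewise_diff[where S = "Poly 2", of \<T> v w]
  by (simp add: P_space_def H10_diff continuous_on_diff Poly_diff)

end

subsection \<open>A discrete Poincare inequality\<close>

text \<open>This normal form exhibits the gradient as the affine map l + (A + A^T) x; no symmetry of
  \<open>A\<close> is imposed. The functions of this form are closed under sums and multiples, so
  monomials suffice.\<close>

lemma Poly2_quadratic:
  assumes "r \<in> Poly 2"
  shows "\<exists>c l (A::real^3^3). r = (\<lambda>x. c + l \<bullet> x + x \<bullet> (A *v x))"
proof -
  define Q :: "scal set" where "Q = {r. \<exists>c l (A::real^3^3). r = (\<lambda>x. c + l \<bullet> x + x \<bullet> (A *v x))}"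
  have add: "(\<lambda>x. p x + q x) \<in> Q" if pq: "p \<in> Q" "q \<in> Q" for p q
  proof -
    obtain c l and A :: "real^3^3" where p: "p = (\<lambda>x. c + l \<bullet> x + x \<bullet> (A *v x))"
      using pq(1) unfolding Q_def by blast
    obtain c' l' and A' :: "real^3^3" where q: "q = (\<lambda>x. c' + l' \<bullet> x + x \<bullet> (A' *v x))"
      using pq(2) unfolding Q_def by blast
    have "(\<lambda>x. p x + q x) = (\<lambda>x. (c + c') + (l + l') \<bullet> x + x \<bullet> ((A + A') *v x))"
      by (simp add: p q inner_add_left inner_add_right matrix_vector_mult_add_rdistrib fun_eq_iff)
    then show ?thesis unfolding Q_def by blast
  qed
  have mult: "(\<lambda>x. k * p x) \<in> Q" if p: "p \<in> Q" for p k
  proof -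
    obtain c l and A :: "real^3^3" where "p = (\<lambda>x. c + l \<bullet> x + x \<bullet> (A *v x))"
      using p unfolding Q_def by blast
    then have "(\<lambda>x. k * p x) = (\<lambda>x. k * c + (k *\<^sub>R l) \<bullet> x + x \<bullet> ((k *\<^sub>R A) *v x))"
      by (simp add: distrib_left scaleR_matrix_vector_assoc[symmetric])
    then show ?thesis unfolding Q_def by blast
  qed
  have const: "(\<lambda>x. k) \<in> Q" for k
    unfolding Q_def by (intro CollectI exI[of _ k] exI[of _ 0] exI[of _ "0::real^3^3"]) simp
  have coord: "(\<lambda>x. x $ i) \<in> Q" for i
    unfolding Q_def
    by (intro CollectI exI[of _ 0] exI[of _ "axis i 1"] exI[of _ "0::real^3^3"]) (simp add: inner_axis')
  have coord2: "(\<lambda>x. x $ i * x $ j) \<in> Q" for i j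
  proof -
    \<comment> \<open>The matrix with the single entry 1 in row i and column j represents x_i
      x_j.\<close>
    have "x \<bullet> ((\<chi> k. if k = i then axis j 1 else 0) *v x) = x $ i * x $ j" for x :: "real^3"
    proof -
      have "((\<chi> k. if k = i then axis j 1 else 0) *v x) = axis i (x $ j)"
      proof (rule vec_eq_iff[THEN iffD2], rule allI)
        fix k
        show "((\<chi> k. if k = i then axis j 1 else 0) *v x) $ k = axis i (x $ j) $ k"
          by (cases "k = i") (simp_all add: matrix_vector_mul_component inner_axis', simp_all add: axis_def)
      qed
      then show ?thesis by (simp add: inner_axis)
    qed
    then show ?thesis
      unfolding Q_def
      by (intro CollectI exI[of _ 0] exI[of _ "0::real^3"] exI[of _ "\<chi> k. if k = i then axis j 1 else 0"])
        simp
  qed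
  have mono: "(\<lambda>x. \<Prod>i\<in>UNIV. (x $ i) ^ a i) \<in> Q" if a: "(\<Sum>i\<in>UNIV. a i) \<le> 2" for a :: "3 \<Rightarrow> nat"
  proof -
    have le: "a 1 + a 2 + a 3 \<le> 2" using a by (simp add: sum_3)
    \<comment> \<open>The ten exponent triples of total degree at most two: one constant, three
      linear, three pure squares and three mixed products.\<close>
    have disj: "x = 0 \<and> y = 0 \<and> z = 0 \<or> x = 1 \<and> y = 0 \<and> z = 0
      \<or> x = 0 \<and> y = 1 \<and> z = 0 \<or> x = 0 \<and> y = 0 \<and> z = 1
      \<or> x = 2 \<and> y = 0 \<and> z = 0 \<or> x = 0 \<and> y = 2 \<and> z = 0
      \<or> x = 0 \<and> y = 0 \<and> z = 2 \<or> x = 1 \<and> y = 1 \<and> z = 0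
      \<or> x = 1 \<and> y = 0 \<and> z = 1 \<or> x = 0 \<and> y = 1 \<and> z = 1"
      if "x + y + z \<le> 2" for x y z :: nat
    proof -
      have "x = 0 \<or> x = 1 \<or> x = 2" "y = 0 \<or> y = 1 \<or> y = 2" "z = 0 \<or> z = 1 \<or> z = 2"
        using that by arith+
      then show ?thesis by (elim disjE) (use that in simp_all)
    qed
    have p3: "(\<Prod>i\<in>UNIV. f i) = f 1 * f 2 * f 3" for f :: "3 \<Rightarrow> real"
      unfolding UNIV_3 by (simp add: mult.assoc)
    from disj[OF le] show ?thesis
      by (elim disjE) (simp_all add: p3 power2_eq_square const coord coord2)
  qed
  have sum: "(\<lambda>x. \<Sum>a\<in>I. c a * (\<Prod>i\<in>UNIV. (x $ i) ^ a i)) \<in> Q"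
    if "\<And>a. a \<in> I \<Longrightarrow> (\<Sum>i\<in>UNIV. a i) \<le> 2" for c and I :: "(3 \<Rightarrow> nat) set"
    using that
  \<comment> \<open>Over an infinite index set the sum is 0 by convention, a constant, so the set of
    multi-indices enters without a finiteness proof.\<close>
  proof (induction I rule: infinite_finite_induct)
    case (insert a I)
    have "(\<lambda>x. c a * (\<Prod>i\<in>UNIV. (x $ i) ^ a i)) \<in> Q"
      using insert.prems by (intro mult mono) simp
    moreover have "(\<lambda>x. \<Sum>a\<in>I. c a * (\<Prod>i\<in>UNIV. (x $ i) ^ a i)) \<in> Q"
      using insert.prems by (intro insert.IH) simp
    ultimately show ?case
      using insert.hyps add by simp
  qed (use const in simp_all)
  have "r \<in> Q" using assms unfolding Poly_def by (auto intro!: sum)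
  then show ?thesis by (simp add: Q_def)
qed

lemma quadratic_has_derivative:
  fixes A :: "real^3^3"
  shows "((\<lambda>x. c + l \<bullet> x + x \<bullet> (A *v x)) has_derivative
    (\<lambda>h. (l + (A + transpose A) *v x) \<bullet> h)) (at x within S)"
proof -
  have m: "((\<lambda>x. A *v x) has_derivative (\<lambda>h. A *v h)) (at x within S)"
    by (intro bounded_linear_imp_has_derivative matrix_vector_mul_bounded_linear)
  have t: "x \<bullet> (A *v h) = (transpose A *v x) \<bullet> h" for h
    by (metis dot_lmul_matrix vector_transpose_matrix transpose_transpose)
  show ?thesis
    by (rule has_derivative_eq_rhs, (rule derivative_intros m)+)
      (simp add: fun_eq_iff t inner_add_left inner_add_right matrix_vector_mult_add_rdistrib inner_commute)
qed

context bounded_open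
begin

section \<open>Equivalence of norms on affine functions\<close>

lemma affine_L2: "(\<lambda>x. m \<bullet> x + b :: real) \<in> L2 \<Omega>"
  by (intro continuous_on_closure_L2 continuous_intros)

text \<open>A vanishing norm would put almost all of the domain into the null set m . x = - b,
  whereas a nonempty open set is not negligible.\<close>

lemma affine_L2_norm_pos:
  assumes "\<Omega> \<noteq> {}" "m \<noteq> 0 \<or> b \<noteq> 0"
  shows "L2_norm \<Omega> (\<lambda>x. m \<bullet> x + b :: real) > 0"
proof (rule ccontr)
  assume "\<not> ?thesis"
  then have "L2_norm \<Omega> (\<lambda>x. m \<bullet> x + b) = 0"
    using L2_norm_nonneg[of \<Omega> "\<lambda>x. m \<bullet> x + b"] by linarith
  then have "(LINT x|lebesgue_on \<Omega>. (m \<bullet> x + b) * (m \<bullet> x + b)) = 0"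
    by (simp add: L2_norm_def L2_inner_def)
  moreover have "integrable (lebesgue_on \<Omega>) (\<lambda>x. (m \<bullet> x + b) * (m \<bullet> x + b))"
    using L2_inner_integrable[OF affine_L2 affine_L2, of m b m b] by simp
  ultimately have "AE x in lebesgue_on \<Omega>. (m \<bullet> x + b) * (m \<bullet> x + b) = 0"
    by (subst (asm) integral_nonneg_eq_0_iff_AE) auto
  then have a1: "AE x in lebesgue. x \<in> \<Omega> \<longrightarrow> m \<bullet> x = - b"
    using sets_domain by (auto simp: AE_restrict_space_iff add_eq_0_iff)
  have "negligible {x. m \<bullet> x = - b}"
    using assms(2) by (intro negligible_hyperplane) auto
  then have a2: "AE x in lebesgue. x \<notin> {x. m \<bullet> x = - b}"
    by (intro AE_not_in) (simp add: negligible_iff_null_sets)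
  have "AE x in lebesgue. x \<notin> \<Omega>"
    using a1 a2 by eventually_elim auto
  then have "negligible \<Omega>"
    using sets_domain by (simp add: negligible_iff_null_sets AE_iff_null_sets)
  then show False using open_not_negligible[OF open_domain assms(1)] by simp
qed

text \<open>Affine functions form a four-dimensional space with parameters (m, b). The L2 norm is
  continuous in them, so it attains a positive minimum on the unit sphere, and homogeneity extends
  the estimate. The point is that C is uniform in m and b, also for x outside the domain.\<close>

lemma affine_le_L2_norm:
  assumes "\<Omega> \<noteq> {}"
  shows "\<exists>C\<ge>0. \<forall>m b x. norm x \<le> R \<longrightarrow> \<bar>m \<bullet> x + b\<bar> \<le> C * L2_norm \<Omega> (\<lambda>x. m \<bullet> x + b :: real)"
proof -
  define N :: "(real^3) \<times> real \<Rightarrow> real" where "N z = L2_norm \<Omega> (\<lambda>x. fst z \<bullet> x + snd z)" for z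
  have affine_le: "\<bar>fst z \<bullet> x + snd z\<bar> \<le> (\<rho> + 1) * norm z" if "norm x \<le> \<rho>" for z :: "(real^3) \<times> real" and x \<rho>
  proof -
    have "\<bar>fst z \<bullet> x + snd z\<bar> \<le> norm (fst z) * norm x + \<bar>snd z\<bar>"
      using Cauchy_Schwarz_ineq2[of "fst z" x] by linarith
    also have "\<dots> \<le> norm z * \<rho> + norm z"
      using norm_fst_le[of "fst z" "snd z"] norm_snd_le[of "snd z" "fst z"] that by (intro add_mono mult_mono) auto
    finally show ?thesis by (simp add: algebra_simps)
  qed
  obtain \<rho> where \<rho>: "\<And>x. x \<in> \<Omega> \<Longrightarrow> norm x \<le> \<rho>" "\<rho> > 0"
    using bounded_domain by (auto simp: bounded_pos)
  define k where "k = sqrt (measure lebesgue \<Omega>) * (\<rho> + 1)"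
  have k: "k \<ge> 0" using \<rho>(2) by (simp add: k_def)
  have N_le: "N z \<le> k * norm z" for z
  proof -
    have "N z \<le> sqrt (measure lebesgue \<Omega>) * ((\<rho> + 1) * norm z)"
      unfolding N_def using \<rho> affine_le
      by (intro L2_norm_le_bound[OF lmeasurable_domain affine_L2]) auto
    then show ?thesis by (simp add: k_def mult.assoc)
  qed
  \<comment> \<open>The triangle inequality for N, with N of the increment bounded by k times its
    norm.\<close>
  have lip: "N z - N w \<le> k * norm (w - z)" for z w
  proof -
    have "N z = L2_norm \<Omega> (\<lambda>x. (fst w \<bullet> x + snd w) - (fst (w - z) \<bullet> x + snd (w - z)))"
      by (simp add: N_def inner_diff_left)
    also have "\<dots> \<le> N w + N (w - z)"
      unfolding N_def by (intro L2_norm_triangle affine_L2)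
    finally show ?thesis using N_le[of "w - z"] by linarith
  qed
  have "k-lipschitz_on UNIV N"
  proof (rule lipschitz_onI)
    show "dist (N z) (N w) \<le> k * dist z w" for z w
      using lip[of z w] lip[of w z] by (auto simp: dist_real_def dist_norm norm_minus_commute)
  qed fact
  then have "continuous_on (sphere 0 1) N"
    using lipschitz_on_continuous_on continuous_on_subset by blast
  moreover have "(0, 1) \<in> sphere (0 :: (real^3) \<times> real) 1" by (simp add: norm_Pair)
  ultimately obtain z0 where z0: "z0 \<in> sphere 0 1" "\<And>z. z \<in> sphere 0 1 \<Longrightarrow> N z0 \<le> N z"
    using continuous_attains_inf[of "sphere (0 :: (real^3) \<times> real) 1" N] by force
  have "z0 \<noteq> 0" using z0(1) by auto
  then have c: "N z0 > 0"
    unfolding N_def using assms by (intro affine_L2_norm_pos) (auto simp: prod_eq_iff)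
  have scale: "N z0 * norm z \<le> N z" for z
  proof (cases "z = 0")
    case False
    have "N z0 \<le> N (z /\<^sub>R norm z)" using False by (intro z0) simp
    also have "N (z /\<^sub>R norm z) = N z / norm z"
    proof -
      have "(\<lambda>x. fst (z /\<^sub>R norm z) \<bullet> x + snd (z /\<^sub>R norm z))
          = (\<lambda>x. inverse (norm z) *\<^sub>R (fst z \<bullet> x + snd z))"
        by (simp add: distrib_left)
      moreover have "L2_norm \<Omega> (\<lambda>x. t *\<^sub>R f x) = t * L2_norm \<Omega> f" if "t \<ge> 0" for t and f :: scal
      proof -
        have "L2_inner \<Omega> (\<lambda>x. t *\<^sub>R f x) (\<lambda>x. t *\<^sub>R f x) = t\<^sup>2 * L2_inner \<Omega> f f"
          by (simp add: L2_inner_def power2_eq_square mult.assoc mult.left_commute)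
        then show ?thesis using that by (simp add: L2_norm_def real_sqrt_mult)
      qed
      ultimately show ?thesis by (simp add: N_def divide_inverse mult.commute)
    qed
    finally show ?thesis using False by (simp add: field_simps)
  qed (simp add: N_def)
  \<comment> \<open>The absolute value of R keeps the constant nonnegative for every R.\<close>
  have "\<bar>m \<bullet> x + b\<bar> \<le> (\<bar>R\<bar> + 1) / N z0 * L2_norm \<Omega> (\<lambda>x. m \<bullet> x + b)" if "norm x \<le> R" for m b x
  proof -
    have "\<bar>m \<bullet> x + b\<bar> \<le> (\<bar>R\<bar> + 1) * norm (m, b)"
      using affine_le[of x "\<bar>R\<bar>" "(m, b)"] that by simp
    also have "\<dots> \<le> (\<bar>R\<bar> + 1) * (N (m, b) / N z0)"
      using scale[of "(m, b)"] c by (intro mult_left_mono) (auto simp: field_simps)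
    finally show ?thesis by (simp add: N_def)
  qed
  then show ?thesis
    using c by (intro exI[of _ "(\<bar>R\<bar> + 1) / N z0"]) auto
qed

text \<open>A test function supported in \<open>S\<close> is also one for the whole domain, and its
  integrals only see \<open>S\<close>. There u may be replaced by the smooth r and integrated by
  parts, so uniqueness on \<open>S\<close> applies.\<close>

lemma wgrad_eq_classical:
  assumes S: "bounded_open S" "S \<subseteq> \<Omega>" and u: "u \<in> H1 \<Omega>"
    and r: "Ck 1 r" "\<And>x. x \<in> S \<Longrightarrow> u x = r x"
    and g: "g \<in> L2 S" "\<And>x j. pderiv3 j r x = g x $ j"
  shows "AE x in lebesgue_on S. wgrad \<Omega> u x = g x"
proof -
  interpret S: bounded_open S by fact
  \<comment> \<open>Used both for a test function of \<open>S\<close> and for its partial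
    derivatives.\<close>
  have restrict: "L2_inner \<Omega> f \<psi> = L2_inner S f \<psi>" if "\<And>x. x \<notin> S \<Longrightarrow> \<psi> x = 0" for f \<psi> :: scal
  proof -
    have "L2_inner T f \<psi> = (LINT x|lebesgue. indicator T x *\<^sub>R (f x \<bullet> \<psi> x))" if "T = S \<or> T = \<Omega>" for T
      unfolding L2_inner_def
      by (rule integral_restrict_space) (use that sets_domain S.sets_domain in auto)
    moreover have "(\<lambda>x. indicator \<Omega> x *\<^sub>R (f x \<bullet> \<psi> x)) = (\<lambda>x. indicator S x *\<^sub>R (f x \<bullet> \<psi> x))"
    proof
      fix x
      show "indicator \<Omega> x *\<^sub>R (f x \<bullet> \<psi> x) = indicator S x *\<^sub>R (f x \<bullet> \<psi> x)"
        using that[of x] S(2) by (cases "x \<in> S") (auto simp: indicator_def)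
    qed
    ultimately show ?thesis by simp
  qed
  show ?thesis
  proof (rule S.L2_vec_eq_AE)
    show "wgrad \<Omega> u \<in> L2 S"
      by (rule L2_subset[OF wgrad_L2[OF u] S(2) S.sets_domain sets_domain])
    fix \<phi> and j :: 3
    assume \<phi>: "\<phi> \<in> test_functions S"
    then have \<phi>\<Omega>: "\<phi> \<in> test_functions \<Omega>" using S(2) by (auto simp: test_functions_def)
    have out: "\<phi> x = 0" "pderiv3 j \<phi> x = 0" if "x \<notin> S" for x
      using that \<phi> test_function_pderiv3[OF \<phi>, of j] by (auto simp: test_functions_def)
    have "L2_inner S (\<lambda>x. wgrad \<Omega> u x $ j) \<phi> = - L2_inner \<Omega> u (pderiv3 j \<phi>)"
      using weak_grad_wgrad[OF u] \<phi>\<Omega> restrict[of \<phi>] out(1) by (simp add: is_weak_grad_def)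
    also have "L2_inner \<Omega> u (pderiv3 j \<phi>) = L2_inner S u (pderiv3 j \<phi>)"
      using out(2) by (intro restrict)
    also have "\<dots> = L2_inner S r (pderiv3 j \<phi>)"
      unfolding L2_inner_def by (rule Bochner_Integration.integral_cong) (auto simp: r(2) space_restrict_space)
    also have "\<dots> = - L2_inner S (pderiv3 j r) \<phi>"
      by (rule integration_by_parts[OF S.sets_domain r(1) \<phi>])
    finally show "L2_inner S (\<lambda>x. wgrad \<Omega> u x $ j) \<phi> = L2_inner S (\<lambda>x. g x $ j) \<phi>"
      by (simp add: g(2)[abs_def])
  qed fact
qed

text \<open>The gradient of a quadratic is affine, hence controlled on \<open>K\<close> by its norm on any part of
  \<open>K\<close> with interior; working on \<open>interior K \<inter> \<Omega>\<close> avoids showing that the interior of an element lies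
  in the domain.\<close>

lemma oscillation_le_wgrad:
  assumes K: "convex K" "bounded K" "interior K \<inter> \<Omega> \<noteq> {}"
  shows "\<exists>C\<ge>0. \<forall>u\<in>H1 \<Omega>. (\<exists>r\<in>Poly 2. \<forall>x\<in>K. u x = r x) \<longrightarrow>
    (\<forall>x\<in>K. \<forall>y\<in>K. \<bar>u x - u y\<bar> \<le> C * L2_norm \<Omega> (wgrad \<Omega> u))"
proof -
  define S where "S = interior K \<inter> \<Omega>"
  have S: "bounded_open S" "S \<subseteq> \<Omega>" "S \<subseteq> K" "S \<noteq> {}"
    using K open_domain bounded_domain interior_subset
    by (auto simp: S_def bounded_open_def intro: bounded_subset)
  interpret S: bounded_open S by fact
  obtain R where R: "\<And>x. x \<in> K \<Longrightarrow> norm x \<le> R" "R > 0"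
    using K(2) by (auto simp: bounded_pos)
  obtain C where C: "C \<ge> 0" "\<And>m b x. norm x \<le> R \<Longrightarrow> \<bar>m \<bullet> x + b\<bar> \<le> C * L2_norm S (\<lambda>x. m \<bullet> x + b :: real)"
    using S.affine_le_L2_norm[OF S(4), of R] by blast
  \<comment> \<open>C comes from the norm equivalence for one gradient component, 3 from summing
    three components, and 2 R bounds the distance of two points of K.\<close>
  have "\<bar>u x - u y\<bar> \<le> (3 * C * (2 * R)) * L2_norm \<Omega> (wgrad \<Omega> u)"
    if u: "u \<in> H1 \<Omega>" "r \<in> Poly 2" "\<forall>x\<in>K. u x = r x" and xy: "x \<in> K" "y \<in> K" for u r x y
  proof -
    obtain c l and A :: "real^3^3" where r: "r = (\<lambda>x. c + l \<bullet> x + x \<bullet> (A *v x))"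
      using Poly2_quadratic[OF u(2)] by blast
    define B where "B = A + transpose A"
    define g where "g x = l + B *v x" for x
    have d: "(r has_derivative (\<lambda>h. g x \<bullet> h)) (at x within T)" for x T
      unfolding r g_def B_def by (rule quadratic_has_derivative)
    have pd: "pderiv3 j r x = g x $ j" for j x
      by (simp add: pderiv3_def inner_axis flip: frechet_derivative_at[OF d])
    have gc: "continuous_on T g" for T
      unfolding g_def by (intro continuous_intros matrix_vector_mult_linear_continuous_on)
    have gj: "g x $ j = B $ j \<bullet> x + l $ j" for x j
      by (simp add: g_def matrix_vector_mul_component)
    have "Ck 1 r"
      using d gc by (auto simp: differentiable_def pd[abs_def] intro!: continuous_intros)
    have gS: "g \<in> L2 S" by (intro S.continuous_on_closure_L2 gc)
    have AE: "AE x in lebesgue_on S. wgrad \<Omega> u x = g x"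
      by (rule wgrad_eq_classical[OF S(1,2) u(1) \<open>Ck 1 r\<close> _ gS pd]) (use u(3) S(3) in auto)
    have W: "wgrad \<Omega> u \<in> L2 S"
      by (rule L2_subset[OF wgrad_L2[OF u(1)] S(2) S.sets_domain sets_domain])
    define M where "M = L2_norm \<Omega> (wgrad \<Omega> u)"
    have "L2_norm S g = L2_norm S (wgrad \<Omega> u)"
      using L2_norm_cong[OF AE W gS] by simp
    also have "\<dots> \<le> M"
      unfolding M_def by (rule L2_norm_subset[OF wgrad_L2[OF u(1)] S(2) S.sets_domain sets_domain])
    finally have gM: "L2_norm S g \<le> M" .
    have "norm (g z) \<le> 3 * C * M" if z: "z \<in> K" for z
    proof -
      have "\<bar>g z $ j\<bar> \<le> C * M" for j
      proof -
        have "\<bar>g z $ j\<bar> \<le> C * L2_norm S (\<lambda>x. g x $ j)"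
          unfolding gj using C(2) R(1)[OF z] by blast
        also have "\<dots> \<le> C * M"
          using L2_norm_component[OF gS, of j] gM C(1) by (intro mult_left_mono) auto
        finally show ?thesis .
      qed
      then have "(\<Sum>j\<in>UNIV. \<bar>g z $ j\<bar>) \<le> (\<Sum>j\<in>(UNIV::3 set). C * M)"
        by (intro sum_mono)
      then show ?thesis using norm_le_l1_cart[of "g z"] by simp
    qed
    then have on: "onorm (\<lambda>h. g z \<bullet> h) \<le> 3 * C * M" if z: "z \<in> K" for z
    proof (intro onorm_bound)
      show "0 \<le> 3 * C * M" using C(1) by (simp add: M_def)
      fix h
      have "norm (g z \<bullet> h) \<le> norm (g z) * norm h" using Cauchy_Schwarz_ineq2 by simp
      also have "\<dots> \<le> 3 * C * M * norm h"
        by (rule mult_right_mono) (use z \<open>\<And>z. z \<in> K \<Longrightarrow> norm (g z) \<le> 3 * C * M\<close> in auto)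
      finally show "norm (g z \<bullet> h) \<le> 3 * C * M * norm h" .
    qed
    \<comment> \<open>The mean value inequality along the segment from x to y, which lies in K by
      convexity.\<close>
    have "norm (r x - r y) \<le> 3 * C * M * norm (x - y)"
      by (rule differentiable_bound[OF K(1) d on xy])
    also have "\<dots> \<le> 3 * C * M * (2 * R)"
    proof (rule mult_left_mono)
      show "norm (x - y) \<le> 2 * R"
        using norm_triangle_ineq4[of x y] R(1)[OF xy(1)] R(1)[OF xy(2)] by linarith
      show "0 \<le> 3 * C * M" using C(1) by (simp add: M_def)
    qed
    finally show ?thesis
      using u(3) xy by (simp add: M_def mult_ac)
  qed
  then show ?thesis
    using C(1) R(2) by (intro exI[of _ "3 * C * (2 * R)"]) auto
qed

text \<open>The elements on which \<open>u\<close> is controlled form a clopen part of the connected closure of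
  the domain, so control propagates from an element touching \<open>\<Gamma>D\<close> to all elements.\<close>

lemma piecewise_quadratic_bound:
  assumes conn: "connected \<Omega>" and \<T>: "tetrahedral_partition \<Omega> \<T>" and x0: "x0 \<in> closure \<Omega>"
  shows "\<exists>C\<ge>0. \<forall>u\<in>H1 \<Omega>. u x0 = 0 \<longrightarrow> (\<forall>K\<in>\<T>. \<exists>r\<in>Poly 2. \<forall>x\<in>K. u x = r x) \<longrightarrow>
    (\<forall>x\<in>closure \<Omega>. \<bar>u x\<bar> \<le> C * L2_norm \<Omega> (wgrad \<Omega> u))"
proof -
  define V where "V = {u\<in>H1 \<Omega>. u x0 = 0 \<and> (\<forall>K\<in>\<T>. \<exists>r\<in>Poly 2. \<forall>x\<in>K. u x = r x)}"
  define good where "good K C \<longleftrightarrow> (\<forall>u\<in>V. \<forall>x\<in>K. \<bar>u x\<bar> \<le> C * L2_norm \<Omega> (wgrad \<Omega> u))" for K C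
  define \<R> where "\<R> = {K\<in>\<T>. \<exists>C\<ge>0. good K C}"
  have \<T>': "finite \<T>" "\<And>K. K \<in> \<T> \<Longrightarrow> 3 simplex K" "\<Union>\<T> = closure \<Omega>"
    using \<T> by (auto simp: tetrahedral_partition_def triangulation_def)
  have simplex: "convex K" "compact K" "interior K \<inter> \<Omega> \<noteq> {}" if K: "K \<in> \<T>" for K
  proof -
    have s: "3 simplex K" by (rule \<T>'(2)[OF K])
    show c: "convex K" "compact K"
      using simplex_imp_polytope[OF s] polytope_imp_convex polytope_imp_compact by auto
    have "aff_dim K = int (DIM(real^3))" using aff_dim_simplex[OF s] by simp
    moreover have "K \<noteq> {}" using aff_dim_simplex[OF s] by auto
    ultimately have "interior K \<noteq> {}"
      using interior_rel_interior rel_interior_eq_empty[OF c(1)] by metis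
    \<comment> \<open>A nonempty open set contained in the closure of the domain must meet the
      domain itself.\<close>
    moreover have "interior K \<subseteq> closure \<Omega>" using \<T>'(3) K interior_subset by blast
    ultimately show "interior K \<inter> \<Omega> \<noteq> {}"
      using open_Int_closure_eq_empty[OF open_interior, of K \<Omega>] by blast
  qed
  have osc: "\<exists>C\<ge>0. \<forall>u\<in>V. \<forall>x\<in>K. \<forall>y\<in>K. \<bar>u x - u y\<bar> \<le> C * L2_norm \<Omega> (wgrad \<Omega> u)"
    if K: "K \<in> \<T>" for K
  proof -
    obtain C where "C \<ge> 0" "\<forall>u\<in>H1 \<Omega>. (\<exists>r\<in>Poly 2. \<forall>x\<in>K. u x = r x) \<longrightarrow>
        (\<forall>x\<in>K. \<forall>y\<in>K. \<bar>u x - u y\<bar> \<le> C * L2_norm \<Omega> (wgrad \<Omega> u))"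
      using oscillation_le_wgrad[OF simplex(1)[OF K] compact_imp_bounded[OF simplex(2)[OF K]] simplex(3)[OF K]]
      by (elim exE conjE) (rule that)
    then show ?thesis using K by (intro exI[of _ C]) (simp add: V_def)
  qed
  \<comment> \<open>Since u vanishes at x0, the oscillation on an element containing x0 already
    bounds u there.\<close>
  have start: "K \<in> \<R>" if K: "K \<in> \<T>" "x0 \<in> K" for K
  proof -
    obtain C where C: "C \<ge> 0"
      "\<And>u x y. u \<in> V \<Longrightarrow> x \<in> K \<Longrightarrow> y \<in> K \<Longrightarrow> \<bar>u x - u y\<bar> \<le> C * L2_norm \<Omega> (wgrad \<Omega> u)"
      using osc[OF K(1)] by blast
    have "good K C"
      unfolding good_def using C(2)[OF _ _ K(2)] by (auto simp: V_def)
    then show ?thesis using C(1) K(1) by (auto simp: \<R>_def)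
  qed
  \<comment> \<open>One common point, even a mere vertex, suffices: u has the same value there seen
    from either element, and the oscillation on the new element is added to the old bound.\<close>
  have step: "K' \<in> \<R>" if K: "K \<in> \<R>" "K' \<in> \<T>" and z: "z \<in> K" "z \<in> K'" for K K' z
  proof -
    obtain C where C: "C \<ge> 0"
      "\<And>u x y. u \<in> V \<Longrightarrow> x \<in> K' \<Longrightarrow> y \<in> K' \<Longrightarrow> \<bar>u x - u y\<bar> \<le> C * L2_norm \<Omega> (wgrad \<Omega> u)"
      using osc[OF K(2)] by blast
    obtain C' where C': "C' \<ge> 0" "good K C'" using K(1) by (auto simp: \<R>_def)
    have "\<bar>u x\<bar> \<le> (C + C') * L2_norm \<Omega> (wgrad \<Omega> u)" if "u \<in> V" "x \<in> K'" for u x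
    proof -
      have "\<bar>u z\<bar> \<le> C' * L2_norm \<Omega> (wgrad \<Omega> u)" using C'(2) that z by (auto simp: good_def)
      moreover have "\<bar>u x - u z\<bar> \<le> C * L2_norm \<Omega> (wgrad \<Omega> u)" using C(2) that z by blast
      ultimately show ?thesis by (simp add: distrib_right)
    qed
    then have "good K' (C + C')" by (simp add: good_def)
    then show ?thesis using C(1) C'(1) K(2) by (auto simp: \<R>_def intro!: exI[of _ "C + C'"])
  qed
  have sub: "\<R> \<subseteq> \<T>" by (auto simp: \<R>_def)
  \<comment> \<open>By \<open>step\<close> a controlled and an uncontrolled element share no point,
    so otherwise two disjoint nonempty closed sets would cover the connected closure.\<close>
  have "\<T> - \<R> = {}"
  proof (rule ccontr)
    assume ne: "\<T> - \<R> \<noteq> {}"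
    have cl: "closed (\<Union>\<R>)" "closed (\<Union>(\<T> - \<R>))"
      using \<T>'(1) sub simplex(2) by (auto intro!: closed_Union compact_imp_closed intro: finite_subset)
    have "\<Union>\<R> \<inter> \<Union>(\<T> - \<R>) = {}" using step by blast
    moreover have "closure \<Omega> \<subseteq> \<Union>\<R> \<union> \<Union>(\<T> - \<R>)" using \<T>'(3) sub by blast
    moreover have "\<Union>\<R> \<inter> closure \<Omega> \<noteq> {}" using x0 \<T>'(3) start by blast
    moreover have "\<Union>(\<T> - \<R>) \<inter> closure \<Omega> \<noteq> {}"
    proof -
      obtain K where K: "K \<in> \<T> - \<R>" using ne by blast
      then have "K \<noteq> {}" using simplex(3)[of K] by auto
      then show ?thesis using K \<T>'(3) by blast
    qed
    ultimately show False
      using connected_closedD[OF connected_imp_connected_closure[OF conn] _ _ cl] by blast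
  qed
  then have "\<forall>K\<in>\<T>. \<exists>C\<ge>0. good K C" by (auto simp: \<R>_def)
  then obtain C where C: "\<And>K. K \<in> \<T> \<Longrightarrow> C K \<ge> 0 \<and> good K (C K)" by metis
  \<comment> \<open>The sum over the finite mesh serves as a common bound for the nonnegative
    elementwise constants.\<close>
  have "\<bar>u x\<bar> \<le> sum C \<T> * L2_norm \<Omega> (wgrad \<Omega> u)" if u: "u \<in> V" and x: "x \<in> closure \<Omega>" for u x
  proof -
    obtain K where K: "K \<in> \<T>" "x \<in> K" using x \<T>'(3) by blast
    have "\<bar>u x\<bar> \<le> C K * L2_norm \<Omega> (wgrad \<Omega> u)" using C[OF K(1)] u K(2) by (auto simp: good_def)
    also have "\<dots> \<le> sum C \<T> * L2_norm \<Omega> (wgrad \<Omega> u)"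
      using C K(1) \<T>'(1) by (intro mult_right_mono member_le_sum) auto
    finally show ?thesis .
  qed
  moreover have "sum C \<T> \<ge> 0" using C by (intro sum_nonneg) auto
  ultimately show ?thesis unfolding V_def by (intro exI[of _ "sum C \<T>"]) simp
qed

text \<open>A single point of \<Gamma>D serves as anchor for all three components. The pointwise
  bound becomes an L2 bound because the domain has finite measure; the factor 3 sums the
  components.\<close>

lemma discrete_Poincare:
  assumes conn: "connected \<Omega>" and \<T>: "tetrahedral_partition \<Omega> \<T>"
    and \<Gamma>: "\<Gamma>D \<inter> closure \<Omega> \<noteq> {}"
  shows "\<exists>C\<ge>0. \<forall>v\<in>U_space \<Omega> \<Gamma>D \<T>. L2_norm \<Omega> v \<le> C * L2_norm \<Omega> (wjac \<Omega> v)"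
proof -
  obtain x0 where x0: "x0 \<in> \<Gamma>D" "x0 \<in> closure \<Omega>" using \<Gamma> by blast
  obtain C where C: "C \<ge> 0" and bound: "\<And>u x. u \<in> H1 \<Omega> \<Longrightarrow> u x0 = 0 \<Longrightarrow>
      \<forall>K\<in>\<T>. \<exists>r\<in>Poly 2. \<forall>x\<in>K. u x = r x \<Longrightarrow> x \<in> closure \<Omega> \<Longrightarrow> \<bar>u x\<bar> \<le> C * L2_norm \<Omega> (wgrad \<Omega> u)"
    using piecewise_quadratic_bound[OF conn \<T> x0(2)] by blast
  have "L2_norm \<Omega> v \<le> sqrt (measure lebesgue \<Omega>) * (3 * C) * L2_norm \<Omega> (wjac \<Omega> v)"
    if v: "v \<in> U_space \<Omega> \<Gamma>D \<T>" for v
  proof -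
    have H: "v \<in> H1v \<Omega>" by (rule U_space_H1v[OF v])
    have "norm (v x) \<le> 3 * C * L2_norm \<Omega> (wjac \<Omega> v)" if x: "x \<in> \<Omega>" for x
    proof -
      have "\<bar>v x $ i\<bar> \<le> C * L2_norm \<Omega> (wjac \<Omega> v)" for i
      proof -
        have "\<exists>r\<in>Poly 2. \<forall>x\<in>K. v x $ i = r x" if K: "K \<in> \<T>" for K
        proof -
          have "\<forall>K\<in>\<T>. \<exists>r\<in>Polyv 2. \<forall>x\<in>K. v x = r x"
            using v by (simp add: U_space_def)
          then obtain r where "r \<in> Polyv 2" "\<forall>x\<in>K. v x = r x"
            using K by blast
          then show ?thesis by (intro bexI[of _ "\<lambda>x. r x $ i"]) (auto simp: Polyv_def)
        qed
        moreover have "v x0 $ i = 0" using v x0(1) by (simp add: U_space_def)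
        ultimately have "\<bar>v x $ i\<bar> \<le> C * L2_norm \<Omega> (wgrad \<Omega> (\<lambda>x. v x $ i))"
          using x closure_subset by (intro bound H1v_component[OF H]) auto
        also have "\<dots> \<le> C * L2_norm \<Omega> (wjac \<Omega> v)"
          by (intro mult_left_mono L2_norm_wjac_component H C)
        finally show ?thesis .
      qed
      then have "(\<Sum>i\<in>UNIV. \<bar>v x $ i\<bar>) \<le> (\<Sum>i\<in>(UNIV::3 set). C * L2_norm \<Omega> (wjac \<Omega> v))"
        by (intro sum_mono)
      then show ?thesis using norm_le_l1_cart[of "v x"] by simp
    qed
    then have "L2_norm \<Omega> v \<le> sqrt (measure lebesgue \<Omega>) * (3 * C * L2_norm \<Omega> (wjac \<Omega> v))"
      using C by (intro L2_norm_le_bound[OF lmeasurable_domain H1v_L2[OF H]]) auto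
    then show ?thesis by (simp add: mult.assoc)
  qed
  then show ?thesis
    using C by (intro exI[of _ "sqrt (measure lebesgue \<Omega>) * (3 * C)"]) auto
qed

end

subsection \<open>One sweep of the iteration\<close>

lemma bdf2_L2:
  assumes "z \<in> L2 \<Omega>" "z1 \<in> L2 \<Omega>" "z2 \<in> L2 \<Omega>"
  shows "bdf2 \<tau> z z1 z2 \<in> L2 \<Omega>"
  unfolding bdf2_def by (intro L2_scaleR L2_add L2_diff assms)

lemma L2_inner_bdf2_diff:
  assumes "z \<in> L2 \<Omega>" "z' \<in> L2 \<Omega>" "z1 \<in> L2 \<Omega>" "z2 \<in> L2 \<Omega>" "D \<in> L2 \<Omega>"
  shows "L2_inner \<Omega> (bdf2 \<tau> z z1 z2) D - L2_inner \<Omega> (bdf2 \<tau> z' z1 z2) D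
    = 3 / (2 * \<tau>) * L2_inner \<Omega> (\<lambda>x. z x - z' x) D"
proof -
  have "L2_inner \<Omega> (bdf2 \<tau> z z1 z2) D - L2_inner \<Omega> (bdf2 \<tau> z' z1 z2) D
      = L2_inner \<Omega> (\<lambda>x. bdf2 \<tau> z z1 z2 x - bdf2 \<tau> z' z1 z2 x) D"
    by (intro L2_inner_diff_left[symmetric] bdf2_L2 assms)
  also have "(\<lambda>x. bdf2 \<tau> z z1 z2 x - bdf2 \<tau> z' z1 z2 x) = (\<lambda>x. (3 / (2 * \<tau>)) *\<^sub>R (z x - z' x))"
  proof
    fix x
    have "bdf2 \<tau> z z1 z2 x - bdf2 \<tau> z' z1 z2 x
        = ((3 *\<^sub>R z x - 4 *\<^sub>R z1 x + z2 x) - (3 *\<^sub>R z' x - 4 *\<^sub>R z1 x + z2 x)) /\<^sub>R (2 * \<tau>)"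
      unfolding bdf2_def by (rule scaleR_diff_right[symmetric])
    also have "(3 *\<^sub>R z x - 4 *\<^sub>R z1 x + z2 x) - (3 *\<^sub>R z' x - 4 *\<^sub>R z1 x + z2 x) = 3 *\<^sub>R (z x - z' x)"
      by (simp add: scaleR_diff_right)
    finally show "bdf2 \<tau> z z1 z2 x - bdf2 \<tau> z' z1 z2 x = (3 / (2 * \<tau>)) *\<^sub>R (z x - z' x)"
      by (simp only: scaleR_scaleR divide_inverse mult.commute)
  qed
  finally show ?thesis by (simp add: L2_inner_scaleR_left)
qed

text \<open>Cancels one factor \<open>x\<close> in an energy estimate; the case of nonpositive
  \<open>x\<close>, where division fails, is trivial.\<close>

lemma le_if_power2_le_mult:
  fixes x y k :: real
  assumes "k > 0" "0 \<le> y" "k * x\<^sup>2 \<le> y * x"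
  shows "x \<le> y / k"
proof (cases "x > 0")
  case True
  have "(k * x) * x \<le> y * x" using assms(3) by (simp add: power2_eq_square)
  then have "k * x \<le> y" using True by (rule mult_right_le_imp_le)
  then show ?thesis using assms(1) by (simp add: field_simps)
next
  case False
  moreover have "y / k \<ge> 0" using assms by simp
  ultimately show ?thesis by linarith
qed

lemma le_sqrt_if_power2_le:
  fixes x A k m :: real
  assumes "k > 0" "0 \<le> A" "k * x\<^sup>2 \<le> m * A\<^sup>2"
  shows "x \<le> sqrt (m / k) * A"
proof -
  have "x\<^sup>2 \<le> m / k * A\<^sup>2" using assms by (simp add: field_simps)
  then have "x \<le> sqrt (m / k * A\<^sup>2)" by (rule real_le_rsqrt)
  then show ?thesis using assms(2) by (simp only: real_sqrt_mult real_sqrt_abs abs_of_nonneg)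
qed

context bounded_open
begin

text \<open>\<open>X\<close> is the monolithic solution, \<open>Y\<close> the previous and
  \<open>Z\<close> the current iterate, so \<open>d'\<close> and \<open>d\<close> are the old and
  the new error. Only the pressure of \<open>Y\<close> is constrained, since nothing else is passed
  on by a sweep. \<open>a\<close> is the leading BDF2 coefficient, \<open>s\<close> the conductivity
  augmented by the time step, and \<open>A\<close> the old gradient error against which everything
  is measured.\<close>

context
  fixes \<epsilon> \<sigma> \<mu> G lam \<alpha> \<kappa> c0 L \<tau> :: real and \<Gamma>D :: "(real^3) set" and \<T> :: "(real^3) set set"
    and h f :: vecf and g :: scal and X1 X2 X Y Z d d' :: fields and a s \<rho> A :: real
  assumes pos: "\<epsilon> > 0" "\<sigma> > 0" "\<mu> > 0" "G > 0" "lam > 0" "\<alpha> > 0" "\<kappa> > 0" "c0 > 0" "L > 0" "\<tau> > 0"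
    and X12: "X1 \<in> S_space \<Omega> \<Gamma>D \<T>" "X2 \<in> S_space \<Omega> \<Gamma>D \<T>"
    and mono: "monolithic \<epsilon> \<sigma> \<mu> G lam \<alpha> \<kappa> c0 L \<tau> \<Omega> \<Gamma>D \<T> h f g X2 X1 X"
    and Y: "fp Y \<in> P_space \<Omega> \<T>"
    and step1: "decoupling_step1 \<epsilon> \<sigma> \<mu> L \<tau> \<Omega> \<T> h X2 X1 Y Z"
    and step2: "decoupling_step2 G lam \<alpha> \<kappa> c0 L \<tau> \<Omega> \<Gamma>D \<T> f g X2 X1 Z"
  defines "d \<equiv> fields_diff Z X" and "d' \<equiv> fields_diff Y X"
    and "a \<equiv> 3 / (2 * \<tau>)" and "s \<equiv> \<sigma> + 3 * \<epsilon> / (2 * \<tau>)"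
    and "\<rho> \<equiv> L\<^sup>2 / (\<kappa> * (\<sigma> + 3 * \<epsilon> / (2 * \<tau>)))"
    and "A \<equiv> L2_norm \<Omega> (wgrad \<Omega> (fp (fields_diff Y X)))"
begin

section \<open>Error equations\<close>

lemma error_sel:
  "fE d = (\<lambda>x. fE Z x - fE X x)" "fH d = (\<lambda>x. fH Z x - fH X x)" "fu d = (\<lambda>x. fu Z x - fu X x)"
  "f\<xi> d = (\<lambda>x. f\<xi> Z x - f\<xi> X x)" "fp d = (\<lambda>x. fp Z x - fp X x)" "fp d' = (\<lambda>x. fp Y x - fp X x)"
  by (simp_all add: d_def d'_def fields_diff_def)

text \<open>Cited by position below: 1-5 belong to \<open>X\<close>, 6-9 to \<open>X1\<close>, 10-13
  to \<open>X2\<close>, 14-18 to \<open>Z\<close>. The displacement occurs in no time quotient, so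
  its older levels are absent.\<close>

lemma discrete_membership:
  "fE X \<in> E_space \<Omega> \<T>" "fH X \<in> H_space \<Omega> \<T>" "fu X \<in> U_space \<Omega> \<Gamma>D \<T>" "f\<xi> X \<in> W_space \<Omega> \<T>" "fp X \<in> P_space \<Omega> \<T>"
  "fE X1 \<in> E_space \<Omega> \<T>" "fH X1 \<in> H_space \<Omega> \<T>" "f\<xi> X1 \<in> W_space \<Omega> \<T>" "fp X1 \<in> P_space \<Omega> \<T>"
  "fE X2 \<in> E_space \<Omega> \<T>" "fH X2 \<in> H_space \<Omega> \<T>" "f\<xi> X2 \<in> W_space \<Omega> \<T>" "fp X2 \<in> P_space \<Omega> \<T>"
  "fE Z \<in> E_space \<Omega> \<T>" "fH Z \<in> H_space \<Omega> \<T>" "fu Z \<in> U_space \<Omega> \<Gamma>D \<T>" "f\<xi> Z \<in> W_space \<Omega> \<T>" "fp Z \<in> P_space \<Omega> \<T>"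
  using mono step1 step2 X12
  unfolding monolithic_def decoupling_step1_def decoupling_step2_def S_space_def by blast+

lemma error_membership:
  "fE d \<in> E_space \<Omega> \<T>" "fH d \<in> H_space \<Omega> \<T>" "fu d \<in> U_space \<Omega> \<Gamma>D \<T>" "f\<xi> d \<in> W_space \<Omega> \<T>" "fp d \<in> P_space \<Omega> \<T>"
  "fp d' \<in> P_space \<Omega> \<T>"
  unfolding error_sel
  by (intro E_space_diff H_space_diff U_space_diff W_space_diff P_space_diff discrete_membership Y)+

lemma E_space_L2: "D \<in> E_space \<Omega> \<T> \<Longrightarrow> D \<in> L2 \<Omega>"
  by (intro Hcurl_L2 E_space_Hcurl)

lemma P_space_L2: "q \<in> P_space \<Omega> \<T> \<Longrightarrow> q \<in> L2 \<Omega>"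
  by (intro H1_L2 P_space_H1)

lemmas in_L2 = E_space_L2 H_space_L2 W_space_L2 P_space_L2

text \<open>This substep uses the lagged pressure, so the old error \<open>d'\<close> survives on
  the right as the only source.\<close>

lemma error_E:
  assumes D: "D \<in> E_space \<Omega> \<T>"
  shows "s * L2_inner \<Omega> (fE d) D - L2_inner \<Omega> (fH d) (wcurl \<Omega> D) = L * L2_inner \<Omega> (wgrad \<Omega> (fp d')) D"
proof -
  have DL: "D \<in> L2 \<Omega>" "wcurl \<Omega> D \<in> L2 \<Omega>"
    using D by (auto intro: in_L2 wcurl_L2 E_space_Hcurl)
  have 1: "\<epsilon> * L2_inner \<Omega> (bdf2 \<tau> (fE X) (fE X1) (fE X2)) D + \<sigma> * L2_inner \<Omega> (fE X) D
        - L2_inner \<Omega> (fH X) (wcurl \<Omega> D) - L * L2_inner \<Omega> (wgrad \<Omega> (fp X)) D = L2_inner \<Omega> h D"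
    using mono D unfolding monolithic_def by blast
  have 2: "\<epsilon> * L2_inner \<Omega> (bdf2 \<tau> (fE Z) (fE X1) (fE X2)) D + \<sigma> * L2_inner \<Omega> (fE Z) D
        - L2_inner \<Omega> (fH Z) (wcurl \<Omega> D) = L * L2_inner \<Omega> (wgrad \<Omega> (fp Y)) D + L2_inner \<Omega> h D"
    using step1 D unfolding decoupling_step1_def by blast
  have 3: "L2_inner \<Omega> (bdf2 \<tau> (fE Z) (fE X1) (fE X2)) D
      = L2_inner \<Omega> (bdf2 \<tau> (fE X) (fE X1) (fE X2)) D + a * L2_inner \<Omega> (fE d) D"
    using L2_inner_bdf2_diff[of "fE Z" \<Omega> "fE X" "fE X1" "fE X2" D \<tau>] DL
    by (simp add: a_def error_sel in_L2 discrete_membership)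
  have 4: "L2_inner \<Omega> (fE d) D = L2_inner \<Omega> (fE Z) D - L2_inner \<Omega> (fE X) D"
    "L2_inner \<Omega> (fH d) (wcurl \<Omega> D) = L2_inner \<Omega> (fH Z) (wcurl \<Omega> D) - L2_inner \<Omega> (fH X) (wcurl \<Omega> D)"
    "L2_inner \<Omega> (wgrad \<Omega> (fp d')) D = L2_inner \<Omega> (wgrad \<Omega> (fp Y)) D - L2_inner \<Omega> (wgrad \<Omega> (fp X)) D"
    unfolding error_sel
    by (intro L2_inner_diff_left L2_inner_wgrad_diff DL E_space_L2[OF discrete_membership(14)] E_space_L2[OF discrete_membership(1)]
        H_space_L2[OF discrete_membership(15)] H_space_L2[OF discrete_membership(2)] P_space_H1[OF Y] P_space_H1[OF discrete_membership(5)])+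
  have "s = \<sigma> + \<epsilon> * a" by (simp add: s_def a_def)
  then have "s * L2_inner \<Omega> (fE d) D = \<sigma> * L2_inner \<Omega> (fE d) D + \<epsilon> * (a * L2_inner \<Omega> (fE d) D)"
    by (simp add: algebra_simps)
  moreover have "\<epsilon> * (a * L2_inner \<Omega> (fE d) D) = \<epsilon> * L2_inner \<Omega> (bdf2 \<tau> (fE Z) (fE X1) (fE X2)) D
      - \<epsilon> * L2_inner \<Omega> (bdf2 \<tau> (fE X) (fE X1) (fE X2)) D"
    unfolding 3 by (simp add: algebra_simps)
  moreover have "\<sigma> * L2_inner \<Omega> (fE d) D = \<sigma> * L2_inner \<Omega> (fE Z) D - \<sigma> * L2_inner \<Omega> (fE X) D"
    "L * L2_inner \<Omega> (wgrad \<Omega> (fp d')) D = L * L2_inner \<Omega> (wgrad \<Omega> (fp Y)) D - L * L2_inner \<Omega> (wgrad \<Omega> (fp X)) D"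
    unfolding 4 by (simp_all add: algebra_simps)
  ultimately show ?thesis using 1 2 4(2) by linarith
qed

lemma error_H:
  assumes B: "B \<in> H_space \<Omega> \<T>"
  shows "\<mu> * a * L2_inner \<Omega> (fH d) B + L2_inner \<Omega> (wcurl \<Omega> (fE d)) B = 0"
proof -
  have 1: "\<mu> * L2_inner \<Omega> (bdf2 \<tau> (fH X) (fH X1) (fH X2)) B + L2_inner \<Omega> (wcurl \<Omega> (fE X)) B = 0"
    using mono B unfolding monolithic_def by blast
  have 2: "\<mu> * L2_inner \<Omega> (bdf2 \<tau> (fH Z) (fH X1) (fH X2)) B + L2_inner \<Omega> (wcurl \<Omega> (fE Z)) B = 0"
    using step1 B unfolding decoupling_step1_def by blast
  have 3: "a * L2_inner \<Omega> (fH d) B = L2_inner \<Omega> (bdf2 \<tau> (fH Z) (fH X1) (fH X2)) B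
      - L2_inner \<Omega> (bdf2 \<tau> (fH X) (fH X1) (fH X2)) B"
    using L2_inner_bdf2_diff[of "fH Z" \<Omega> "fH X" "fH X1" "fH X2" B \<tau>] H_space_L2[OF B]
    by (simp add: a_def error_sel H_space_L2[OF discrete_membership(2)] H_space_L2[OF discrete_membership(7)]
        H_space_L2[OF discrete_membership(11)] H_space_L2[OF discrete_membership(15)])
  have 4: "L2_inner \<Omega> (wcurl \<Omega> (fE d)) B = L2_inner \<Omega> (wcurl \<Omega> (fE Z)) B - L2_inner \<Omega> (wcurl \<Omega> (fE X)) B"
    unfolding error_sel
    by (intro L2_inner_wcurl_diff E_space_Hcurl[OF discrete_membership(14)] E_space_Hcurl[OF discrete_membership(1)] H_space_L2[OF B])
  show ?thesis using 1 2 unfolding 4 mult.assoc 3 by (simp add: algebra_simps)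
qed

lemma error_u:
  assumes v: "v \<in> U_space \<Omega> \<Gamma>D \<T>"
  shows "G * L2_inner \<Omega> (wjac \<Omega> (fu d)) (wjac \<Omega> v) - L2_inner \<Omega> (f\<xi> d) (wdiv \<Omega> v) = 0"
proof -
  have 1: "G * L2_inner \<Omega> (wjac \<Omega> (fu X)) (wjac \<Omega> v) - L2_inner \<Omega> (f\<xi> X) (wdiv \<Omega> v) = L2_inner \<Omega> f v"
    using mono v unfolding monolithic_def by blast
  have 2: "G * L2_inner \<Omega> (wjac \<Omega> (fu Z)) (wjac \<Omega> v) - L2_inner \<Omega> (f\<xi> Z) (wdiv \<Omega> v) = L2_inner \<Omega> f v"
    using step2 v unfolding decoupling_step2_def by blast
  have 3: "L2_inner \<Omega> (wjac \<Omega> (fu d)) (wjac \<Omega> v)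
      = L2_inner \<Omega> (wjac \<Omega> (fu Z)) (wjac \<Omega> v) - L2_inner \<Omega> (wjac \<Omega> (fu X)) (wjac \<Omega> v)"
    "L2_inner \<Omega> (f\<xi> d) (wdiv \<Omega> v) = L2_inner \<Omega> (f\<xi> Z) (wdiv \<Omega> v) - L2_inner \<Omega> (f\<xi> X) (wdiv \<Omega> v)"
    unfolding error_sel
    by (intro L2_inner_wjac_diff L2_inner_diff_left wjac_L2 wdiv_L2 U_space_H1v[OF v]
        U_space_H1v[OF discrete_membership(16)] U_space_H1v[OF discrete_membership(3)]
        W_space_L2[OF discrete_membership(17)] W_space_L2[OF discrete_membership(4)])+
  show ?thesis using 1 2 unfolding 3 by (simp add: algebra_simps)
qed

lemma error_xi:
  assumes w: "w \<in> W_space \<Omega> \<T>"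
  shows "L2_inner \<Omega> (wdiv \<Omega> (fu d)) w + inverse lam * L2_inner \<Omega> (f\<xi> d) w
    - \<alpha> * inverse lam * L2_inner \<Omega> (fp d) w = 0"
proof -
  have 1: "L2_inner \<Omega> (wdiv \<Omega> (fu X)) w + inverse lam * L2_inner \<Omega> (f\<xi> X) w
        - \<alpha> * inverse lam * L2_inner \<Omega> (fp X) w = 0"
    using mono w unfolding monolithic_def by blast
  have 2: "L2_inner \<Omega> (wdiv \<Omega> (fu Z)) w + inverse lam * L2_inner \<Omega> (f\<xi> Z) w
        - \<alpha> * inverse lam * L2_inner \<Omega> (fp Z) w = 0"
    using step2 w unfolding decoupling_step2_def by blast
  have 3: "L2_inner \<Omega> (wdiv \<Omega> (fu d)) w = L2_inner \<Omega> (wdiv \<Omega> (fu Z)) w - L2_inner \<Omega> (wdiv \<Omega> (fu X)) w"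
    "L2_inner \<Omega> (f\<xi> d) w = L2_inner \<Omega> (f\<xi> Z) w - L2_inner \<Omega> (f\<xi> X) w"
    "L2_inner \<Omega> (fp d) w = L2_inner \<Omega> (fp Z) w - L2_inner \<Omega> (fp X) w"
    unfolding error_sel
    by (intro L2_inner_wdiv_diff L2_inner_diff_left W_space_L2[OF w]
        U_space_H1v[OF discrete_membership(16)] U_space_H1v[OF discrete_membership(3)]
        W_space_L2[OF discrete_membership(17)] W_space_L2[OF discrete_membership(4)]
        P_space_L2[OF discrete_membership(18)] P_space_L2[OF discrete_membership(5)])+
  show ?thesis using 1 2 unfolding 3 by (simp add: algebra_simps)
qed

text \<open>This substep already uses the new electric field, so the source is the new error
  \<open>fE d\<close> and the old one enters only through it.\<close>

lemma error_p:
  assumes q: "q \<in> P_space \<Omega> \<T>"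
  shows "(c0 + \<alpha>\<^sup>2 * inverse lam) * (a * L2_inner \<Omega> (fp d) q) - \<alpha> * inverse lam * (a * L2_inner \<Omega> (f\<xi> d) q)
    + \<kappa> * L2_inner \<Omega> (wgrad \<Omega> (fp d)) (wgrad \<Omega> q) = L * L2_inner \<Omega> (fE d) (wgrad \<Omega> q)"
proof -
  have qL: "q \<in> L2 \<Omega>" "wgrad \<Omega> q \<in> L2 \<Omega>"
    using q by (auto intro: P_space_L2 wgrad_L2 P_space_H1)
  have 1: "(c0 + \<alpha>\<^sup>2 * inverse lam) * L2_inner \<Omega> (bdf2 \<tau> (fp X) (fp X1) (fp X2)) q
        - \<alpha> * inverse lam * L2_inner \<Omega> (bdf2 \<tau> (f\<xi> X) (f\<xi> X1) (f\<xi> X2)) q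
        + \<kappa> * L2_inner \<Omega> (wgrad \<Omega> (fp X)) (wgrad \<Omega> q) - L * L2_inner \<Omega> (fE X) (wgrad \<Omega> q)
        = L2_inner \<Omega> g q"
    using mono q unfolding monolithic_def by blast
  have 2: "(c0 + \<alpha>\<^sup>2 * inverse lam) * L2_inner \<Omega> (bdf2 \<tau> (fp Z) (fp X1) (fp X2)) q
        - \<alpha> * inverse lam * L2_inner \<Omega> (bdf2 \<tau> (f\<xi> Z) (f\<xi> X1) (f\<xi> X2)) q
        + \<kappa> * L2_inner \<Omega> (wgrad \<Omega> (fp Z)) (wgrad \<Omega> q)
        = L * L2_inner \<Omega> (fE Z) (wgrad \<Omega> q) + L2_inner \<Omega> g q"
    using step2 q unfolding decoupling_step2_def by blast
  have 3: "a * L2_inner \<Omega> (fp d) q = L2_inner \<Omega> (bdf2 \<tau> (fp Z) (fp X1) (fp X2)) q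
      - L2_inner \<Omega> (bdf2 \<tau> (fp X) (fp X1) (fp X2)) q"
    unfolding a_def error_sel
    by (intro L2_inner_bdf2_diff[symmetric] P_space_L2[OF discrete_membership(18)] P_space_L2[OF discrete_membership(5)]
        P_space_L2[OF discrete_membership(9)] P_space_L2[OF discrete_membership(13)] qL)
  have 4: "a * L2_inner \<Omega> (f\<xi> d) q = L2_inner \<Omega> (bdf2 \<tau> (f\<xi> Z) (f\<xi> X1) (f\<xi> X2)) q
      - L2_inner \<Omega> (bdf2 \<tau> (f\<xi> X) (f\<xi> X1) (f\<xi> X2)) q"
    unfolding a_def error_sel
    by (intro L2_inner_bdf2_diff[symmetric] W_space_L2[OF discrete_membership(17)] W_space_L2[OF discrete_membership(4)]
        W_space_L2[OF discrete_membership(8)] W_space_L2[OF discrete_membership(12)] qL)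
  have 5: "L2_inner \<Omega> (wgrad \<Omega> (fp d)) (wgrad \<Omega> q)
      = L2_inner \<Omega> (wgrad \<Omega> (fp Z)) (wgrad \<Omega> q) - L2_inner \<Omega> (wgrad \<Omega> (fp X)) (wgrad \<Omega> q)"
    "L2_inner \<Omega> (fE d) (wgrad \<Omega> q) = L2_inner \<Omega> (fE Z) (wgrad \<Omega> q) - L2_inner \<Omega> (fE X) (wgrad \<Omega> q)"
    unfolding error_sel
    by (intro L2_inner_wgrad_diff L2_inner_diff_left qL P_space_H1[OF discrete_membership(18)] P_space_H1[OF discrete_membership(5)]
        E_space_L2[OF discrete_membership(14)] E_space_L2[OF discrete_membership(1)])+
  show ?thesis using 1 2 unfolding 3 4 5 by (simp add: algebra_simps)
qed

section \<open>Energy estimates\<close>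

lemma parameters: "a > 0" "s > 0" "\<rho> > 0" "L\<^sup>2 / s = \<kappa> * \<rho>" "0 \<le> A"
proof -
  show "a > 0" using pos by (simp add: a_def)
  have t: "3 * \<epsilon> / (2 * \<tau>) > 0" using pos by simp
  show s: "s > 0" unfolding s_def by (rule add_pos_pos[OF pos(2) t])
  have \<rho>: "\<rho> = L\<^sup>2 / (\<kappa> * s)" by (simp add: \<rho>_def s_def)
  show "\<rho> > 0" unfolding \<rho> using pos s by simp
  show "L\<^sup>2 / s = \<kappa> * \<rho>" unfolding \<rho> using pos by simp
  show "0 \<le> A" by (simp add: A_def)
qed

text \<open>With the errors themselves as test functions the two curl terms are equal with opposite
  signs and cancel on adding.\<close>

lemma electromagnetic_energy:
  "s * (L2_norm \<Omega> (fE d))\<^sup>2 + \<mu> * a * (L2_norm \<Omega> (fH d))\<^sup>2 \<le> L * A * L2_norm \<Omega> (fE d)"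
proof -
  have "s * (L2_norm \<Omega> (fE d))\<^sup>2 + \<mu> * a * (L2_norm \<Omega> (fH d))\<^sup>2 = L * L2_inner \<Omega> (wgrad \<Omega> (fp d')) (fE d)"
    using error_E[OF error_membership(1)] error_H[OF error_membership(2)]
    by (simp add: L2_norm_power2 L2_inner_commute[of _ "fH d" "wcurl \<Omega> (fE d)"])
  also have "\<dots> \<le> L * (A * L2_norm \<Omega> (fE d))"
    unfolding A_def d'_def[symmetric] using pos error_membership
    by (intro mult_left_mono L2_Cauchy_Schwarz wgrad_L2 P_space_H1 E_space_L2) auto
  finally show ?thesis by (simp add: mult.assoc)
qed

lemma error_E_bound: "L2_norm \<Omega> (fE d) \<le> L / s * A"
proof -
  have "0 \<le> \<mu> * a * (L2_norm \<Omega> (fH d))\<^sup>2" using parameters pos by simp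
  then have "s * (L2_norm \<Omega> (fE d))\<^sup>2 \<le> L * A * L2_norm \<Omega> (fE d)"
    using electromagnetic_energy by linarith
  then have "L2_norm \<Omega> (fE d) \<le> L * A / s"
    using parameters pos by (intro le_if_power2_le_mult) auto
  then show ?thesis by simp
qed

text \<open>The electric energy is dropped and the bound on \<open>fE d\<close> inserted on the
  right, which yields L^2/s = \<kappa>\<rho> times A^2.\<close>

lemma error_H_bound: "L2_norm \<Omega> (fH d) \<le> sqrt (\<kappa> * \<rho> / (\<mu> * a)) * A"
proof (rule le_sqrt_if_power2_le)
  have "0 \<le> s * (L2_norm \<Omega> (fE d))\<^sup>2" using parameters by simp
  then have "\<mu> * a * (L2_norm \<Omega> (fH d))\<^sup>2 \<le> L * A * L2_norm \<Omega> (fE d)"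
    using electromagnetic_energy by linarith
  also have "\<dots> \<le> L * A * (L / s * A)"
    using error_E_bound parameters pos by (intro mult_left_mono) auto
  also have "\<dots> = L\<^sup>2 / s * A\<^sup>2" by (simp add: power2_eq_square)
  finally show "\<mu> * a * (L2_norm \<Omega> (fH d))\<^sup>2 \<le> \<kappa> * \<rho> * A\<^sup>2"
    by (simp add: parameters(4))
qed (use parameters pos in simp_all)

text \<open>The divergence terms cancel between the displacement and \<xi> equations, leaving
  -\<alpha>/lam (e_p, e_\<xi>). Weighted by \<open>a\<close>, this matches the cross term of the
  pressure equation, and both are absorbed by a square.\<close>

lemma poroelastic_energy:
  "a * c0 * (L2_norm \<Omega> (fp d))\<^sup>2 + a * G * (L2_norm \<Omega> (wjac \<Omega> (fu d)))\<^sup>2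
    + \<kappa> * (L2_norm \<Omega> (wgrad \<Omega> (fp d)))\<^sup>2 \<le> \<kappa> * \<rho> * A * L2_norm \<Omega> (wgrad \<Omega> (fp d))"
proof -
  define P W J PW where "P = L2_inner \<Omega> (fp d) (fp d)" and "W = L2_inner \<Omega> (f\<xi> d) (f\<xi> d)"
    and "J = L2_inner \<Omega> (wjac \<Omega> (fu d)) (wjac \<Omega> (fu d))" and "PW = L2_inner \<Omega> (fp d) (f\<xi> d)"
  have dp: "fp d \<in> L2 \<Omega>" "wgrad \<Omega> (fp d) \<in> L2 \<Omega>" and dE: "fE d \<in> L2 \<Omega>" and d\<xi>: "f\<xi> d \<in> L2 \<Omega>"
    using error_membership by (auto intro: in_L2 wgrad_L2 P_space_H1)
  have J: "G * J + inverse lam * W - \<alpha> * inverse lam * PW = 0"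
    using error_u[OF error_membership(3)] error_xi[OF error_membership(4)]
    by (simp add: J_def W_def PW_def L2_inner_commute[of _ "f\<xi> d" "wdiv \<Omega> (fu d)"])
  have p: "(c0 + \<alpha>\<^sup>2 * inverse lam) * (a * P) - \<alpha> * inverse lam * (a * PW)
      + \<kappa> * (L2_norm \<Omega> (wgrad \<Omega> (fp d)))\<^sup>2 = L * L2_inner \<Omega> (fE d) (wgrad \<Omega> (fp d))"
    using error_p[OF error_membership(5)]
    by (simp add: P_def PW_def L2_norm_power2 L2_inner_commute[of _ "f\<xi> d" "fp d"])
  have sq: "0 \<le> \<alpha>\<^sup>2 * P - 2 * \<alpha> * PW + W"
  proof -
    have "0 \<le> L2_inner \<Omega> (\<lambda>x. \<alpha> *\<^sub>R fp d x - f\<xi> d x) (\<lambda>x. \<alpha> *\<^sub>R fp d x - f\<xi> d x)"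
      by (rule L2_inner_nonneg)
    also have "\<dots> = L2_inner \<Omega> (\<lambda>x. \<alpha> *\<^sub>R fp d x) (\<lambda>x. \<alpha> *\<^sub>R fp d x)
        - 2 * L2_inner \<Omega> (\<lambda>x. \<alpha> *\<^sub>R fp d x) (f\<xi> d) + W"
      unfolding W_def by (intro L2_inner_diff_self L2_scaleR dp d\<xi>)
    also have "L2_inner \<Omega> (\<lambda>x. \<alpha> *\<^sub>R fp d x) (\<lambda>x. \<alpha> *\<^sub>R fp d x) = \<alpha>\<^sup>2 * P"
      unfolding P_def L2_inner_scaleR_left by (subst L2_inner_commute)
        (simp only: L2_inner_scaleR_left power2_eq_square mult.assoc)
    finally show ?thesis by (simp only: L2_inner_scaleR_left PW_def mult.assoc)
  qed
  \<comment> \<open>Completing the square: each of the two identities contributes one of the two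
    copies of the mixed product \<open>PW\<close>.\<close>
  have "a * c0 * P + a * G * J + a * inverse lam * (\<alpha>\<^sup>2 * P - 2 * \<alpha> * PW + W)
      + \<kappa> * (L2_norm \<Omega> (wgrad \<Omega> (fp d)))\<^sup>2
    = ((c0 + \<alpha>\<^sup>2 * inverse lam) * (a * P) - \<alpha> * inverse lam * (a * PW)
      + \<kappa> * (L2_norm \<Omega> (wgrad \<Omega> (fp d)))\<^sup>2) + a * (G * J + inverse lam * W - \<alpha> * inverse lam * PW)"
    by (simp add: algebra_simps)
  also have "\<dots> = L * L2_inner \<Omega> (fE d) (wgrad \<Omega> (fp d))"
    unfolding J p by simp
  also have "\<dots> \<le> L * (L2_norm \<Omega> (fE d) * L2_norm \<Omega> (wgrad \<Omega> (fp d)))"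
    using pos by (intro mult_left_mono L2_Cauchy_Schwarz dE dp) auto
  also have "\<dots> \<le> L * (L / s * A * L2_norm \<Omega> (wgrad \<Omega> (fp d)))"
    using pos error_E_bound by (intro mult_left_mono mult_right_mono) auto
  also have "\<dots> = L\<^sup>2 / s * A * L2_norm \<Omega> (wgrad \<Omega> (fp d))"
    by (simp add: power2_eq_square)
  finally have "a * c0 * P + a * G * J + a * inverse lam * (\<alpha>\<^sup>2 * P - 2 * \<alpha> * PW + W)
      + \<kappa> * (L2_norm \<Omega> (wgrad \<Omega> (fp d)))\<^sup>2 \<le> \<kappa> * \<rho> * A * L2_norm \<Omega> (wgrad \<Omega> (fp d))"
    by (simp only: parameters(4))
  moreover have "0 \<le> a * inverse lam * (\<alpha>\<^sup>2 * P - 2 * \<alpha> * PW + W)"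
    using sq parameters(1) pos by (intro mult_nonneg_nonneg) auto
  ultimately show ?thesis
    unfolding L2_norm_power2 P_def[symmetric] J_def[symmetric] by linarith
qed

lemma error_grad_p_bound: "L2_norm \<Omega> (wgrad \<Omega> (fp d)) \<le> \<rho> * A"
proof -
  have "0 \<le> a * c0 * (L2_norm \<Omega> (fp d))\<^sup>2" "0 \<le> a * G * (L2_norm \<Omega> (wjac \<Omega> (fu d)))\<^sup>2"
    using parameters pos by simp_all
  then have "\<kappa> * (L2_norm \<Omega> (wgrad \<Omega> (fp d)))\<^sup>2 \<le> \<kappa> * \<rho> * A * L2_norm \<Omega> (wgrad \<Omega> (fp d))"
    using poroelastic_energy by linarith
  then have "L2_norm \<Omega> (wgrad \<Omega> (fp d)) \<le> \<kappa> * \<rho> * A / \<kappa>"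
    by (rule le_if_power2_le_mult[rotated 2]) (use parameters pos in simp_all)
  then show ?thesis using pos by simp
qed

text \<open>Inserting the gradient bound on the right makes the estimate quadratic in A; square
  roots then give bounds linear in A.\<close>

lemma poroelastic_energy':
  "a * c0 * (L2_norm \<Omega> (fp d))\<^sup>2 + a * G * (L2_norm \<Omega> (wjac \<Omega> (fu d)))\<^sup>2 \<le> \<kappa> * \<rho>\<^sup>2 * A\<^sup>2"
proof -
  have "0 \<le> \<kappa> * (L2_norm \<Omega> (wgrad \<Omega> (fp d)))\<^sup>2" using pos by simp
  then have "a * c0 * (L2_norm \<Omega> (fp d))\<^sup>2 + a * G * (L2_norm \<Omega> (wjac \<Omega> (fu d)))\<^sup>2
      \<le> \<kappa> * \<rho> * A * L2_norm \<Omega> (wgrad \<Omega> (fp d))"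
    using poroelastic_energy by linarith
  also have "\<dots> \<le> \<kappa> * \<rho> * A * (\<rho> * A)"
    using error_grad_p_bound parameters pos by (intro mult_left_mono) auto
  finally show ?thesis by (simp add: power2_eq_square mult_ac)
qed

lemma error_p_bound: "L2_norm \<Omega> (fp d) \<le> sqrt (\<kappa> * \<rho>\<^sup>2 / (a * c0)) * A"
proof (rule le_sqrt_if_power2_le)
  have "0 \<le> a * G * (L2_norm \<Omega> (wjac \<Omega> (fu d)))\<^sup>2" using parameters pos by simp
  then show "a * c0 * (L2_norm \<Omega> (fp d))\<^sup>2 \<le> \<kappa> * \<rho>\<^sup>2 * A\<^sup>2"
    using poroelastic_energy' by linarith
qed (use parameters pos in simp_all)

lemma error_jac_u_bound: "L2_norm \<Omega> (wjac \<Omega> (fu d)) \<le> sqrt (\<kappa> * \<rho>\<^sup>2 / (a * G)) * A"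
proof (rule le_sqrt_if_power2_le)
  have "0 \<le> a * c0 * (L2_norm \<Omega> (fp d))\<^sup>2" using parameters pos by simp
  then show "a * G * (L2_norm \<Omega> (wjac \<Omega> (fu d)))\<^sup>2 \<le> \<kappa> * \<rho>\<^sup>2 * A\<^sup>2"
    using poroelastic_energy' by linarith
qed (use parameters pos in simp_all)

text \<open>The displacement and \<xi> equations alone suffice: their divergence terms cancel, and
  after dropping the elastic energy one factor of the norm of \<open>f\<xi> d\<close> divides
  out.\<close>

lemma error_xi_bound: "L2_norm \<Omega> (f\<xi> d) \<le> \<alpha> * L2_norm \<Omega> (fp d)"
proof -
  have "G * (L2_norm \<Omega> (wjac \<Omega> (fu d)))\<^sup>2 + inverse lam * (L2_norm \<Omega> (f\<xi> d))\<^sup>2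
      = inverse lam * (\<alpha> * L2_inner \<Omega> (fp d) (f\<xi> d))"
    using error_u[OF error_membership(3)] error_xi[OF error_membership(4)]
    by (simp add: L2_norm_power2 L2_inner_commute[of _ "f\<xi> d" "wdiv \<Omega> (fu d)"] mult_ac)
  moreover have "0 \<le> G * (L2_norm \<Omega> (wjac \<Omega> (fu d)))\<^sup>2" using pos by simp
  ultimately have "inverse lam * (L2_norm \<Omega> (f\<xi> d))\<^sup>2 \<le> inverse lam * (\<alpha> * L2_inner \<Omega> (fp d) (f\<xi> d))"
    by linarith
  then have "(L2_norm \<Omega> (f\<xi> d))\<^sup>2 \<le> \<alpha> * L2_inner \<Omega> (fp d) (f\<xi> d)"
    using pos by simp
  also have "\<dots> \<le> \<alpha> * (L2_norm \<Omega> (fp d) * L2_norm \<Omega> (f\<xi> d))"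
    using pos error_membership by (intro mult_left_mono L2_Cauchy_Schwarz P_space_L2 W_space_L2) auto
  finally have "1 * (L2_norm \<Omega> (f\<xi> d))\<^sup>2 \<le> (\<alpha> * L2_norm \<Omega> (fp d)) * L2_norm \<Omega> (f\<xi> d)"
    by (simp add: mult.assoc)
  then have "L2_norm \<Omega> (f\<xi> d) \<le> (\<alpha> * L2_norm \<Omega> (fp d)) / 1"
    using pos by (intro le_if_power2_le_mult) auto
  then show ?thesis by simp
qed

text \<open>The memberships of both displacements are exported too, because Poincare's inequality is
  applied to their difference outside this context.\<close>

lemmas error_bounds = error_grad_p_bound error_E_bound error_H_bound error_p_bound error_jac_u_bound
  error_xi_bound discrete_membership(16,3)

end

end

section \<open>Contraction and geometric decay\<close>

theorem theorem3:
  fixes \<epsilon> \<sigma> \<mu> G lam \<alpha> \<kappa> c0 L \<tau> :: real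
    and \<Omega> \<Gamma>D \<Gamma>N :: "(real^3) set"
    and \<MM> :: "(real^3) set set set" and \<T> :: "(real^3) set set"
    and hs fs :: "nat \<Rightarrow> real^3 \<Rightarrow> real^3" and gs :: "nat \<Rightarrow> real^3 \<Rightarrow> real"
    and X Z :: "nat \<Rightarrow> fields" and n :: nat
  defines "e \<equiv> \<lambda>i. fields_diff (Z i) (X n)"
  assumes "lipschitz_polyhedron \<Omega>" and "boundary_parts \<Omega> \<Gamma>D \<Gamma>N"
    and "\<forall>\<S>\<in>\<MM>. tetrahedral_partition \<Omega> \<S>" and "shape_regular \<MM>"
    and "\<exists>\<beta>>0. \<forall>\<S>\<in>\<MM>. inf_sup \<beta> \<Omega> \<Gamma>D \<S>"
    and "\<T> \<in> \<MM>"
    and "\<epsilon> > 0" "\<sigma> > 0" "\<mu> > 0" "G > 0" "lam > 0" "\<alpha> > 0" "\<kappa> > 0" "c0 > 0"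
    and "0 < L" "L < sqrt (\<sigma> * \<kappa>)" and "\<tau> > 0" and "n \<ge> 2"
    and "hs n \<in> L2 \<Omega>" "fs n \<in> L2 \<Omega>" "gs n \<in> L2 \<Omega>"
    and "X (n - 1) \<in> S_space \<Omega> \<Gamma>D \<T>" "X (n - 2) \<in> S_space \<Omega> \<Gamma>D \<T>"
    and "monolithic \<epsilon> \<sigma> \<mu> G lam \<alpha> \<kappa> c0 L \<tau> \<Omega> \<Gamma>D \<T> (hs n) (fs n) (gs n)
           (X (n - 2)) (X (n - 1)) (X n)"
    and "decoupling_sequence \<epsilon> \<sigma> \<mu> G lam \<alpha> \<kappa> c0 L \<tau> \<Omega> \<Gamma>D \<T> (hs n) (fs n) (gs n)
           (X (n - 2)) (X (n - 1)) Z"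
  shows "(\<forall>i\<ge>1. L2_norm \<Omega> (wgrad \<Omega> (fp (e i)))
              \<le> L\<^sup>2 / (\<kappa> * (\<sigma> + 3 * \<epsilon> / (2 * \<tau>))) * L2_norm \<Omega> (wgrad \<Omega> (fp (e (i - 1)))))
       \<and> L\<^sup>2 / (\<kappa> * (\<sigma> + 3 * \<epsilon> / (2 * \<tau>))) < 1
       \<and> (\<exists>C\<ge>0. \<exists>r. 0 \<le> r \<and> r < 1 \<and> (\<forall>i\<ge>1.
             L2_norm \<Omega> (fE (e i)) \<le> C * r ^ i \<and>
             L2_norm \<Omega> (fH (e i)) \<le> C * r ^ i \<and>
             H1v_norm \<Omega> (fu (e i)) \<le> C * r ^ i \<and>
             L2_norm \<Omega> (f\<xi> (e i)) \<le> C * r ^ i \<and>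
             H1_norm \<Omega> (fp (e i)) \<le> C * r ^ i))"
proof -
  have poly: "lipschitz_polyhedron \<Omega>" and parts: "boundary_parts \<Omega> \<Gamma>D \<Gamma>N" by fact+
  interpret bounded_open \<Omega>
    using poly by unfold_locales (auto simp: lipschitz_polyhedron_def)
  have conn: "connected \<Omega>" using poly by (simp add: lipschitz_polyhedron_def)
  have part: "tetrahedral_partition \<Omega> \<T>" using assms(4,7) by blast
  \<comment> \<open>Supplies the point at which the displacement errors vanish.\<close>
  have "\<Gamma>D \<noteq> {}" "\<Gamma>D \<subseteq> frontier \<Omega>"
    using parts openin_imp_subset unfolding boundary_parts_def by blast+
  then have "\<Gamma>D \<inter> closure \<Omega> \<noteq> {}" by (auto simp: frontier_def)
  from discrete_Poincare[OF conn part this] obtain CP where CP: "CP \<ge> 0"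
    "\<And>v. v \<in> U_space \<Omega> \<Gamma>D \<T> \<Longrightarrow> L2_norm \<Omega> v \<le> CP * L2_norm \<Omega> (wjac \<Omega> v)"
    by (elim exE conjE) (rule that, assumption, erule (1) bspec)

  define s where "s = \<sigma> + 3 * \<epsilon> / (2 * \<tau>)"
  define a where "a = 3 / (2 * \<tau>)"
  define \<rho> where "\<rho> = L\<^sup>2 / (\<kappa> * (\<sigma> + 3 * \<epsilon> / (2 * \<tau>)))"
  define M where "M i = L2_norm \<Omega> (wgrad \<Omega> (fp (e i)))" for i
  note pos = \<open>\<epsilon> > 0\<close> \<open>\<sigma> > 0\<close> \<open>\<mu> > 0\<close> \<open>G > 0\<close> \<open>lam > 0\<close> \<open>\<alpha> > 0\<close> \<open>\<kappa> > 0\<close> \<open>c0 > 0\<close> \<open>0 < L\<close> \<open>\<tau> > 0\<close>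
  have t: "3 * \<epsilon> / (2 * \<tau>) > 0" using pos by simp
  have s: "s > \<sigma>" "s > 0" unfolding s_def using t pos(2) by linarith+
  have \<rho>_s: "\<rho> = L\<^sup>2 / (\<kappa> * s)" by (simp add: \<rho>_def s_def)
  have \<rho>0: "\<rho> > 0" unfolding \<rho>_s using pos s by simp
  \<comment> \<open>Two strict inequalities: L^2 < \<kappa>\<sigma> by the coupling condition, and
    \<kappa>\<sigma> < \<kappa>s by the positive contribution of the time step.\<close>
  have "L\<^sup>2 < (sqrt (\<sigma> * \<kappa>))\<^sup>2"
    using \<open>L < sqrt (\<sigma> * \<kappa>)\<close> pos by (intro power_strict_mono) auto
  also have "\<dots> = \<kappa> * \<sigma>" using pos by (simp add: mult.commute)
  also have "\<dots> < \<kappa> * s" using s(1) pos(7) by (rule mult_strict_left_mono)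
  finally have \<rho>1: "\<rho> < 1" unfolding \<rho>_s using pos s by simp

  have Z0: "Z 0 = X (n - 1)"
    and steps: "\<And>i. i \<ge> 1 \<Longrightarrow> decoupling_step1 \<epsilon> \<sigma> \<mu> L \<tau> \<Omega> \<T> (hs n) (X (n - 2)) (X (n - 1)) (Z (i - 1)) (Z i)"
      "\<And>i. i \<ge> 1 \<Longrightarrow> decoupling_step2 G lam \<alpha> \<kappa> c0 L \<tau> \<Omega> \<Gamma>D \<T> (fs n) (gs n) (X (n - 2)) (X (n - 1)) (Z i)"
    using assms(26) unfolding decoupling_sequence_def by blast+
  \<comment> \<open>At index 0 membership comes from the initialization by the previous time level,
    afterwards from the second substep.\<close>
  have fpZ: "fp (Z i) \<in> P_space \<Omega> \<T>" for i
  proof (cases "i = 0")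
    case True
    then show ?thesis using Z0 assms(23) by (simp add: S_space_def)
  next
    case False
    then have "i \<ge> 1" by simp
    from steps(2)[OF this] show ?thesis unfolding decoupling_step2_def by blast
  qed

  define C1 C2 C3 C4 where "C1 = L / s" and "C2 = sqrt (\<kappa> * \<rho> / (\<mu> * a))"
    and "C3 = sqrt (\<kappa> * \<rho>\<^sup>2 / (a * c0))" and "C4 = sqrt (\<kappa> * \<rho>\<^sup>2 / (a * G))"
  have a: "a > 0" using pos by (simp add: a_def)
  have C: "C1 \<ge> 0" "C2 \<ge> 0" "C3 \<ge> 0" "C4 \<ge> 0"
    using pos s a \<rho>0 by (simp_all add: C1_def C2_def C3_def C4_def)
  have bounds: "M i \<le> \<rho> * M (i - 1)" "L2_norm \<Omega> (fE (e i)) \<le> C1 * M (i - 1)"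
    "L2_norm \<Omega> (fH (e i)) \<le> C2 * M (i - 1)" "L2_norm \<Omega> (fp (e i)) \<le> C3 * M (i - 1)"
    "L2_norm \<Omega> (wjac \<Omega> (fu (e i))) \<le> C4 * M (i - 1)"
    "L2_norm \<Omega> (f\<xi> (e i)) \<le> \<alpha> * L2_norm \<Omega> (fp (e i))" "fu (e i) \<in> U_space \<Omega> \<Gamma>D \<T>"
    if i: "i \<ge> 1" for i
  proof -
    \<comment> \<open>The sweep estimates with \<open>Z (i - 1)\<close> as previous and
      \<open>Z i\<close> as current iterate.\<close>
    note eb = error_bounds[OF pos assms(23) assms(24) assms(25) fpZ steps(1)[OF i] steps(2)[OF i]]
    show "M i \<le> \<rho> * M (i - 1)" "L2_norm \<Omega> (fE (e i)) \<le> C1 * M (i - 1)"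
      "L2_norm \<Omega> (fH (e i)) \<le> C2 * M (i - 1)" "L2_norm \<Omega> (fp (e i)) \<le> C3 * M (i - 1)"
      "L2_norm \<Omega> (wjac \<Omega> (fu (e i))) \<le> C4 * M (i - 1)"
      "L2_norm \<Omega> (f\<xi> (e i)) \<le> \<alpha> * L2_norm \<Omega> (fp (e i))"
      unfolding M_def e_def C1_def C2_def C3_def C4_def s_def a_def \<rho>_def by (rule eb)+
    show "fu (e i) \<in> U_space \<Omega> \<Gamma>D \<T>"
      using U_space_diff[OF eb(7,8)] by (simp add: e_def fields_diff_def)
  qed
  have M0: "M i \<ge> 0" for i by (simp add: M_def)
  have M_pow: "M i \<le> \<rho> ^ i * M 0" for i
  proof (induction i)
    case (Suc i)
    have "M (Suc i) \<le> \<rho> * M i" using bounds(1)[of "Suc i"] by simp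
    also have "\<dots> \<le> \<rho> * (\<rho> ^ i * M 0)" using Suc \<rho>0 by (intro mult_left_mono) auto
    finally show ?case by (simp add: mult.assoc)
  qed simp
  \<comment> \<open>One summand for each of the five norms; all are nonnegative, so B dominates each
    of them.\<close>
  define B where "B = C1 + C2 + (CP + 1) * C4 + \<alpha> * C3 + (C3 + \<rho>)"
  have nonneg: "0 \<le> (CP + 1) * C4" "0 \<le> \<alpha> * C3" using C CP pos by simp_all
  have B: "C1 \<le> B" "C2 \<le> B" "(CP + 1) * C4 \<le> B" "\<alpha> * C3 \<le> B" "C3 + \<rho> \<le> B" "B \<ge> 0"
    unfolding B_def using C nonneg \<rho>0 by linarith+
  \<comment> \<open>Iterate i is bounded through \<open>M (i - 1)\<close>, hence by the power i - 1
    of \<rho>; dividing by \<rho>, which is positive, restores the exponent i.\<close>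
  define K where "K = B * M 0 / \<rho>"
  have K: "K \<ge> 0" using B M0 \<rho>0 by (simp add: K_def)
  have geo: "x \<le> K * \<rho> ^ i" if i: "i \<ge> 1" and x: "x \<le> c * M (i - 1)" "c \<le> B" for x c i
  proof -
    have "c * M (i - 1) \<le> B * M (i - 1)" using x(2) M0 by (rule mult_right_mono)
    also have "\<dots> \<le> B * (\<rho> ^ (i - 1) * M 0)" using M_pow B(6) by (rule mult_left_mono)
    also have "\<dots> = K * \<rho> ^ i"
      using i \<rho>0 by (cases i) (simp_all add: K_def)
    finally show ?thesis using x(1) by linarith
  qed
  have "L2_norm \<Omega> (fE (e i)) \<le> K * \<rho> ^ i \<and> L2_norm \<Omega> (fH (e i)) \<le> K * \<rho> ^ i \<and>
      H1v_norm \<Omega> (fu (e i)) \<le> K * \<rho> ^ i \<and> L2_norm \<Omega> (f\<xi> (e i)) \<le> K * \<rho> ^ i \<and>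
      H1_norm \<Omega> (fp (e i)) \<le> K * \<rho> ^ i" if i: "i \<ge> 1" for i
  proof (intro conjI)
    show "L2_norm \<Omega> (fE (e i)) \<le> K * \<rho> ^ i" by (rule geo[OF i bounds(2)[OF i] B(1)])
    show "L2_norm \<Omega> (fH (e i)) \<le> K * \<rho> ^ i" by (rule geo[OF i bounds(3)[OF i] B(2)])
    \<comment> \<open>The L2 part costs the factor \<open>CP\<close> and the Jacobian the factor 1,
      hence \<open>CP + 1\<close>.\<close>
    have "H1v_norm \<Omega> (fu (e i)) \<le> L2_norm \<Omega> (fu (e i)) + L2_norm \<Omega> (wjac \<Omega> (fu (e i)))"
      unfolding H1v_norm_def by (rule sqrt_sum_squares_le_sum) simp_all
    also have "\<dots> \<le> (CP + 1) * L2_norm \<Omega> (wjac \<Omega> (fu (e i)))"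
      using CP(2)[OF bounds(7)[OF i]] by (simp add: algebra_simps)
    also have "\<dots> \<le> (CP + 1) * (C4 * M (i - 1))"
      using bounds(5)[OF i] CP(1) by (intro mult_left_mono) auto
    finally have "H1v_norm \<Omega> (fu (e i)) \<le> (CP + 1) * C4 * M (i - 1)" by (simp only: mult.assoc)
    then show "H1v_norm \<Omega> (fu (e i)) \<le> K * \<rho> ^ i" by (rule geo[OF i _ B(3)])
    have "\<alpha> * L2_norm \<Omega> (fp (e i)) \<le> \<alpha> * (C3 * M (i - 1))"
      using bounds(4)[OF i] pos(6) by (intro mult_left_mono) auto
    then have "L2_norm \<Omega> (f\<xi> (e i)) \<le> \<alpha> * C3 * M (i - 1)"
      using bounds(6)[OF i] by (simp only: mult.assoc)
    then show "L2_norm \<Omega> (f\<xi> (e i)) \<le> K * \<rho> ^ i" by (rule geo[OF i _ B(4)])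
    \<comment> \<open>The storage term with c0 bounds the L2 part and the contraction the gradient,
      hence \<open>C3 + \<rho>\<close>.\<close>
    have "H1_norm \<Omega> (fp (e i)) \<le> L2_norm \<Omega> (fp (e i)) + M i"
      unfolding H1_norm_def M_def by (rule sqrt_sum_squares_le_sum) simp_all
    also have "\<dots> \<le> (C3 + \<rho>) * M (i - 1)"
      using bounds(1,4)[OF i] by (simp add: distrib_right)
    finally show "H1_norm \<Omega> (fp (e i)) \<le> K * \<rho> ^ i" by (rule geo[OF i _ B(5)])
  qed
  then show ?thesis
    using bounds(1) \<rho>0 \<rho>1 K unfolding M_def \<rho>_def[symmetric]
    by (intro conjI allI impI exI[of _ K] exI[of _ \<rho>]) auto
qed

end
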